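(* Let $m$ be the number of left-invariant vector fields $X_j$ of homogeneity one (i.e. those with $d_j=1$, namely $X_1,\dots,X_m$). Suppose the fixed homogeneous norm $|g|$ is a radial function of the coordinates $(x_1,\dots,x_m)$ of homogeneity one, i.e. its dependence on these coordinates is only as a smooth function of $x_1^2+\dots+x_m^2$ on $x_1^2+\dots+x_m^2\ne 0$. Then for every $u\in C_0^\infty(\mathbb G)$, $$\lim_{s\to 1-}\frac{2m(1-s)}{\tau_m}\|u\|^2_{\mathcal{D}^{s,2}(\mathbb G)}=\int_{\mathbb G}\sum_{i=1}^m|X_iu(g)|^2\,dg$$ and $$\lim_{s\to 0+}\frac{s}{\sigma_Q}\|u\|^2_{\mathcal{D}^{s,2}(\mathbb G)}=\int_{\mathbb G}|u(g)|^2\,dg .$$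
   Context: $\mathbb G$ is a homogeneous group: a connected, simply connected nilpotent Lie group whose Lie algebra $\mathfrak g$ carries a family of automorphisms (dilations) $\{\Delta_\lambda\}_{\lambda>0}$ for which there are a basis $X_1,\dots,X_n$ of $\mathfrak g$ and reals $1=d_1\le d_2\le\dots\le d_n$ with $\Delta_\lambda X_j=\lambda^{d_j}X_j$. The group is not assumed to be Carnot (stratified), and the $X_j$ with $d_j=1$ need not generate $\mathfrak g$. Group dilations are $\delta_\lambda=\exp\circ\Delta_\lambda\circ\exp^{-1}$, and $Q=d_1+\dots+d_n$ is the homogeneous dimension. $dg$ (or $dh$) is a fixed bi-invariant Haar measure (the push-forward of Lebesgue measure on $\mathfrak g$ under $\exp$), so $d(\delta_\lambda g)=\lambda^Q dg$. $|\cdot|$ is a fixed homogeneous norm: $|\cdot|\in C(\mathbb G)\cap C^\infty(\mathbb G\setminus\{e\})$ ($e$ the identity), $|g|\ge 0$ with $|g|=0$ iff $g=e$, $|g^{-1}|=|g|$, $|\delta_\lambda g|=\lambda|g|$, and $|gh|\le|g|+|h|$. $X_j$ also denotes the left-invariant vector field $(X_jf)(g)=\frac{d}{dt}f(g\exp(tX_j))|_{t=0}$. Coordinates $x_1,\dots,x_n$ on $\mathbb G$ are defined by $\exp^{-1}g=\sum_j x_j(g)X_j$. $d\sigma$ is the unique Radon measure on $\{|h|=1\}$ with $\int_{\mathbb G}u(h)\,dh=\int_0^\infty\int_{|h|=1}u(\delta_r h)\,r^{Q-1}\,d\sigma(h)\,dr$ for all $u\in L^1(\mathbb G)$; $\sigma_Q=\int_{|h|=1}d\sigma(h)$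 and $\tau_m=\int_{|h|=1}\sum_{i=1}^m|x_i(h)|^2\,d\sigma(h)$. For $0<s<1$, $$\|u\|^2_{\mathcal{D}^{s,2}(\mathbb G)}=\int_{\mathbb G}\int_{\mathbb G}\frac{|u(g)-u(h)|^2}{|h^{-1}g|^{Q+2s}}\,dg\,dh .$$ *)

theory Defs
  imports "HOL-Analysis.Analysis" "HOL-Algebra.Group"
begin

section \<open>Smooth functions on open subsets of a vector space\<close>

text \<open>Meaningful for open \<open>S\<close> only. On a finite-dimensional space, \<open>f\<close> is of class \<open>C\<^sup>k\<^sup>+\<^sup>1\<close> iff it is
  differentiable and all its directional derivatives are of class \<open>C\<^sup>k\<close>.\<close>

primrec Ck_on :: "nat \<Rightarrow> 'a::euclidean_space set \<Rightarrow> ('a \<Rightarrow> 'b::real_normed_vector) \<Rightarrow> bool" where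
  "Ck_on 0 S f \<longleftrightarrow> continuous_on S f"
| "Ck_on (Suc k) S f \<longleftrightarrow> (\<forall>x\<in>S. f differentiable at x) \<and>
     (\<forall>v. Ck_on k S (\<lambda>x. frechet_derivative f (at x) v))"

definition smooth_on :: "'a::euclidean_space set \<Rightarrow> ('a \<Rightarrow> 'b::real_normed_vector) \<Rightarrow> bool" where
  "smooth_on S f \<longleftrightarrow> (\<forall>k. Ck_on k S f)"


section \<open>Nilpotent Lie algebras\<close>

locale lie_algebra =
  fixes br :: "'a::euclidean_space \<Rightarrow> 'a \<Rightarrow> 'a"
  assumes bilinear_br: "bilinear br"
    and br_self: "br x x = 0"
    and jacobi: "br x (br y z) + br y (br z x) + br z (br x y) = 0"

primrec lower_central :: "('a::euclidean_space \<Rightarrow> 'a \<Rightarrow> 'a) \<Rightarrow> nat \<Rightarrow> 'a set" where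
  "lower_central br 0 = UNIV"
| "lower_central br (Suc k) = span {br x y | x y. y \<in> lower_central br k}"

locale nilpotent_lie_algebra = lie_algebra +
  assumes nilpotent: "\<exists>k. lower_central br k = {0}"


section \<open>Homogeneous groups\<close>

text \<open>The Lie algebra is an arbitrary finite-dimensional real vector space, the type \<open>'a\<close>. Its inner
  product enters only through the normalisation of Lebesgue measure, and the basis \<open>frame\<close> below is
  not assumed orthonormal.\<close>

record ('g, 'a) homogeneous_group_data = "'g monoid" +
  bracket  :: "'a \<Rightarrow> 'a \<Rightarrow> 'a"
  exp_map  :: "'a \<Rightarrow> 'g"
  dil      :: "real \<Rightarrow> 'a \<Rightarrow> 'a"
  frame    :: "nat \<Rightarrow> 'a"
  weight   :: "nat \<Rightarrow> real"

definition log_map :: "('g, 'a::euclidean_space) homogeneous_group_data \<Rightarrow> 'g \<Rightarrow> 'a" where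
  "log_map G = inv_into UNIV (exp_map G)"

definition smooth_fun :: "('g, 'a::euclidean_space) homogeneous_group_data \<Rightarrow> ('g \<Rightarrow> real) \<Rightarrow> bool" where
  "smooth_fun G f \<longleftrightarrow> smooth_on UNIV (f \<circ> exp_map G)"

text \<open>The left-invariant vector field of \<open>v\<close> in the Lie algebra, applied to \<open>f\<close>.\<close>

definition left_field ::
  "('g, 'a::euclidean_space) homogeneous_group_data \<Rightarrow> 'a \<Rightarrow> ('g \<Rightarrow> real) \<Rightarrow> 'g \<Rightarrow> real" where
  "left_field G v f g = deriv (\<lambda>t. f (g \<otimes>\<^bsub>G\<^esub> exp_map G (t *\<^sub>R v))) 0"

text \<open>For a connected, simply connected nilpotent Lie group the exponential map is a diffeomorphism
  of the Lie algebra onto the group. Conversely, a Lie group with nilpotent Lie algebra whose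
  exponential map is a diffeomorphism is diffeomorphic to a vector space, hence connected and simply
  connected, and nilpotent. So the manifold structure (and the topology) of \<open>G\<close> is given by the
  single global chart \<open>log_map G\<close>. The assumptions \<open>one_parameter\<close> and \<open>left_fields_bracket\<close> say that
  \<open>exp_map G\<close> is the exponential map and \<open>bracket G\<close> the commutator of left-invariant vector
  fields.\<close>

locale connected_simply_connected_nilpotent_lie_group =
  fixes G :: "('g, 'a::euclidean_space) homogeneous_group_data"
  assumes group: "group G"
    and exp_bij: "bij_betw (exp_map G) UNIV (carrier G)"
    and mult_smooth: "smooth_on UNIV
          (\<lambda>p :: 'a \<times> 'a. log_map G (exp_map G (fst p) \<otimes>\<^bsub>G\<^esub> exp_map G (snd p)))"
    and inv_smooth: "smooth_on UNIV (\<lambda>x :: 'a. log_map G (inv\<^bsub>G\<^esub> (exp_map G x)))"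
    and one_parameter: "exp_map G ((s + t) *\<^sub>R v) = exp_map G (s *\<^sub>R v) \<otimes>\<^bsub>G\<^esub> exp_map G (t *\<^sub>R v)"
    and lie_algebra: "nilpotent_lie_algebra (bracket G)"
    and left_fields_bracket: "\<lbrakk>smooth_fun G f; g \<in> carrier G\<rbrakk> \<Longrightarrow>
          left_field G (bracket G v w) f g =
            left_field G v (left_field G w f) g - left_field G w (left_field G v f) g"

locale homogeneous_group = connected_simply_connected_nilpotent_lie_group G
  for G :: "('g, 'a::euclidean_space) homogeneous_group_data" +
  assumes dil_linear: "l > 0 \<Longrightarrow> linear (dil G l)"
    and dil_bij: "l > 0 \<Longrightarrow> bij (dil G l)"
    and dil_bracket: "l > 0 \<Longrightarrow> dil G l (bracket G v w) = bracket G (dil G l v) (dil G l w)"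
    and frame_inj: "inj_on (frame G) {1..DIM('a)}"
    and frame_independent: "independent (frame G ` {1..DIM('a)})"
    and frame_span: "span (frame G ` {1..DIM('a)}) = UNIV"
    and weight_one: "weight G 1 = 1"
    and weight_mono: "mono_on {1..DIM('a)} (weight G)"
    and dil_frame: "\<lbrakk>l > 0; j \<in> {1..DIM('a)}\<rbrakk> \<Longrightarrow>
          dil G l (frame G j) = (l powr weight G j) *\<^sub>R frame G j"

definition group_dil :: "('g, 'a::euclidean_space) homogeneous_group_data \<Rightarrow> real \<Rightarrow> 'g \<Rightarrow> 'g" where
  "group_dil G l g = exp_map G (dil G l (log_map G g))"

definition hom_dim :: "('g, 'a::euclidean_space) homogeneous_group_data \<Rightarrow> real" where
  "hom_dim G = (\<Sum>j = 1..DIM('a). weight G j)"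

text \<open>The number of basis fields of homogeneity one. They are the first ones, the weights being
  nondecreasing.\<close>

definition num_first :: "('g, 'a::euclidean_space) homogeneous_group_data \<Rightarrow> nat" where
  "num_first G = card {j \<in> {1..DIM('a)}. weight G j = 1}"

definition coord :: "('g, 'a::euclidean_space) homogeneous_group_data \<Rightarrow> nat \<Rightarrow> 'g \<Rightarrow> real" where
  "coord G j g = representation (frame G ` {1..DIM('a)}) (log_map G g) (frame G j)"

text \<open>Push-forward of Lebesgue measure under the exponential map, on the Borel sets of \<open>G\<close>.\<close>

definition haar :: "('g, 'a::euclidean_space) homogeneous_group_data \<Rightarrow> 'g measure" where
  "haar G = embed_measure lborel (exp_map G)"


section \<open>Homogeneous norms, surface measure and test functions\<close>

definition homogeneous_norm ::
  "('g, 'a::euclidean_space) homogeneous_group_data \<Rightarrow> ('g \<Rightarrow> real) \<Rightarrow> bool" where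
  "homogeneous_norm G N \<longleftrightarrow>
     continuous_on UNIV (N \<circ> exp_map G) \<and>
     smooth_on (exp_map G -` (carrier G - {\<one>\<^bsub>G\<^esub>})) (N \<circ> exp_map G) \<and>
     (\<forall>g\<in>carrier G. N g \<ge> 0) \<and>
     (\<forall>g\<in>carrier G. N g = 0 \<longleftrightarrow> g = \<one>\<^bsub>G\<^esub>) \<and>
     (\<forall>g\<in>carrier G. N (inv\<^bsub>G\<^esub> g) = N g) \<and>
     (\<forall>l>0. \<forall>g\<in>carrier G. N (group_dil G l g) = l * N g) \<and>
     (\<forall>g\<in>carrier G. \<forall>h\<in>carrier G. N (g \<otimes>\<^bsub>G\<^esub> h) \<le> N g + N h)"

definition unit_sphere ::
  "('g, 'a::euclidean_space) homogeneous_group_data \<Rightarrow> ('g \<Rightarrow> real) \<Rightarrow> 'g set" where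
  "unit_sphere G N = {h \<in> carrier G. N h = 1}"

text \<open>The unit sphere is compact, so its Radon measures are its finite Borel measures. At most one
  measure satisfies this predicate.\<close>

definition surface_measure ::
  "('g, 'a::euclidean_space) homogeneous_group_data \<Rightarrow> ('g \<Rightarrow> real) \<Rightarrow> 'g measure \<Rightarrow> bool" where
  "surface_measure G N \<sigma> \<longleftrightarrow>
     finite_measure \<sigma> \<and>
     space \<sigma> = unit_sphere G N \<and>
     sets \<sigma> = sets (restrict_space (haar G) (unit_sphere G N)) \<and>
     (\<forall>u :: 'g \<Rightarrow> real. integrable (haar G) u \<longrightarrow>
        (LINT h|haar G. u h) =
        (LINT r:{0<..}|lborel. (LINT h|\<sigma>. u (group_dil G r h) * r powr (hom_dim G - 1))))"

definition sphere_mass :: "'g measure \<Rightarrow> real" where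
  "sphere_mass \<sigma> = (LINT h|\<sigma>. 1)"

definition first_moment ::
  "('g, 'a::euclidean_space) homogeneous_group_data \<Rightarrow> 'g measure \<Rightarrow> real" where
  "first_moment G \<sigma> = (LINT h|\<sigma>. (\<Sum>i = 1..num_first G. \<bar>coord G i h\<bar>\<^sup>2))"

text \<open>With the coordinates \<open>x\<^sub>j\<close>, \<open>j > m\<close>, held fixed, the norm is a smooth function of
  \<open>x\<^sub>1\<^sup>2 + \<dots> + x\<^sub>m\<^sup>2\<close> on \<open>{0<..}\<close>. The first argument of \<open>F\<close> encodes these remaining coordinates as a
  vector.\<close>

definition radial_first_coords ::
  "('g, 'a::euclidean_space) homogeneous_group_data \<Rightarrow> ('g \<Rightarrow> real) \<Rightarrow> bool" where
  "radial_first_coords G N \<longleftrightarrow>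
     (\<exists>F :: 'a \<Rightarrow> real \<Rightarrow> real. (\<forall>y. smooth_on {0<..} (F y)) \<and>
        (\<forall>g\<in>carrier G. (\<Sum>i = 1..num_first G. (coord G i g)\<^sup>2) \<noteq> 0 \<longrightarrow>
           N g = F (\<Sum>j\<in>{num_first G<..DIM('a)}. coord G j g *\<^sub>R frame G j)
                   (\<Sum>i = 1..num_first G. (coord G i g)\<^sup>2)))"

text \<open>The class \<open>C\<^sub>0\<^sup>\<infinity>\<close>; the support is taken in the chart, where closure and compactness are those of
  the Lie algebra.\<close>

definition test_fun :: "('g, 'a::euclidean_space) homogeneous_group_data \<Rightarrow> ('g \<Rightarrow> real) \<Rightarrow> bool" where
  "test_fun G u \<longleftrightarrow> smooth_fun G u \<and> compact (closure {x. u (exp_map G x) \<noteq> 0})"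

text \<open>The squared norm with values in \<open>[0, \<infinity>]\<close>. On the diagonal the integrand is \<open>0 / 0 = 0\<close>, which
  concerns a null set only.\<close>

definition D_norm_sq ::
  "('g, 'a::euclidean_space) homogeneous_group_data \<Rightarrow> ('g \<Rightarrow> real) \<Rightarrow> real \<Rightarrow> ('g \<Rightarrow> real) \<Rightarrow> ennreal" where
  "D_norm_sq G N s u =
     (\<integral>\<^sup>+h. (\<integral>\<^sup>+g. ennreal (\<bar>u g - u h\<bar>\<^sup>2 / N (inv\<^bsub>G\<^esub> h \<otimes>\<^bsub>G\<^esub> g) powr (hom_dim G + 2 * s))
        \<partial>haar G) \<partial>haar G)"

end

theory Submission
  imports Defs "HOL-Computational_Algebra.Polynomial"
begin

text \<open>Everything is transported to the Lie algebra by \<open>exp\<close>. The Maurer--Cartan equation for the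
  left-invariant forms, which is the bracket axiom, gives \<open>d exp\<close> as a polynomial in the nilpotent maps
  \<open>ad x\<close>; translations therefore have Jacobian \<open>1\<close> and Lebesgue measure is bi-invariant. With
  \<open>\<phi>(k) = \<integral> |u(hk) - u(h)|\<^sup>2 dh\<close> and \<open>\<Psi>(r)\<close> the integral of \<open>\<phi> \<circ> \<delta>\<^sub>r\<close> over the unit sphere, left
  invariance and polar coordinates turn the squared norm into \<open>\<integral>\<^sub>0\<^sup>\<infinity> r\<^sup>-\<^sup>1\<^sup>-\<^sup>2\<^sup>s \<Psi>(r) dr\<close>. The limit
  \<open>s \<rightarrow> 0\<close> sees only large \<open>r\<close>, where the supports of \<open>u\<close> and of its translate are disjoint and \<open>\<Psi>\<close> is
  constant. The limit \<open>s \<rightarrow> 1\<close> sees only \<open>r \<rightarrow> 0\<close>, where \<open>\<Psi>(r) / r\<^sup>2\<close> tends to the integral of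
  \<open>|\<Sum>\<^sub>i\<^sub>\<le>\<^sub>m x\<^sub>i X\<^sub>i u|\<^sup>2\<close>: the coordinates of weight greater than \<open>1\<close> disappear. The reflections and
  transpositions of \<open>x\<^sub>1, \<dots>, x\<^sub>m\<close> preserve the norm and Lebesgue measure, which diagonalises the second
  moments of the surface measure.\<close>

text \<open>The factor \<open>2\<close> of the first limit comes from the integral of
  \<open>r powr (1 - 2 * s)\<close> near \<open>0\<close>, which grows like
  \<open>1 / (2 * (1 - s))\<close>; the quotient \<open>m / tau_m\<close> is the inverse of the
  common second moment of the first \<open>m\<close> coordinates. In the second limit the
  \<open>1 / (2 * s)\<close> from the integral of \<open>r powr (- 1 - 2 * s)\<close> near infinity
  meets the value of \<open>\<Psi>\<close> there, which is \<open>2 * sigma_Q\<close> times the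
  integral of \<open>u\<close> squared. Two obstacles shape the argument. The surface measure is
  known only through its polar formula, so its symmetries are read off from moments over the unit
  ball, where Lebesgue measure and the norm are both invariant, and then transferred to the sphere.
  And that formula is an identity between real integrals, in which a divergent integral counts as
  \<open>0\<close>; it is first upgraded to an equality of measures, which serves all nonnegative
  Borel functions. Both normalising constants must be shown positive, since a division by
  \<open>0\<close> would make the left-hand sides vanish.\<close>

section \<open>Determinants of unipotent linear maps\<close>

lemma matrix_add_mult: "(A + B) ** C = A ** C + B ** (C :: 'r::semiring_1^'n^'m)"
  by (vector matrix_matrix_mult_def sum.distrib[symmetric] distrib_right)

lemma matrix_uminus_mult:
  fixes A :: "'r::ring_1^'n^'m" and B :: "'r^'k^'n"
  shows "(- A) ** B = - (A ** B)" "A ** (- B) = - (A ** B)"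
  by (simp_all add: vec_eq_iff matrix_matrix_mult_def sum_negf)

lemma funpow_square_uminus:
  fixes A :: "'r::comm_ring_1^'n^'n"
  assumes "((\<lambda>A. A ** A) ^^ k) A = 0"
  shows "((\<lambda>A. A ** A) ^^ k) (- A) = 0"
proof (cases k)
  case 0
  then show ?thesis using assms by simp
next
  case (Suc j)
  then show ?thesis using assms by (simp add: funpow_Suc_right matrix_uminus_mult del: funpow.simps)
qed

text \<open>\<open>(1 + A) (1 - A) = 1 - A^2\<close>, and \<open>- A^2\<close> reaches
  \<open>0\<close> after one squaring less. Iterated squares in place of powers make this induction
  close. The ring is general because the entries will be polynomials.\<close>

lemma det_unipotent_dvd_one:
  fixes A :: "'r::comm_ring_1^'n^'n"
  assumes "((\<lambda>A. A ** A) ^^ k) A = 0"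
  shows "det (mat 1 + A) dvd 1"
  using assms
proof (induction k arbitrary: A)
  case 0
  then show ?case by simp
next
  case (Suc k)
  from Suc.prems have "((\<lambda>A. A ** A) ^^ k) (A ** A) = 0"
    by (simp only: funpow_Suc_right o_apply)
  then have "det (mat 1 + - (A ** A)) dvd 1"
    by (intro Suc.IH funpow_square_uminus)
  moreover have "mat 1 + - (A ** A) = (mat 1 + A) ** (mat 1 + - A)"
    unfolding matrix_add_mult matrix_add_ldistrib matrix_uminus_mult matrix_mul_lid matrix_mul_rid by simp
  ultimately have "det (mat 1 + A) * det (mat 1 + - A) dvd 1"
    by (simp only: det_mul)
  then show ?case by (rule dvd_mult_left)
qed

lemma poly_det:
  fixes A :: "('r::comm_ring_1 poly)^'n^'n"
  shows "poly (det A) x = det (\<chi> i j. poly (A $ i $ j) x)"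
proof -
  have [simp]: "poly (of_int n) x = (of_int n :: 'r)" for n
    by (cases n rule: int_cases2) (simp_all add: poly_of_nat)
  show ?thesis
    by (simp add: det_def poly_sum poly_prod)
qed

text \<open>The determinant of \<open>1 + X A\<close> is a unit of \<open>\<real>[X]\<close>, hence constant in \<open>X\<close>.\<close>

lemma det_unipotent:
  fixes A :: "real^'n^'n"
  assumes "((\<lambda>A. A ** A) ^^ k) A = 0"
  shows "det (mat 1 + A) = 1"
proof -
  \<comment> \<open>\<open>P c B\<close> is the matrix \<open>c B\<close> over the polynomial ring.
    With \<open>c\<close> free its square is \<open>P (c ^ 2) (B ** B)\<close>, so
    \<open>X A\<close> is annihilated by as many squarings as \<open>A\<close>.\<close>
  define P where "P c B = (\<chi> i j. c * [:B $ i $ j:])" for c :: "real poly" and B :: "real^'n^'n"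
  have sq: "P c B ** P c B = P (c ^ 2) (B ** B)" for c B
  proof -
    have *: "(\<Sum>x\<in>UNIV. [:f x:]) = [:\<Sum>x\<in>UNIV. f x:]" for f :: "'n \<Rightarrow> real"
      by (induction rule: infinite_finite_induct[of _ "UNIV"]) (auto simp: pCons_0_0)
    show ?thesis
      unfolding P_def matrix_matrix_mult_def *[symmetric]
      by (simp add: vec_eq_iff sum_distrib_left power2_eq_square mult_ac
          flip: *)
  qed
  have "((\<lambda>A. A ** A) ^^ k) (P c B) = P (c ^ (2 ^ k)) (((\<lambda>A. A ** A) ^^ k) B)" for c B k
    by (induction k) (simp_all add: sq power_mult[symmetric] mult.commute)
  then have "((\<lambda>A. A ** A) ^^ k) (P [:0, 1:] A) = P ([:0, 1:] ^ (2 ^ k)) 0"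
    using assms by simp
  then have "((\<lambda>A. A ** A) ^^ k) (P [:0, 1:] A) = 0"
    by (simp add: P_def vec_eq_iff)
  then have "det (mat 1 + P [:0, 1:] A) dvd 1"
    by (rule det_unipotent_dvd_one)
  then obtain c where c: "det (mat 1 + P [:0, 1:] A) = [:c:]"
    by (metis is_unit_polyE)
  have "det (mat 1 + x *\<^sub>R A) = c" for x
  proof -
    have "(\<chi> i j. poly ((mat 1 + P [:0, 1:] A) $ i $ j) x) = mat 1 + x *\<^sub>R A"
      by (auto simp: vec_eq_iff P_def mat_def)
    then show ?thesis using poly_det[of "mat 1 + P [:0, 1:] A" x] c by simp
  qed
  \<comment> \<open>The constant is \<open>det 1 = 1\<close> at \<open>x = 0\<close> and the
    determinant sought at \<open>x = 1\<close>.\<close>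
  from this[of 0] this[of 1] show ?thesis by simp
qed

section \<open>Change of variables in a Euclidean space\<close>

text \<open>The change of variables theorem of the library is restricted to \<open>real^'n\<close> with a well-ordered
  finite index type; this type provides such an index type of cardinality \<open>DIM('a)\<close>.\<close>

typedef (overloaded) ('a::euclidean_space) basis_index = "{..<DIM('a)}"
  using DIM_positive by blast

instantiation basis_index :: (euclidean_space) wellorder
begin

definition "i \<le> j \<longleftrightarrow> Rep_basis_index i \<le> Rep_basis_index j"

definition "i < j \<longleftrightarrow> Rep_basis_index i < Rep_basis_index j"

instance
proof
  fix P :: "'a basis_index \<Rightarrow> bool" and a
  assume *: "\<And>x. (\<And>y. y < x \<Longrightarrow> P y) \<Longrightarrow> P x"
  show "P a"
  proof (induction "Rep_basis_index a" arbitrary: a rule: less_induct)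
    case less
    then show ?case by - (rule *, simp add: less_basis_index_def)
  qed
qed (auto simp: less_eq_basis_index_def less_basis_index_def Rep_basis_index_inject)

end

instance basis_index :: (euclidean_space) finite
proof
  have *: "(UNIV :: 'a basis_index set) = Abs_basis_index ` {..<DIM('a)}"
    by (rule type_definition.Abs_image[OF type_definition_basis_index, symmetric])
  show "finite (UNIV :: 'a basis_index set)" unfolding * by (rule finite_imageI) simp
qed

definition basis_vector :: "'a::euclidean_space basis_index \<Rightarrow> 'a" where
  "basis_vector = (SOME \<beta>. bij_betw \<beta> UNIV Basis)"

lemma bij_basis_vector: "bij_betw (basis_vector :: 'a::euclidean_space basis_index \<Rightarrow> 'a) UNIV Basis"
proof -
  have "bij_betw Rep_basis_index (UNIV :: 'a basis_index set) {..<DIM('a)}"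
    using type_definition.Rep_range[OF type_definition_basis_index]
    by (auto simp: bij_betw_def inj_on_def Rep_basis_index_inject)
  moreover obtain f :: "nat \<Rightarrow> 'a" where "bij_betw f {..<DIM('a)} Basis"
    using ex_bij_betw_nat_finite[of "Basis :: 'a set"] by (auto simp: atLeast0LessThan)
  ultimately have "\<exists>\<beta>. bij_betw \<beta> (UNIV :: 'a basis_index set) (Basis :: 'a set)"
    using bij_betw_trans by blast
  then show ?thesis unfolding basis_vector_def by (rule someI_ex)
qed

definition to_vec :: "'a::euclidean_space \<Rightarrow> real^'a basis_index" where
  "to_vec x = (\<chi> i. x \<bullet> basis_vector i)"

definition of_vec :: "real^'a basis_index \<Rightarrow> 'a::euclidean_space" where
  "of_vec v = (\<Sum>i\<in>UNIV. v $ i *\<^sub>R basis_vector i)"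

lemma basis_vector_inner:
  "basis_vector i \<bullet> (basis_vector j :: 'a::euclidean_space) = (if i = j then 1 else 0)"
proof -
  have "basis_vector i \<in> (Basis :: 'a set)" for i
    using bij_basis_vector by (auto simp: bij_betw_def)
  then show ?thesis
    using bij_basis_vector[where 'a='a] by (auto simp: bij_betw_def inner_Basis inj_on_def)
qed

lemma of_vec_inner [simp]: "of_vec v \<bullet> (basis_vector i :: 'a::euclidean_space) = v $ i"
  unfolding of_vec_def
  by (simp add: inner_sum_left basis_vector_inner if_distrib if_distribR sum.delta cong: if_cong)

lemma to_vec_of_vec [simp]: "to_vec (of_vec v) = v"
  by (simp add: to_vec_def vec_eq_iff)

lemma of_vec_to_vec [simp]: "of_vec (to_vec x) = (x :: 'a::euclidean_space)"
proof -
  have "of_vec (to_vec x) = (\<Sum>b\<in>Basis. (x \<bullet> b) *\<^sub>R b)"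
    unfolding of_vec_def to_vec_def
    using sum.reindex_bij_betw[OF bij_basis_vector, of "\<lambda>b. (x \<bullet> b) *\<^sub>R b"] by simp
  then show ?thesis by (simp add: euclidean_representation)
qed

lemma bounded_linear_to_vec: "bounded_linear to_vec"
  by (intro linear_conv_bounded_linear[THEN iffD1] linearI)
    (simp_all add: to_vec_def vec_eq_iff inner_add_left)

lemma bounded_linear_of_vec: "bounded_linear of_vec"
  by (intro linear_conv_bounded_linear[THEN iffD1] linearI)
    (simp_all add: of_vec_def scaleR_add_left sum.distrib scaleR_sum_right)

text \<open>The coordinates refer to an orthonormal basis, so boxes pull back to boxes with the same
  side lengths, and the values on boxes determine Lebesgue measure.\<close>

lemma distr_lborel_to_vec: "distr lborel borel to_vec = (lborel :: (real^'a::euclidean_space basis_index) measure)"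
proof (rule lborel_eqI[symmetric])
  have [measurable]: "(to_vec :: 'a \<Rightarrow> _) \<in> borel_measurable borel"
    using bounded_linear_to_vec by (intro borel_measurable_continuous_onI linear_continuous_on)
  fix l u :: "real^'a basis_index"
  assume le: "\<And>b. b \<in> Basis \<Longrightarrow> l \<bullet> b \<le> u \<bullet> b"
  have *: "(Basis :: 'a set) = range basis_vector"
    using bij_basis_vector[where 'a='a] by (auto simp: bij_betw_def)
  have le': "l $ i \<le> u $ i" for i
    using le[of "axis i 1"] by (simp add: inner_axis)
  have "to_vec -` box l u = box (of_vec l) (of_vec u :: 'a)"
    by (auto simp: mem_box_cart mem_box * to_vec_def)
  then have "emeasure (distr lborel borel to_vec) (box l u) = emeasure lborel (box (of_vec l) (of_vec u :: 'a))"
    by (subst emeasure_distr) auto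
  also have "\<dots> = ennreal (\<Prod>b\<in>Basis. (of_vec u - of_vec l) \<bullet> (b :: 'a))"
    using le' by (subst emeasure_lborel_box) (auto simp: *)
  also have "(\<Prod>b\<in>Basis. (of_vec u - of_vec l) \<bullet> (b :: 'a)) = (\<Prod>i\<in>UNIV. u $ i - l $ i)"
    using prod.reindex_bij_betw[OF bij_basis_vector, of "\<lambda>b. (of_vec u - of_vec l) \<bullet> (b :: 'a)"]
    by (simp add: inner_diff_left)
  also have "\<dots> = (\<Prod>b\<in>Basis. (u - l) \<bullet> b)"
    unfolding Basis_vec_def
    by (subst prod.UNION_disjoint) (auto simp: axis_eq_axis inner_axis)
  finally show "emeasure (distr lborel borel to_vec) (box l u) = ennreal (\<Prod>b\<in>Basis. (u - l) \<bullet> b)" .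
qed simp

lemma distr_lborel_of_vec: "distr lborel borel of_vec = (lborel :: 'a::euclidean_space measure)"
proof -
  have [measurable]: "(to_vec :: 'a \<Rightarrow> _) \<in> borel_measurable borel"
    "(of_vec :: _ \<Rightarrow> 'a) \<in> borel_measurable borel"
    using bounded_linear_to_vec bounded_linear_of_vec
    by (auto intro!: borel_measurable_continuous_onI linear_continuous_on)
  have "distr (distr lborel borel to_vec) borel of_vec = distr lborel borel (\<lambda>x :: 'a. x)"
    by (subst distr_distr) (auto simp: o_def)
  then show ?thesis using distr_lborel_to_vec[where 'a='a] by (simp add: distr_id2)
qed

lemma linear_funpow: "linear f \<Longrightarrow> linear (f ^^ j)" for f :: "'a::real_vector \<Rightarrow> 'a"
  by (induction j) (auto intro: linear_id linear_compose simp del: id_apply comp_apply)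

definition linear_det :: "('a::euclidean_space \<Rightarrow> 'a) \<Rightarrow> real" where
  "linear_det f = det (matrix (\<lambda>v. to_vec (f (of_vec v))))"

lemma linear_conj_vec: "linear f \<Longrightarrow> linear (\<lambda>v. to_vec (f (of_vec v)))"
  using linear_compose[OF linear_compose[OF bounded_linear.linear[OF bounded_linear_of_vec]]
      bounded_linear.linear[OF bounded_linear_to_vec]]
  by (simp add: o_def)

lemma linear_det_compose:
  assumes "linear f" "linear g"
  shows "linear_det (\<lambda>x. f (g x)) = linear_det f * linear_det g"
proof -
  have "matrix ((\<lambda>v. to_vec (f (of_vec v))) \<circ> (\<lambda>v. to_vec (g (of_vec v)))) =
      matrix (\<lambda>v. to_vec (f (of_vec v))) ** matrix (\<lambda>v. to_vec (g (of_vec v)))"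
    using assms by (intro matrix_compose linear_conj_vec)
  then show ?thesis by (simp add: linear_det_def det_mul o_def)
qed

lemma linear_det_id: "linear_det (\<lambda>x. x) = 1"
  by (simp add: linear_det_def matrix_id_mat_1[unfolded id_def])

lemma linear_det_unipotent:
  assumes f: "linear f" and "\<And>x. (f ^^ K) x = 0"
  shows "linear_det (\<lambda>x. x + f x) = 1"
proof -
  define h where "h = (\<lambda>v. to_vec (f (of_vec v)))"
  have h: "linear h" unfolding h_def by (rule linear_conj_vec[OF f])
  have lin: "linear (h ^^ j)" for j
    by (rule linear_funpow[OF h])
  \<comment> \<open>\<open>det_unipotent\<close> asks for iterated squares, that is for exponents
    \<open>2 ^ k\<close>; since \<open>K \<le> 2 ^ K\<close>, the \<open>K\<close>-th iterate
    vanishes.\<close>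
  have sq: "((\<lambda>A. A ** A) ^^ k) (matrix h) = matrix (h ^^ (2 ^ k))" for k
    by (induction k) (simp_all add: matrix_compose[symmetric] lin funpow_add[symmetric] mult_2)
  have pow: "(h ^^ j) v = to_vec ((f ^^ j) (of_vec v))" for j v
    by (induction j) (simp_all add: h_def)
  have "(f ^^ j) x = 0" if "j \<ge> K" for j x
  proof -
    have "(f ^^ (K + (j - K))) x = 0"
      by (simp add: funpow_add assms)
    then show ?thesis using that by simp
  qed
  moreover have "K \<le> 2 ^ K" by (simp add: less_imp_le)
  ultimately have "h ^^ (2 ^ K) = (\<lambda>v. 0)"
    by (auto simp: pow to_vec_def vec_eq_iff)
  then have "((\<lambda>A. A ** A) ^^ K) (matrix h) = 0"
    unfolding sq by (simp add: matrix_def vec_eq_iff)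
  then have "det (mat 1 + matrix h) = 1" by (rule det_unipotent)
  moreover have "matrix (\<lambda>v. to_vec (of_vec v + f (of_vec v))) = mat 1 + matrix h"
    by (simp add: matrix_def vec_eq_iff h_def linear_add[OF bounded_linear.linear[OF bounded_linear_to_vec]] mat_def axis_def)
  ultimately show ?thesis by (simp add: linear_det_def)
qed

text \<open>The preimage of a box is an open set that \<open>g\<close> maps bijectively onto the
  box, so the change of variables formula with \<open>|det| = 1\<close> gives both the same
  volume.\<close>

lemma lborel_distr_bij_cart:
  fixes g :: "real^'n::{finite,wellorder} \<Rightarrow> real^'n::_"
  assumes der: "\<And>x. (g has_derivative g' x) (at x)"
    and "bij g" and det: "\<And>x. \<bar>det (matrix (g' x))\<bar> = 1"
  shows "distr lborel borel g = lborel"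
proof (rule lborel_eqI[symmetric])
  have cont: "continuous_on UNIV g"
    using der by (meson continuous_at_imp_continuous_on has_derivative_continuous)
  then have [measurable]: "g \<in> borel_measurable borel" by (rule borel_measurable_continuous_onI)
  fix l u :: "real^'n::_"
  assume le: "\<And>b. b \<in> Basis \<Longrightarrow> l \<bullet> b \<le> u \<bullet> b"
  define S where "S = g -` box l u"
  have "open S" unfolding S_def using cont by (intro open_vimage) auto
  have img: "g ` S = box l u"
    unfolding S_def using \<open>bij g\<close> by (simp add: bij_is_surj surj_image_vimage_eq)
  have "((\<lambda>x. \<bar>det (matrix (g' x))\<bar>) has_integral measure lebesgue (box l u)) S"
  proof (subst has_measure_differentiable_image[symmetric])
    show "S \<in> sets lebesgue" using \<open>open S\<close> by auto
    show "inj_on g S" using \<open>bij g\<close> by (meson bij_is_inj inj_on_subset subset_UNIV)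
    show "g ` S \<in> lmeasurable \<and> measure lebesgue (g ` S) = measure lebesgue (box l u)"
      by (simp add: img)
  qed (use der in \<open>auto intro: has_derivative_at_withinI\<close>)
  then have "((\<lambda>x. 1) has_integral measure lebesgue (box l u)) S" by (simp add: det)
  then have S: "S \<in> lmeasurable" "measure lebesgue S = measure lebesgue (box l u)"
    by (simp_all add: has_integral_iff lmeasurable_iff_integrable_on lmeasure_integral)
  have "emeasure (distr lborel borel g) (box l u) = emeasure lborel S"
    by (subst emeasure_distr) (auto simp: S_def)
  also have "\<dots> = emeasure lebesgue S" using \<open>open S\<close> by (simp add: emeasure_completion)
  also have "\<dots> = ennreal (measure lebesgue (box l u))"
    using S by (simp add: emeasure_eq_measure2)
  also have "\<dots> = (\<Prod>b\<in>Basis. (u - l) \<bullet> b)" using le by (simp add: measure_lborel_box_eq)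
  finally show "emeasure (distr lborel borel g) (box l u) = (\<Prod>b\<in>Basis. (u - l) \<bullet> b)" .
qed simp

lemma lborel_distr_bij:
  fixes g :: "'a::euclidean_space \<Rightarrow> 'a"
  assumes der: "\<And>x. (g has_derivative g' x) (at x)"
    and "bij g" and det: "\<And>x. \<bar>linear_det (g' x)\<bar> = 1"
  shows "distr lborel borel g = lborel"
proof -
  define h where "h = (\<lambda>v. to_vec (g (of_vec v)))"
  have cont: "continuous_on UNIV g"
    using der by (meson continuous_at_imp_continuous_on has_derivative_continuous)
  then have [measurable]: "g \<in> borel_measurable borel" by (rule borel_measurable_continuous_onI)
  have [measurable]: "(to_vec :: 'a \<Rightarrow> _) \<in> borel_measurable borel"
    "(of_vec :: _ \<Rightarrow> 'a) \<in> borel_measurable borel"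
    using bounded_linear_to_vec bounded_linear_of_vec
    by (auto intro!: borel_measurable_continuous_onI linear_continuous_on)
  have "bij h"
    by (rule o_bij[of "\<lambda>v. to_vec (inv_into UNIV g (of_vec v))"])
      (use \<open>bij g\<close> in \<open>auto simp: h_def o_def bij_is_inj bij_is_surj surj_f_inv_f inv_f_f\<close>)
  have "distr lborel borel h = lborel"
  proof (rule lborel_distr_bij_cart)
    show "(h has_derivative (\<lambda>v. to_vec (g' (of_vec x) (of_vec v)))) (at x)" for x
      unfolding h_def
      by (intro bounded_linear.has_derivative[OF bounded_linear_to_vec]
          has_derivative_compose[OF bounded_linear_imp_has_derivative[OF bounded_linear_of_vec] der])
    show "\<bar>det (matrix (\<lambda>v. to_vec (g' (of_vec x) (of_vec v))))\<bar> = 1" for x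
      using det by (simp add: linear_det_def)
  qed fact
  have "distr lborel borel g = distr (distr lborel borel of_vec) borel g"
    by (simp add: distr_lborel_of_vec)
  also have "\<dots> = distr (distr lborel borel h) borel of_vec"
    by (subst (1 2) distr_distr) (auto simp: h_def o_def)
  also have "\<dots> = lborel"
    by (simp add: \<open>distr lborel borel h = lborel\<close> distr_lborel_of_vec)
  finally show ?thesis .
qed

lemma lborel_distr_minus: "distr lborel borel uminus = (lborel :: 'a::euclidean_space measure)"
  using lborel_affine[of "- 1" "0 :: 'a"] by (simp add: density_1)

section \<open>Smooth functions\<close>

lemma smooth_on_UNIV_differentiable: "smooth_on UNIV f \<Longrightarrow> f differentiable at x"
  unfolding smooth_on_def by (metis Ck_on.simps(2) UNIV_I)

lemma smooth_on_UNIV_derivative: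
  "smooth_on UNIV f \<Longrightarrow> smooth_on UNIV (\<lambda>x. frechet_derivative f (at x) v)"
  unfolding smooth_on_def by (metis Ck_on.simps(2))

lemma smooth_on_continuous: "smooth_on S f \<Longrightarrow> continuous_on S f"
  unfolding smooth_on_def by (metis Ck_on.simps(1))

lemma smooth_on_bounded_linear:
  fixes f :: "'a::euclidean_space \<Rightarrow> 'b::real_normed_vector"
  assumes "bounded_linear f"
  shows "smooth_on UNIV f"
proof -
  have const: "Ck_on k UNIV (\<lambda>x :: 'a. c :: 'b)" for k c
    by (induction k arbitrary: c) (auto simp: frechet_derivative_const)
  have "frechet_derivative f (at x) = f" for x
    using assms by (metis bounded_linear_imp_has_derivative frechet_derivative_at)
  then have "Ck_on k UNIV f" for k
    using assms const by (cases k)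
      (auto simp: linear_continuous_on bounded_linear_imp_differentiable)
  then show ?thesis by (simp add: smooth_on_def)
qed

text \<open>A product rule for a linear map that varies together with its argument. \<open>L\<close>
  is known to be differentiable only vector by vector, so the argument is expanded in a basis and
  each term treated as a scalar multiple.\<close>

lemma has_derivative_apply_linear:
  fixes L :: "'x::real_normed_vector \<Rightarrow> 'a::euclidean_space \<Rightarrow> 'b::real_normed_vector"
  assumes lin: "\<And>y. linear (L y)"
    and diff: "\<And>b. (\<lambda>y. L y b) differentiable at x"
    and v: "(v has_derivative v') (at x)"
  shows "((\<lambda>y. L y (v y)) has_derivative
    (\<lambda>h. frechet_derivative (\<lambda>y. L y (v x)) (at x) h + L x (v' h))) (at x)"
proof -
  have expand: "L y w = (\<Sum>b\<in>Basis. (w \<bullet> b) *\<^sub>R L y b)" for y w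
  proof -
    have "L y w = L y (\<Sum>b\<in>Basis. (w \<bullet> b) *\<^sub>R b)" by (simp add: euclidean_representation)
    then show ?thesis by (simp add: linear_sum[OF lin] linear_cmul[OF lin])
  qed
  define D where "D b = frechet_derivative (\<lambda>y. L y b) (at x)" for b
  have D: "((\<lambda>y. L y b) has_derivative D b) (at x)" for b
    unfolding D_def using diff by (simp add: frechet_derivative_works)
  have "((\<lambda>y. \<Sum>b\<in>Basis. (w \<bullet> b) *\<^sub>R L y b) has_derivative (\<lambda>h. \<Sum>b\<in>Basis. (w \<bullet> b) *\<^sub>R D b h)) (at x)" for w
    by (intro derivative_intros D)
  then have D_sum: "D w = (\<lambda>h. \<Sum>b\<in>Basis. (w \<bullet> b) *\<^sub>R D b h)" for w
    using D[of w] expand[of _ w] by (metis (no_types, lifting) ext has_derivative_unique)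
  have "((\<lambda>y. \<Sum>b\<in>Basis. (v y \<bullet> b) *\<^sub>R L y b) has_derivative
      (\<lambda>h. \<Sum>b\<in>Basis. (v x \<bullet> b) *\<^sub>R D b h + (v' h \<bullet> b) *\<^sub>R L x b)) (at x)"
    by (intro has_derivative_sum has_derivative_scaleR has_derivative_inner_left v D)
  then have "((\<lambda>y. L y (v y)) has_derivative
      (\<lambda>h. \<Sum>b\<in>Basis. (v x \<bullet> b) *\<^sub>R D b h + (v' h \<bullet> b) *\<^sub>R L x b)) (at x)"
    using expand by (metis (no_types, lifting) ext)
  then show ?thesis
    unfolding D_def[symmetric] by (simp add: sum.distrib D_sum[of "v x"] expand[of x "v' _"])
qed

section \<open>Multiplication in exponential coordinates\<close>

context connected_simply_connected_nilpotent_lie_group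
begin

text \<open>The Baker--Campbell--Hausdorff product; it is handled through the group axioms and its
  derivatives, never through the series.\<close>

definition cmul :: "'a \<Rightarrow> 'a \<Rightarrow> 'a" where
  "cmul x y = log_map G (exp_map G x \<otimes>\<^bsub>G\<^esub> exp_map G y)"

lemma exp_carrier [simp]: "exp_map G x \<in> carrier G"
  using exp_bij by (auto simp: bij_betw_def)

lemma inj_exp: "inj (exp_map G)"
  using exp_bij by (simp add: bij_betw_def)

lemma log_exp [simp]: "log_map G (exp_map G x) = x"
  unfolding log_map_def using inj_exp by (rule inv_into_f_f) simp

lemma exp_log: "g \<in> carrier G \<Longrightarrow> exp_map G (log_map G g) = g"
  unfolding log_map_def using exp_bij by (auto simp: bij_betw_def f_inv_into_f)

lemma exp_cmul: "exp_map G (cmul x y) = exp_map G x \<otimes>\<^bsub>G\<^esub> exp_map G y"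
  unfolding cmul_def by (intro exp_log monoid.m_closed group.is_monoid group) simp_all

lemma exp_zero: "exp_map G 0 = \<one>\<^bsub>G\<^esub>"
proof -
  interpret group G by (rule group)
  have "exp_map G 0 = exp_map G 0 \<otimes>\<^bsub>G\<^esub> exp_map G 0"
    using one_parameter[of 0 0 0] by simp
  then show ?thesis using exp_carrier[of 0] by (metis r_cancel_one')
qed

lemma cmul_zero_left [simp]: "cmul 0 x = x" and cmul_zero_right [simp]: "cmul x 0 = x"
proof -
  interpret group G by (rule group)
  show "cmul 0 x = x" "cmul x 0 = x" by (simp_all add: cmul_def exp_zero)
qed

lemma cmul_assoc: "cmul (cmul x y) z = cmul x (cmul y z)"
proof -
  interpret group G by (rule group)
  have "exp_map G (cmul (cmul x y) z) = exp_map G (cmul x (cmul y z))"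
    by (simp add: exp_cmul m_assoc)
  then show ?thesis using inj_exp by (simp add: inj_eq)
qed

lemma cmul_scaleR: "cmul (s *\<^sub>R x) (t *\<^sub>R x) = (s + t) *\<^sub>R x"
  unfolding cmul_def one_parameter[symmetric] by simp

lemma cmul_minus_left [simp]: "cmul (- x) x = 0" and cmul_minus_right [simp]: "cmul x (- x) = 0"
  using cmul_scaleR[of "- 1" x 1] cmul_scaleR[of 1 x "- 1"] by simp_all

lemma cmul_cancel [simp]: "cmul (- x) (cmul x y) = y" "cmul x (cmul (- x) y) = y"
  by (simp_all add: cmul_assoc[symmetric])

lemma exp_minus: "exp_map G (- x) = inv\<^bsub>G\<^esub> exp_map G x"
proof -
  interpret group G by (rule group)
  have "exp_map G (- x) \<otimes>\<^bsub>G\<^esub> exp_map G x = \<one>\<^bsub>G\<^esub>"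
    by (simp add: exp_cmul[symmetric] exp_zero)
  then show ?thesis by (intro inv_equality[symmetric]) simp_all
qed

lemma cmul_minus_minus: "cmul (- x) (- y) = - cmul y x"
proof -
  have "cmul (cmul y x) (cmul (- x) (- y)) = 0"
    by (simp add: cmul_assoc)
  then show ?thesis by (metis cmul_cancel(1) cmul_zero_right)
qed

section \<open>Left-invariant fields and the Maurer--Cartan form\<close>

definition D_right :: "'a \<Rightarrow> 'a \<Rightarrow> 'a \<Rightarrow> 'a" where
  "D_right x y v = frechet_derivative (\<lambda>p. cmul (fst p) (snd p)) (at (x, y)) (0, v)"

abbreviation lfield :: "'a \<Rightarrow> 'a \<Rightarrow> 'a" where
  "lfield x \<equiv> D_right x 0"

text \<open>The left Maurer--Cartan form at \<open>x\<close>: the differential at \<open>x\<close>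
  of left translation by the inverse \<open>- x\<close>, with values in the tangent space at the
  identity \<open>0\<close>.\<close>

definition mc_form :: "'a \<Rightarrow> 'a \<Rightarrow> 'a" where
  "mc_form x = D_right (- x) x"

lemma cmul_smooth: "smooth_on UNIV (\<lambda>p. cmul (fst p) (snd p))"
  using mult_smooth by (simp add: cmul_def)

lemma D_right_smooth: "smooth_on UNIV (\<lambda>p. D_right (fst p) (snd p) v)"
  using smooth_on_UNIV_derivative[OF cmul_smooth] by (simp add: D_right_def)

lemma cmul_has_derivative: "(cmul x has_derivative D_right x y) (at y)"
proof -
  let ?P = "\<lambda>p. cmul (fst p) (snd p)"
  have "(?P has_derivative frechet_derivative ?P (at (x, y))) (at (x, y))"
    using smooth_on_UNIV_differentiable[OF cmul_smooth] by (simp add: frechet_derivative_works)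
  moreover have "((\<lambda>y. (x, y)) has_derivative (\<lambda>v. (0, v))) (at y)"
    by (intro derivative_intros)
  ultimately show ?thesis
    using has_derivative_compose[of "\<lambda>y. (x, y)" "\<lambda>v. (0, v)" y UNIV ?P]
    by (simp add: D_right_def[abs_def])
qed

lemma linear_D_right: "linear (D_right x y)"
  using cmul_has_derivative has_derivative_linear by blast

lemma continuous_on_cmul [continuous_intros]:
  assumes "continuous_on S f" "continuous_on S g"
  shows "continuous_on S (\<lambda>x. cmul (f x) (g x))"
  using continuous_on_compose2[OF smooth_on_continuous[OF cmul_smooth] continuous_on_Pair[OF assms]]
  by simp

text \<open>Associativity differentiated in the last factor. That \<open>lfield x\<close> and
  \<open>mc_form x\<close> are mutually inverse, and the factorisation \<open>D_right_eq\<close>,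
  are instances.\<close>

lemma D_right_chain: "D_right x (cmul y z) (D_right y z v) = D_right (cmul x y) z v"
proof -
  have "((\<lambda>z. cmul x (cmul y z)) has_derivative (\<lambda>v. D_right x (cmul y z) (D_right y z v))) (at z)"
    by (rule has_derivative_compose[OF cmul_has_derivative cmul_has_derivative])
  then have "(cmul (cmul x y) has_derivative (\<lambda>v. D_right x (cmul y z) (D_right y z v))) (at z)"
    by (simp add: cmul_assoc[symmetric])
  then show ?thesis using cmul_has_derivative has_derivative_unique by metis
qed

lemma D_right_zero [simp]: "D_right 0 y v = v"
proof -
  have "((\<lambda>x. x) has_derivative D_right 0 y) (at y)"
    using cmul_has_derivative[of 0 y] by (simp add: ext[of "cmul 0" "\<lambda>x. x"])
  then show ?thesis using has_derivative_ident has_derivative_unique by metis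
qed

lemma mc_form_lfield [simp]: "mc_form x (lfield x v) = v"
  using D_right_chain[of "- x" x 0 v] by (simp add: mc_form_def)

lemma lfield_mc_form [simp]: "lfield x (mc_form x v) = v"
  using D_right_chain[of x "- x" x v] by (simp add: mc_form_def)

lemma D_right_eq: "D_right x y v = lfield (cmul x y) (mc_form y v)"
  using D_right_chain[of "cmul x y" "- y" y v] by (simp add: mc_form_def cmul_assoc)

lemma cmul_line_has_derivative:
  "((\<lambda>s. cmul x (s *\<^sub>R v)) has_derivative (\<lambda>s. lfield x (s *\<^sub>R v))) (at 0)"
  by (rule has_derivative_compose[OF bounded_linear_imp_has_derivative[OF bounded_linear_scaleR_left]])
    (use cmul_has_derivative[of x 0] in simp)

text \<open>The one-parameter group of \<open>x\<close> is a straight line in exponential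
  coordinates, and its velocity is the left-invariant field of \<open>x\<close>.\<close>

lemma lfield_scaleR [simp]: "lfield (t *\<^sub>R x) x = x"
proof -
  have "((\<lambda>s. cmul (t *\<^sub>R x) (s *\<^sub>R x)) has_derivative (\<lambda>s. lfield (t *\<^sub>R x) (s *\<^sub>R x))) (at 0)"
    by (rule cmul_line_has_derivative)
  moreover have "((\<lambda>s. cmul (t *\<^sub>R x) (s *\<^sub>R x)) has_derivative (\<lambda>s. s *\<^sub>R x)) (at 0)"
    unfolding cmul_scaleR by (auto intro!: derivative_eq_intros)
  ultimately have "(\<lambda>s :: real. lfield (t *\<^sub>R x) (s *\<^sub>R x)) = (\<lambda>s. s *\<^sub>R x)"
    by (rule has_derivative_unique)
  from fun_cong[OF this, of 1] show ?thesis by simp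
qed

lemma lfield_self [simp]: "lfield x x = x"
  using lfield_scaleR[of 1 x] by simp

lemma left_field_exp:
  assumes "(f \<circ> exp_map G) differentiable at x"
  shows "left_field G v f (exp_map G x) = frechet_derivative (f \<circ> exp_map G) (at x) (lfield x v)"
proof -
  let ?f = "f \<circ> exp_map G"
  have f: "(?f has_derivative frechet_derivative ?f (at x)) (at (cmul x (0 *\<^sub>R v)))"
    using assms by (simp add: frechet_derivative_works)
  have "((\<lambda>t. cmul x (t *\<^sub>R v)) has_derivative (\<lambda>t. lfield x (t *\<^sub>R v))) (at 0)"
    by (rule cmul_line_has_derivative)
  from has_derivative_compose[OF this f]
  have "((\<lambda>t. ?f (cmul x (t *\<^sub>R v))) has_derivative (\<lambda>t. frechet_derivative ?f (at x) (lfield x (t *\<^sub>R v)))) (at 0)" .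
  moreover have "(\<lambda>t. frechet_derivative ?f (at x) (lfield x (t *\<^sub>R v))) = (*) (frechet_derivative ?f (at x) (lfield x v))"
    using linear_frechet_derivative[OF assms]
    by (simp add: fun_eq_iff linear_cmul linear_cmul[OF linear_D_right])
  ultimately have "((\<lambda>t. ?f (cmul x (t *\<^sub>R v))) has_real_derivative frechet_derivative ?f (at x) (lfield x v)) (at 0)"
    by (simp add: has_field_derivative_def)
  then show ?thesis
    unfolding left_field_def by (intro DERIV_imp_deriv) (simp add: exp_cmul[symmetric])
qed

lemma lfield_differentiable: "(\<lambda>y. lfield y w) differentiable at x"
proof -
  have "(\<lambda>p. D_right (fst p) (snd p) w) differentiable at (x, 0)"
    by (rule smooth_on_UNIV_differentiable[OF D_right_smooth])
  moreover have "(\<lambda>y. (y, 0)) differentiable at x"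
    unfolding differentiable_def by (auto intro!: exI derivative_intros)
  ultimately show ?thesis
    using differentiable_chain_at[of "\<lambda>y. (y, 0)" x "\<lambda>p. D_right (fst p) (snd p) w"] by (auto simp: o_def)
qed

lemma mc_form_differentiable: "(\<lambda>y. mc_form y w) differentiable at x"
proof -
  have "(\<lambda>p. D_right (fst p) (snd p) w) differentiable at (- x, x)"
    by (rule smooth_on_UNIV_differentiable[OF D_right_smooth])
  moreover have "(\<lambda>y. (- y, y)) differentiable at x"
    unfolding differentiable_def by (auto intro!: exI derivative_intros)
  ultimately show ?thesis
    using differentiable_chain_at[of "\<lambda>y. (- y, y)" x "\<lambda>p. D_right (fst p) (snd p) w"] by (auto simp: o_def mc_form_def)
qed

section \<open>The Maurer--Cartan equation along rays\<close>

definition D_lfield :: "'a \<Rightarrow> 'a \<Rightarrow> 'a \<Rightarrow> 'a" where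
  "D_lfield x w = frechet_derivative (\<lambda>y. lfield y w) (at x)"

lemma D_lfield: "((\<lambda>y. lfield y w) has_derivative D_lfield x w) (at x)"
  unfolding D_lfield_def using lfield_differentiable by (simp add: frechet_derivative_works)

text \<open>The bracket axiom, tested on the coordinate functions.\<close>

lemma lfield_bracket:
  "lfield x (bracket G v w) = D_lfield x w (lfield x v) - D_lfield x v (lfield x w)"
proof (rule euclidean_eqI)
  fix b :: 'a assume "b \<in> Basis"
  define f where "f = (\<lambda>g. log_map G g \<bullet> b)"
  have f: "f \<circ> exp_map G = (\<lambda>x. x \<bullet> b)" by (simp add: f_def o_def)
  have bl: "bounded_linear (\<lambda>x. x \<bullet> b)" by (rule bounded_linear_inner_left)
  have fd: "frechet_derivative (\<lambda>x. x \<bullet> b) (at x) = (\<lambda>x. x \<bullet> b)" for x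
    using bl by (metis bounded_linear_imp_has_derivative frechet_derivative_at)
  have 1: "left_field G w f (exp_map G y) = lfield y w \<bullet> b" for w y
    using bl by (subst left_field_exp) (simp_all add: f fd bounded_linear_imp_differentiable)
  have der: "((\<lambda>y. lfield y w \<bullet> b) has_derivative (\<lambda>h. D_lfield x w h \<bullet> b)) (at x)" for w
    by (intro has_derivative_inner_left D_lfield)
  have 2: "left_field G v (left_field G w f) (exp_map G x) = D_lfield x w (lfield x v) \<bullet> b" for v w
    using der[of w] by (subst left_field_exp)
      (auto simp: o_def 1 frechet_derivative_at[symmetric] differentiable_def)
  have "smooth_fun G f"
    unfolding smooth_fun_def f by (rule smooth_on_bounded_linear[OF bl])
  from left_fields_bracket[OF this exp_carrier, of v w x] show
    "lfield x (bracket G v w) \<bullet> b = (D_lfield x w (lfield x v) - D_lfield x v (lfield x w)) \<bullet> b"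
    by (simp add: 1 2 inner_diff_left)
qed

lemma linear_bracket: "linear (bracket G x)"
  using lie_algebra unfolding nilpotent_lie_algebra_def lie_algebra_def by (simp add: bilinear_def)

lemma bracket_nilpotent: "\<exists>K. \<forall>x z. (bracket G x ^^ K) z = 0"
proof -
  obtain K where K: "lower_central (bracket G) K = {0}"
    using lie_algebra unfolding nilpotent_lie_algebra_def nilpotent_lie_algebra_axioms_def by blast
  have "(bracket G x ^^ k) z \<in> lower_central (bracket G) k" for x z k
    by (induction k) (auto intro: span_base)
  then show ?thesis using K by blast
qed

text \<open>The Maurer--Cartan equation contracted with the radial direction: two identities for the
  left-invariant fields are differentiated at \<open>y = t x\<close> and combined with the bracket
  axiom. The factor \<open>t\<close> lets \<open>t = 0\<close> be treated with the other
  cases.\<close>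

lemma mc_form_derivative:
  "t *\<^sub>R frechet_derivative (\<lambda>y. mc_form y z) (at (t *\<^sub>R x)) x =
    z - mc_form (t *\<^sub>R x) z - t *\<^sub>R bracket G x (mc_form (t *\<^sub>R x) z)"
proof -
  define y where "y = t *\<^sub>R x"
  define w where "w = mc_form y z"
  have lin: "linear (mc_form y')" for y' unfolding mc_form_def by (rule linear_D_right)
  \<comment> \<open>Differentiating the constant \<open>mc_form y (lfield y w) = w\<close> trades
    the derivative of the form for that of the fields.\<close>
  have "((\<lambda>y. mc_form y (lfield y w)) has_derivative (\<lambda>h. frechet_derivative (\<lambda>y'. mc_form y' (lfield y w)) (at y) h
      + mc_form y (D_lfield y w h))) (at y)"
    by (rule has_derivative_apply_linear[OF lin mc_form_differentiable D_lfield])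
  then have "(\<lambda>h. frechet_derivative (\<lambda>y'. mc_form y' (lfield y w)) (at y) h + mc_form y (D_lfield y w h)) = (\<lambda>h. 0)"
    by (simp add: has_derivative_const has_derivative_unique)
  from fun_cong[OF this, of x] have 1: "frechet_derivative (\<lambda>y'. mc_form y' z) (at y) x = - mc_form y (D_lfield y w x)"
    by (simp add: w_def eq_neg_iff_add_eq_0)
  \<comment> \<open>Differentiating \<open>lfield y y = y\<close> brings in the straightness of
    one-parameter groups.\<close>
  have "((\<lambda>y. lfield y y) has_derivative (\<lambda>h. D_lfield y y h + lfield y h)) (at y)"
    unfolding D_lfield_def by (rule has_derivative_apply_linear[OF linear_D_right lfield_differentiable has_derivative_ident])
  then have "((\<lambda>y. y) has_derivative (\<lambda>h. D_lfield y y h + lfield y h)) (at y)"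
    by simp
  then have "(\<lambda>h. D_lfield y y h + lfield y h) = (\<lambda>h. h)"
    by (rule has_derivative_unique[OF _ has_derivative_ident])
  then have 2: "D_lfield y y h = h - lfield y h" for h
    by (metis add_diff_cancel_right')
  have "((\<lambda>y'. lfield y' y) has_derivative (\<lambda>h. t *\<^sub>R D_lfield y x h)) (at y)"
    using has_derivative_scaleR_right[OF D_lfield[of x y], of t] linear_cmul[OF linear_D_right]
    by (simp add: y_def)
  then have 3: "t *\<^sub>R D_lfield y x h = h - lfield y h" for h
    using 2 D_lfield[of y y] has_derivative_unique by metis
  \<comment> \<open>On the ray \<open>lfield y x = x\<close>, so the bracket axiom exchanges the
    derivative of the field of \<open>w\<close> along \<open>x\<close> for that of the field of
    \<open>x\<close> along \<open>lfield y w\<close>, which fact 3 evaluates.\<close>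
  have "D_lfield y w x = lfield y (bracket G x w) + D_lfield y x (lfield y w)"
    using lfield_bracket[of y x w] by (simp add: y_def)
  then have "t *\<^sub>R D_lfield y w x = lfield y (t *\<^sub>R bracket G x w) + lfield y w - lfield y (lfield y w)"
    by (simp add: scaleR_add_right 3 linear_cmul[OF linear_D_right])
  then have "mc_form y (t *\<^sub>R D_lfield y w x) = mc_form y (lfield y (t *\<^sub>R bracket G x w + w - lfield y w))"
    by (simp add: linear_add[OF linear_D_right] linear_diff[OF linear_D_right])
  then have "t *\<^sub>R mc_form y (D_lfield y w x) = t *\<^sub>R bracket G x w + w - z"
    by (simp add: linear_cmul[OF lin] w_def)
  then show ?thesis using 1 by (simp add: w_def y_def)
qed

text \<open>By the Maurer--Cartan equation, \<open>W t = t \<omega>(t x) z\<close> solves \<open>W' = z - [x, W]\<close>; since \<open>ad x\<close> is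
  nilpotent the solution is a polynomial in \<open>ad x\<close>.\<close>

lemma mc_form_eq:
  assumes K: "\<And>z. (bracket G x ^^ Suc K) z = 0"
  shows "mc_form x z = z + (\<Sum>k<K. ((- 1) ^ Suc k / fact (Suc (Suc k))) *\<^sub>R (bracket G x ^^ Suc k) z)"
proof -
  let ?a = "bracket G x"
  have lin_pow: "linear (?a ^^ j)" for j
    by (rule linear_funpow[OF linear_bracket])
  have bl_pow: "bounded_linear (?a ^^ j)" for j
    using lin_pow by (simp add: linear_conv_bounded_linear)
  define W where "W t = t *\<^sub>R mc_form (t *\<^sub>R x) z" for t
  have "((\<lambda>t. mc_form (t *\<^sub>R x) z) has_derivative
      (\<lambda>s. frechet_derivative (\<lambda>y. mc_form y z) (at (t *\<^sub>R x)) (s *\<^sub>R x))) (at t)" for t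
    by (rule has_derivative_compose[of "\<lambda>t. t *\<^sub>R x" "\<lambda>s. s *\<^sub>R x" t UNIV "\<lambda>y. mc_form y z"])
      (use mc_form_differentiable in \<open>auto intro!: derivative_eq_intros simp: frechet_derivative_works[symmetric]\<close>)
  then have "((\<lambda>t. mc_form (t *\<^sub>R x) z) has_vector_derivative
      frechet_derivative (\<lambda>y. mc_form y z) (at (t *\<^sub>R x)) x) (at t)" for t
    unfolding has_vector_derivative_def
    by (simp add: linear_cmul[OF linear_frechet_derivative[OF mc_form_differentiable]])
  then have "(W has_vector_derivative (t *\<^sub>R frechet_derivative (\<lambda>y. mc_form y z) (at (t *\<^sub>R x)) x
      + 1 *\<^sub>R mc_form (t *\<^sub>R x) z)) (at t)" for t
    unfolding W_def by (rule has_vector_derivative_scaleR[OF DERIV_ident])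
  then have W: "(W has_vector_derivative (z - ?a (W t))) (at t)" for t
    unfolding mc_form_derivative by (simp add: W_def linear_cmul[OF linear_bracket])
  \<comment> \<open>The series of \<open>(1 - exp (- t ad x)) / ad x\<close> applied to
    \<open>z\<close>, cut off at degree \<open>K\<close> in \<open>ad x\<close> because the next
    power vanishes.\<close>
  define p where "p t = (\<Sum>k\<le>K. ((- 1) ^ k * t ^ Suc k / fact (Suc k)) *\<^sub>R (?a ^^ k) z)" for t
  have p: "(p has_vector_derivative (z - ?a (p t))) (at t)" for t
  proof -
    define c where "c k = ((- 1) ^ k * t ^ k / fact k) *\<^sub>R (?a ^^ k) z" for k
    have "((\<lambda>t. (- 1) ^ k * t ^ Suc k / fact (Suc k)) has_real_derivative (- 1) ^ k * t ^ k / fact k) (at t)" for k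
    proof -
      have "((\<lambda>t. ((- 1) ^ k / fact (Suc k)) * t ^ Suc k) has_real_derivative
          ((- 1) ^ k / fact (Suc k)) * (real (Suc k) * t ^ k)) (at t)"
        using DERIV_cmult[OF DERIV_pow[of "Suc k" t UNIV], of "(- 1) ^ k / fact (Suc k)"] by simp
      moreover have "((- 1) ^ k / fact (Suc k)) * (real (Suc k) * t ^ k) = (- 1) ^ k * t ^ k / fact k"
        unfolding fact_Suc by (simp add: divide_simps del: of_nat_Suc)
      ultimately show ?thesis by simp
    qed
    then have "(p has_vector_derivative (\<Sum>k\<le>K. c k)) (at t)"
      unfolding p_def c_def by (intro has_vector_derivative_sum)
        (auto intro!: has_vector_derivative_eq_rhs[OF has_vector_derivative_scaleR[OF _ has_vector_derivative_const]])
    moreover have "?a (p t) = - (\<Sum>k\<le>K. c (Suc k))"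
      by (simp add: p_def c_def linear_sum[OF linear_bracket] linear_cmul[OF linear_bracket] sum_negf[symmetric])
    moreover have "(\<Sum>k\<le>K. c k) = z + (\<Sum>k\<le>K. c (Suc k))"
    proof -
      have "(\<Sum>k\<le>Suc K. c k) = c 0 + (\<Sum>k\<le>K. c (Suc k))" by (rule sum.atMost_Suc_shift)
      moreover have "c (Suc K) = 0" using K by (simp add: c_def)
      ultimately show ?thesis by (simp add: c_def[of 0])
    qed
    ultimately show ?thesis by simp
  qed
  \<comment> \<open>Uniqueness by descending induction on \<open>j\<close>: at \<open>Suc K\<close>
    nilpotency gives \<open>0\<close>, and if the image of \<open>W - p\<close> under the power
    \<open>Suc j\<close> vanishes, then the one under the power \<open>j\<close> has derivative
    \<open>0\<close> and starts at \<open>0\<close>.\<close>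
  have zero: "(?a ^^ j) (W t - p t) = 0" if "j \<le> Suc K" for j t
    using that
  proof (induction j arbitrary: t rule: inc_induct)
    case base
    then show ?case using K by blast
  next
    case (step j)
    have "((\<lambda>t. (?a ^^ j) (W t - p t)) has_vector_derivative (?a ^^ j) ((z - ?a (W t)) - (z - ?a (p t)))) (at t)" for t
      by (intro bounded_linear.has_vector_derivative[OF bl_pow] has_vector_derivative_diff W p)
    moreover have "(?a ^^ j) ((z - ?a (W t)) - (z - ?a (p t))) = - (?a ^^ Suc j) (W t - p t)" for t
      by (simp add: funpow_Suc_right linear_diff[OF linear_bracket] linear_diff[OF lin_pow] del: funpow.simps)
    ultimately have "((\<lambda>t. (?a ^^ j) (W t - p t)) has_vector_derivative 0) (at t)" for t
      using step.IH by simp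
    then obtain c where "\<And>t. (?a ^^ j) (W t - p t) = c"
      using has_vector_derivative_zero_constant[of UNIV "\<lambda>t. (?a ^^ j) (W t - p t)"] by auto
    moreover have "(?a ^^ j) (W 0 - p 0) = 0"
      by (simp add: W_def p_def linear_0[OF lin_pow])
    ultimately show ?case by metis
  qed
  have "mc_form x z = p 1" using zero[of 0 1] by (simp add: W_def)
  also have "\<dots> = z + (\<Sum>k<K. ((- 1) ^ Suc k / fact (Suc (Suc k))) *\<^sub>R (?a ^^ Suc k) z)"
    unfolding p_def lessThan_Suc_atMost[symmetric] sum.lessThan_Suc_shift by simp
  finally show ?thesis .
qed

section \<open>Jacobians of translations and invariance of Lebesgue measure\<close>

lemma linear_det_mc_form: "linear_det (mc_form x) = 1"
proof -
  obtain K where K: "\<And>z. (bracket G x ^^ K) z = 0" using bracket_nilpotent by blast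
  let ?a = "bracket G x"
  have lin_pow: "linear (?a ^^ j)" for j
    by (rule linear_funpow[OF linear_bracket])
  define S where "S z = (\<Sum>k<K. ((- 1) ^ Suc k / fact (Suc (Suc k))) *\<^sub>R (?a ^^ k) z)" for z
  have S: "linear S"
    unfolding S_def by (intro linear_compose_sum ballI linear_compose_scale_right lin_pow)
  have lin: "linear (\<lambda>z. ?a (S z))"
    using linear_compose[OF S linear_bracket] by (simp add: o_def)
  have aS: "?a (S z) = (\<Sum>k<K. ((- 1) ^ Suc k / fact (Suc (Suc k))) *\<^sub>R (?a ^^ Suc k) z)" for z
    by (simp add: S_def linear_sum[OF linear_bracket] linear_cmul[OF linear_bracket] linear_neg[OF linear_bracket])
  \<comment> \<open>\<open>mc_form x\<close> is the identity plus \<open>ad x\<close> times the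
    polynomial \<open>S\<close> in \<open>ad x\<close>. Since the two factors commute, their product
    inherits the nilpotency of \<open>ad x\<close>.\<close>
  have comm: "S (?a z) = ?a (S z)" for z
    unfolding aS by (simp add: S_def funpow_Suc_right del: funpow.simps)
  have comm': "S ((?a ^^ j) z) = (?a ^^ j) (S z)" for j z
    by (induction j) (simp_all add: comm)
  have "((\<lambda>z. ?a (S z)) ^^ j) z = (?a ^^ j) ((S ^^ j) z)" for j z
    by (induction j) (simp_all add: comm')
  then have "linear_det (\<lambda>z. z + ?a (S z)) = 1"
    by (intro linear_det_unipotent[OF lin, of K]) (simp add: K)
  moreover have "mc_form x = (\<lambda>z. z + ?a (S z))"
    unfolding aS by (rule ext, rule mc_form_eq) (simp add: K linear_0[OF linear_bracket])
  ultimately show ?thesis by simp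
qed

text \<open>By \<open>D_right_eq\<close> the differential of a left translation is the
  Maurer--Cartan form at the source followed by the inverse of the form at the target.\<close>

lemma linear_det_D_right: "linear_det (D_right x y) = 1"
proof -
  have mc: "linear (mc_form y)" for y unfolding mc_form_def by (rule linear_D_right)
  have "linear_det (lfield y) * linear_det (mc_form y) = 1" for y
    by (simp add: linear_det_compose[OF linear_D_right mc, symmetric] linear_det_id)
  then have "linear_det (lfield y) = 1" for y
    by (simp add: linear_det_mc_form)
  moreover have "D_right x y = (\<lambda>v. lfield (cmul x y) (mc_form y v))"
    by (rule ext) (rule D_right_eq)
  ultimately show ?thesis
    by (simp add: linear_det_compose[OF linear_D_right mc] linear_det_mc_form)
qed

lemma lborel_distr_cmul_left: "distr lborel borel (cmul x) = lborel"
proof (rule lborel_distr_bij)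
  show "bij (cmul x)"
    by (rule o_bij[of "cmul (- x)"]) (simp_all add: o_def fun_eq_iff)
qed (auto intro: cmul_has_derivative simp: linear_det_D_right)

text \<open>Inversion is \<open>x \<mapsto> - x\<close> in the chart and preserves Lebesgue measure;
  it conjugates right translation by \<open>y\<close> to left translation by
  \<open>- y\<close>.\<close>

lemma lborel_distr_cmul_right: "distr lborel borel (\<lambda>x. cmul x y) = lborel"
proof -
  have meas [measurable]: "cmul z \<in> borel_measurable borel" for z
    by (intro borel_measurable_continuous_onI continuous_intros)
  have "distr lborel borel (\<lambda>x. cmul x y) = distr (distr (distr lborel borel uminus) borel (cmul (- y))) borel uminus"
    by (subst distr_distr, simp, simp, subst distr_distr) (auto simp: o_def cmul_minus_minus)
  then show ?thesis by (simp add: lborel_distr_cmul_left lborel_distr_minus)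
qed

end

section \<open>Limits of Mellin-type integrals\<close>

text \<open>Allows real estimates for extended values. For \<open>e > l\<close> the lower bound is
  truncated to \<open>0\<close> and the condition remains true.\<close>

lemma tendsto_ennreal_sandwich:
  fixes f :: "'x \<Rightarrow> ennreal"
  assumes "l \<ge> 0"
    and bounds: "\<And>e. e > 0 \<Longrightarrow> \<forall>\<^sub>F x in F. ennreal (l - e) \<le> f x \<and> f x \<le> ennreal (l + e)"
  shows "(f \<longlongrightarrow> ennreal l) F"
proof -
  have "((\<lambda>x. enn2real (f x)) \<longlongrightarrow> l) F"
  proof (rule tendstoI)
    fix e :: real assume "e > 0"
    then have "\<forall>\<^sub>F x in F. ennreal (l - e / 2) \<le> f x \<and> f x \<le> ennreal (l + e / 2)"
      by (intro bounds) simp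
    then show "\<forall>\<^sub>F x in F. dist (enn2real (f x)) l < e"
    proof eventually_elim
      case (elim x)
      then obtain y where y: "f x = ennreal y" "y \<ge> 0"
        by (cases "f x") (auto simp: top_unique)
      have "y \<le> l + e / 2" using elim y \<open>l \<ge> 0\<close> \<open>e > 0\<close> by (simp add: ennreal_le_iff del: ennreal_plus)
      moreover have "l - e / 2 \<le> y"
        using elim y by (cases "l - e / 2 \<ge> 0") (auto simp: ennreal_le_iff)
      ultimately show ?case using y \<open>e > 0\<close> by (simp add: dist_real_def abs_less_iff)
    qed
  qed
  then have "((\<lambda>x. ennreal (enn2real (f x))) \<longlongrightarrow> ennreal l) F" by (rule tendsto_ennrealI)
  moreover have "\<forall>\<^sub>F x in F. ennreal (enn2real (f x)) = f x"
    using bounds[OF zero_less_one]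
  proof eventually_elim
    case (elim x)
    then have "f x < \<infinity>" using ennreal_less_top order_le_less_trans by fastforce
    then show ?case by simp
  qed
  ultimately show ?thesis by (rule Lim_transform_eventually)
qed

lemma nn_integral_powr_at_0:
  assumes "a > 0" "c > 0"
  shows "(\<integral>\<^sup>+r. ennreal (r powr (a - 1)) * indicator {0<..c} r \<partial>lborel) = ennreal (c powr a / a)"
proof -
  have "(\<integral>\<^sup>+r. ennreal (r powr (a - 1)) * indicator {0<..c} r \<partial>lborel) =
      (\<integral>\<^sup>+r. ennreal (r powr (a - 1)) * indicator {0..c} r \<partial>lborel)"
    by (intro nn_integral_cong) (auto simp: indicator_def)
  also have "\<dots> = ennreal (c powr a / a)"
    using has_integral_powr_from_0[of "a - 1" c] assms
    by (intro nn_integral_has_integral_lebesgue') auto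
  finally show ?thesis .
qed

lemma nn_integral_powr_at_infinity:
  assumes "a > 0" "c > 0"
  shows "(\<integral>\<^sup>+r. ennreal (r powr (- a - 1)) * indicator {c..} r \<partial>lborel) = ennreal (c powr (- a) / a)"
  using has_integral_powr_to_inf[of "- a - 1" c] assms
  by (intro nn_integral_has_integral_lebesgue') auto

text \<open>\<open>c\<close> will be \<open>L - e\<close> or \<open>L + e\<close> and may be
  negative; both sides are then \<open>0\<close>, which spares the case distinction in the estimates
  below.\<close>

lemma ennreal_mult_left_commute_real:
  assumes "0 \<le> a" "0 \<le> x"
  shows "ennreal a * (ennreal c * ennreal x) = ennreal (c * (a * x))"
    and "ennreal a * ennreal (c * x) = ennreal c * ennreal (a * x)"
proof -
  have "a * (c * x) = c * (a * x)" by simp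
  then show "ennreal a * (ennreal c * ennreal x) = ennreal (c * (a * x))"
    using assms by (cases "c \<ge> 0") (auto simp: ennreal_mult[symmetric] ennreal_neg mult_nonpos_nonneg)
  show "ennreal a * ennreal (c * x) = ennreal c * ennreal (a * x)"
    using assms \<open>a * (c * x) = c * (a * x)\<close>
    by (cases "c \<ge> 0") (auto simp: ennreal_mult[symmetric] ennreal_neg mult_nonpos_nonneg)
qed

lemma powr_mult_square:
  fixes r :: real
  assumes "r > 0"
  shows "r powr (- 1 - 2 * s) * r\<^sup>2 = r powr (2 - 2 * s - 1)"
proof -
  have "r\<^sup>2 = r powr 2" using assms by simp
  then show ?thesis by (simp only: powr_add[symmetric]) simp
qed

text \<open>Split at \<open>d\<close>. On \<open>{0<..d}\<close> the integrand is close to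
  \<open>L * r powr (1 - 2 * s)\<close>, with integral
  \<open>L * d powr (2 - 2 * s) / (2 - 2 * s)\<close>, and multiplication by \<open>1 - s\<close>
  leaves \<open>L / 2\<close> in the limit. Beyond \<open>d\<close> the integral stays bounded by
  \<open>B * d powr (- 2 * s) / (2 * s)\<close>, so the factor \<open>1 - s\<close> removes
  it.\<close>

lemma mellin_limit_1:
  fixes \<Psi> :: "real \<Rightarrow> ennreal"
  assumes [measurable]: "\<Psi> \<in> borel_measurable borel"
    and "L \<ge> 0" "B \<ge> 0"
    and bound: "\<And>r. r > 0 \<Longrightarrow> \<Psi> r \<le> ennreal B"
    and near_0: "\<And>e. e > 0 \<Longrightarrow> \<exists>d>0. \<forall>r. 0 < r \<longrightarrow> r \<le> d \<longrightarrow>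
        ennreal ((L - e) * r\<^sup>2) \<le> \<Psi> r \<and> \<Psi> r \<le> ennreal ((L + e) * r\<^sup>2)"
  shows "((\<lambda>s. ennreal (1 - s) * (\<integral>\<^sup>+r. ennreal (r powr (- 1 - 2 * s)) * \<Psi> r * indicator {0<..} r \<partial>lborel))
    \<longlongrightarrow> ennreal (L / 2)) (at_left 1)"
proof (rule tendsto_ennreal_sandwich)
  fix e :: real assume e: "e > 0"
  obtain d where d: "d > 0" and near: "\<And>r. 0 < r \<Longrightarrow> r \<le> d \<Longrightarrow>
      ennreal ((L - e) * r\<^sup>2) \<le> \<Psi> r \<and> \<Psi> r \<le> ennreal ((L + e) * r\<^sup>2)"
    using near_0[OF e] by blast
  let ?D = "\<lambda>s. \<integral>\<^sup>+r. ennreal (r powr (- 1 - 2 * s)) * \<Psi> r * indicator {0<..} r \<partial>lborel"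
  define lo where "lo s = (L - e) * (d powr (2 - 2 * s) / 2)" for s :: real
  define up where "up s = (L + e) * (d powr (2 - 2 * s) / 2) + (1 - s) * (B * (d powr (- (2 * s)) / (2 * s)))" for s :: real
  have ex: "- (2 * s) - 1 = - 1 - 2 * s" for s :: real by simp
  have head: "(\<integral>\<^sup>+r. ennreal c * (ennreal (r powr (2 - 2 * s - 1)) * indicator {0<..d} r) \<partial>lborel)
      = ennreal c * ennreal (d powr (2 - 2 * s) / (2 - 2 * s))" if "s < 1" for s c
    using that d nn_integral_powr_at_0[of "2 - 2 * s" d]
    by (subst nn_integral_cmult) simp_all
  have scale: "ennreal (1 - s) * (ennreal c * ennreal (d powr (2 - 2 * s) / (2 - 2 * s)))
      = ennreal (c * (d powr (2 - 2 * s) / 2))" if "s < 1" for s c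
  proof -
    have "(1 - s) * (d powr (2 - 2 * s) / (2 - 2 * s)) = d powr (2 - 2 * s) / 2"
      using that by (simp add: field_simps)
    moreover have "0 \<le> d powr (2 - 2 * s) / (2 - 2 * s)" using that by simp
    ultimately show ?thesis using that by (simp only: ennreal_mult_left_commute_real diff_ge_0_iff_ge less_imp_le)
  qed
  have lower: "ennreal (lo s) \<le> ennreal (1 - s) * ?D s" if "s < 1" for s
  proof -
    have "ennreal (lo s) = ennreal (1 - s) *
        (\<integral>\<^sup>+r. ennreal (L - e) * (ennreal (r powr (2 - 2 * s - 1)) * indicator {0<..d} r) \<partial>lborel)"
      unfolding head[OF that] scale[OF that] lo_def ..
    also have "\<dots> \<le> ennreal (1 - s) * ?D s"
    proof (intro mult_left_mono nn_integral_mono)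
      fix r :: real
      have "ennreal (L - e) * ennreal (r powr (2 - 2 * s - 1)) \<le> ennreal (r powr (- 1 - 2 * s)) * \<Psi> r"
        if r: "0 < r" "r \<le> d"
      proof -
        have "ennreal (L - e) * ennreal (r powr (2 - 2 * s - 1)) =
            ennreal (r powr (- 1 - 2 * s)) * ennreal ((L - e) * r\<^sup>2)"
          unfolding powr_mult_square[OF r(1), symmetric]
          by (rule ennreal_mult_left_commute_real(2)[symmetric]) simp_all
        also have "\<dots> \<le> ennreal (r powr (- 1 - 2 * s)) * \<Psi> r"
          using near[OF r] by (intro mult_left_mono) auto
        finally show ?thesis .
      qed
      then show "ennreal (L - e) * (ennreal (r powr (2 - 2 * s - 1)) * indicator {0<..d} r)
          \<le> ennreal (r powr (- 1 - 2 * s)) * \<Psi> r * indicator {0<..} r"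
        by (auto simp: indicator_def)
    qed simp
    finally show ?thesis .
  qed
  have upper: "ennreal (1 - s) * ?D s \<le> ennreal (up s)" if s: "0 < s" "s < 1" for s
  proof -
    have "?D s \<le> (\<integral>\<^sup>+r. ennreal (L + e) * (ennreal (r powr (2 - 2 * s - 1)) * indicator {0<..d} r)
        + ennreal B * (ennreal (r powr (- (2 * s) - 1)) * indicator {d..} r) \<partial>lborel)"
    proof (rule nn_integral_mono)
      fix r :: real
      have "ennreal (r powr (- 1 - 2 * s)) * \<Psi> r \<le> ennreal (L + e) * ennreal (r powr (2 - 2 * s - 1))"
        if r: "0 < r" "r \<le> d"
      proof -
        have "ennreal (r powr (- 1 - 2 * s)) * \<Psi> r \<le> ennreal (r powr (- 1 - 2 * s)) * ennreal ((L + e) * r\<^sup>2)"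
          using near[OF r] by (intro mult_left_mono) auto
        also have "\<dots> = ennreal (L + e) * ennreal (r powr (2 - 2 * s - 1))"
          unfolding powr_mult_square[OF r(1), symmetric]
          by (rule ennreal_mult_left_commute_real(2)) simp_all
        finally show ?thesis .
      qed
      moreover have "ennreal (r powr (- 1 - 2 * s)) * \<Psi> r \<le> ennreal B * ennreal (r powr (- (2 * s) - 1))"
        if r: "0 < r"
        unfolding ex using mult_left_mono[OF bound[OF r], of "ennreal (r powr (- 1 - 2 * s))"] by (simp add: mult.commute)
      ultimately show "ennreal (r powr (- 1 - 2 * s)) * \<Psi> r * indicator {0<..} r \<le>
          ennreal (L + e) * (ennreal (r powr (2 - 2 * s - 1)) * indicator {0<..d} r)
        + ennreal B * (ennreal (r powr (- (2 * s) - 1)) * indicator {d..} r)"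
        using d by (cases "0 < r"; cases "r < d"; cases "r = d") (auto simp: indicator_def add_increasing2)
    qed
    also have "\<dots> = ennreal (L + e) * ennreal (d powr (2 - 2 * s) / (2 - 2 * s))
        + ennreal B * ennreal (d powr (- (2 * s)) / (2 * s))"
    proof -
      have "(\<integral>\<^sup>+r. ennreal B * (ennreal (r powr (- (2 * s) - 1)) * indicator {d..} r) \<partial>lborel)
          = ennreal B * ennreal (d powr (- (2 * s)) / (2 * s))"
        using d s nn_integral_powr_at_infinity[of "2 * s" d] by (subst nn_integral_cmult) simp_all
      with head[OF s(2), of "L + e"] show ?thesis by (subst nn_integral_add) simp_all
    qed
    finally have "ennreal (1 - s) * ?D s \<le> ennreal (1 - s) * (\<dots>)"
      by (intro mult_left_mono) auto
    also have "\<dots> = ennreal (up s)"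
      unfolding distrib_left scale[OF s(2)] up_def
      using s \<open>L \<ge> 0\<close> \<open>B \<ge> 0\<close> e by (simp add: ennreal_mult[symmetric] ennreal_plus[symmetric] del: ennreal_plus)
    finally show ?thesis .
  qed
  have dne: "d \<noteq> 0" using d by simp
  have "(lo \<longlongrightarrow> (L - e) * (d powr (2 - 2 * 1) / 2)) (at_left 1)"
    unfolding lo_def using dne by (intro tendsto_intros) auto
  then have "(lo \<longlongrightarrow> (L - e) / 2) (at_left 1)" using dne by simp
  then have 1: "\<forall>\<^sub>F s in at_left 1. L / 2 - e < lo s"
    by (rule order_tendstoD) (use e in \<open>simp add: field_simps\<close>)
  have "(up \<longlongrightarrow> (L + e) * (d powr (2 - 2 * 1) / 2) + (1 - 1) * (B * (d powr (- (2 * 1)) / (2 * 1)))) (at_left 1)"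
    unfolding up_def using dne by (intro tendsto_intros) auto
  then have "(up \<longlongrightarrow> (L + e) / 2) (at_left 1)" using dne by simp
  then have 2: "\<forall>\<^sub>F s in at_left 1. up s < L / 2 + e"
    by (rule order_tendstoD) (use e in \<open>simp add: field_simps\<close>)
  have 3: "\<forall>\<^sub>F s in at_left 1. s \<in> {0<..<1::real}"
    by (rule eventually_at_left_real) simp
  show "\<forall>\<^sub>F s in at_left 1. ennreal (L / 2 - e) \<le> ennreal (1 - s) * ?D s \<and>
      ennreal (1 - s) * ?D s \<le> ennreal (L / 2 + e)"
    using 1 2 3
  proof eventually_elim
    case (elim s)
    have "ennreal (L / 2 - e) \<le> ennreal (lo s)" "ennreal (up s) \<le> ennreal (L / 2 + e)"
      using elim by (auto intro: ennreal_leI)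
    then show ?case using lower[of s] upper[of s] elim by (auto intro: order_trans)
  qed
qed (use \<open>L \<ge> 0\<close> in simp)

text \<open>The roles are exchanged: the tail beyond \<open>R\<close> is exactly
  \<open>L * R powr (- 2 * s) / (2 * s)\<close>, of which the factor \<open>s\<close> leaves
  \<open>L / 2\<close>, while the quadratic bound keeps the part below \<open>R\<close> bounded, so
  that the factor \<open>s\<close> removes it.\<close>

lemma mellin_limit_0:
  fixes \<Psi> :: "real \<Rightarrow> ennreal"
  assumes [measurable]: "\<Psi> \<in> borel_measurable borel"
    and "L \<ge> 0" "C \<ge> 0" and R: "R > 0"
    and near_0: "\<And>r. 0 < r \<Longrightarrow> r \<le> R \<Longrightarrow> \<Psi> r \<le> ennreal (C * r\<^sup>2)"
    and far: "\<And>r. r \<ge> R \<Longrightarrow> \<Psi> r = ennreal L"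
  shows "((\<lambda>s. ennreal s * (\<integral>\<^sup>+r. ennreal (r powr (- 1 - 2 * s)) * \<Psi> r * indicator {0<..} r \<partial>lborel))
    \<longlongrightarrow> ennreal (L / 2)) (at_right 0)"
proof (rule tendsto_ennreal_sandwich)
  let ?D = "\<lambda>s. \<integral>\<^sup>+r. ennreal (r powr (- 1 - 2 * s)) * \<Psi> r * indicator {0<..} r \<partial>lborel"
  define lo where "lo s = L * (R powr (- (2 * s)) / 2)" for s :: real
  define up where "up s = s * (C * (R powr (2 - 2 * s) / (2 - 2 * s))) + L * (R powr (- (2 * s)) / 2)" for s :: real
  have ex: "- (2 * s) - 1 = - 1 - 2 * s" for s :: real by simp
  have tail: "(\<integral>\<^sup>+r. ennreal L * (ennreal (r powr (- (2 * s) - 1)) * indicator {R..} r) \<partial>lborel)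
      = ennreal L * ennreal (R powr (- (2 * s)) / (2 * s))" if "s > 0" for s
    using that R nn_integral_powr_at_infinity[of "2 * s" R]
    by (subst nn_integral_cmult) simp_all
  have scale: "ennreal s * (ennreal L * ennreal (R powr (- (2 * s)) / (2 * s))) = ennreal (L * (R powr (- (2 * s)) / 2))"
    if "s > 0" for s
  proof -
    have "s * (R powr (- (2 * s)) / (2 * s)) = R powr (- (2 * s)) / 2"
      using that by (simp add: field_simps)
    moreover have "0 \<le> R powr (- (2 * s)) / (2 * s)" using that by simp
    ultimately show ?thesis using that by (simp only: ennreal_mult_left_commute_real less_imp_le)
  qed
  have lower: "ennreal (lo s) \<le> ennreal s * ?D s" if "s > 0" for s
  proof -
    have "ennreal (lo s) = ennreal s *
        (\<integral>\<^sup>+r. ennreal L * (ennreal (r powr (- (2 * s) - 1)) * indicator {R..} r) \<partial>lborel)"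
      unfolding tail[OF that] scale[OF that] lo_def ..
    also have "\<dots> \<le> ennreal s * ?D s"
    proof (intro mult_left_mono nn_integral_mono)
      fix r :: real
      show "ennreal L * (ennreal (r powr (- (2 * s) - 1)) * indicator {R..} r)
          \<le> ennreal (r powr (- 1 - 2 * s)) * \<Psi> r * indicator {0<..} r"
        unfolding ex using R far[of r] by (auto simp: indicator_def mult_ac)
    qed simp
    finally show ?thesis .
  qed
  have upper: "ennreal s * ?D s \<le> ennreal (up s)" if s: "0 < s" "s < 1" for s
  proof -
    have "?D s \<le> (\<integral>\<^sup>+r. ennreal C * (ennreal (r powr (2 - 2 * s - 1)) * indicator {0<..R} r)
        + ennreal L * (ennreal (r powr (- (2 * s) - 1)) * indicator {R..} r) \<partial>lborel)"
    proof (rule nn_integral_mono)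
      fix r :: real
      have "ennreal (r powr (- 1 - 2 * s)) * \<Psi> r \<le> ennreal C * ennreal (r powr (2 - 2 * s - 1))"
        if r: "0 < r" "r \<le> R"
      proof -
        have "ennreal (r powr (- 1 - 2 * s)) * \<Psi> r \<le> ennreal (r powr (- 1 - 2 * s)) * ennreal (C * r\<^sup>2)"
          using near_0[OF r] by (intro mult_left_mono) auto
        also have "\<dots> = ennreal C * ennreal (r powr (2 - 2 * s - 1))"
          unfolding powr_mult_square[OF r(1), symmetric]
          by (rule ennreal_mult_left_commute_real(2)) simp_all
        finally show ?thesis .
      qed
      then show "ennreal (r powr (- 1 - 2 * s)) * \<Psi> r * indicator {0<..} r \<le>
          ennreal C * (ennreal (r powr (2 - 2 * s - 1)) * indicator {0<..R} r)
        + ennreal L * (ennreal (r powr (- (2 * s) - 1)) * indicator {R..} r)"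
        unfolding ex using R far[of r]
        by (cases "r > R") (auto simp: indicator_def add_increasing2 mult.commute)
    qed
    also have "\<dots> = ennreal C * ennreal (R powr (2 - 2 * s) / (2 - 2 * s))
        + ennreal L * ennreal (R powr (- (2 * s)) / (2 * s))"
    proof -
      have "(\<integral>\<^sup>+r. ennreal C * (ennreal (r powr (2 - 2 * s - 1)) * indicator {0<..R} r) \<partial>lborel)
          = ennreal C * ennreal (R powr (2 - 2 * s) / (2 - 2 * s))"
        using R s nn_integral_powr_at_0[of "2 - 2 * s" R] by (subst nn_integral_cmult) simp_all
      with tail[OF s(1)] show ?thesis by (subst nn_integral_add) simp_all
    qed
    finally have "ennreal s * ?D s \<le> ennreal s * (\<dots>)"
      by (intro mult_left_mono) auto
    also have "\<dots> = ennreal (up s)"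
      unfolding distrib_left scale[OF s(1)] up_def
      using s \<open>L \<ge> 0\<close> \<open>C \<ge> 0\<close> by (simp add: ennreal_mult[symmetric] ennreal_plus[symmetric] del: ennreal_plus)
    finally show ?thesis .
  qed
  fix e :: real assume e: "e > 0"
  have Rne: "R \<noteq> 0" using R by simp
  have "(lo \<longlongrightarrow> L * (R powr (- (2 * 0)) / 2)) (at_right 0)"
    unfolding lo_def using Rne by (intro tendsto_intros) auto
  then have "(lo \<longlongrightarrow> L / 2) (at_right 0)" using Rne by simp
  then have 1: "\<forall>\<^sub>F s in at_right 0. L / 2 - e < lo s"
    by (rule order_tendstoD) (use e in simp)
  have "(up \<longlongrightarrow> 0 * (C * (R powr (2 - 2 * 0) / (2 - 2 * 0))) + L * (R powr (- (2 * 0)) / 2)) (at_right 0)"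
    unfolding up_def using Rne by (intro tendsto_intros) auto
  then have "(up \<longlongrightarrow> L / 2) (at_right 0)" using Rne by simp
  then have 2: "\<forall>\<^sub>F s in at_right 0. up s < L / 2 + e"
    by (rule order_tendstoD) (use e in simp)
  have 3: "\<forall>\<^sub>F s in at_right 0. s \<in> {0<..<1::real}"
    by (rule eventually_at_right_real) simp
  show "\<forall>\<^sub>F s in at_right 0. ennreal (L / 2 - e) \<le> ennreal s * ?D s \<and> ennreal s * ?D s \<le> ennreal (L / 2 + e)"
    using 1 2 3
  proof eventually_elim
    case (elim s)
    have "ennreal (L / 2 - e) \<le> ennreal (lo s)" "ennreal (up s) \<le> ennreal (L / 2 + e)"
      using elim by (auto intro: ennreal_leI)
    then show ?case using lower[of s] upper[of s] elim by (auto intro: order_trans)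
  qed
qed (use \<open>L \<ge> 0\<close> in simp)

declare One_nat_def [simp del]

section \<open>Coordinates and dilations\<close>

context homogeneous_group
begin

lemma one_le_DIM: "1 \<le> DIM('a)"
  by (simp add: Suc_leI One_nat_def)

definition xc :: "nat \<Rightarrow> 'a \<Rightarrow> real" where
  "xc j v = coord G j (exp_map G v)"

lemma xc_representation: "xc j v = representation (frame G ` {1..DIM('a)}) v (frame G j)"
  by (simp add: xc_def coord_def)

lemma coord_eq_xc: "g \<in> carrier G \<Longrightarrow> coord G j g = xc j (log_map G g)"
  by (simp add: xc_def exp_log)

lemma in_span_frame: "v \<in> span (frame G ` {1..DIM('a)})"
  by (simp add: frame_span)

lemma linear_xc: "linear (xc j)"
  by (intro linearI)
    (simp_all add: xc_representation real_vector.representation_add real_vector.representation_scale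
      frame_independent in_span_frame)

lemma bounded_linear_xc: "bounded_linear (xc j)"
  using linear_xc by (simp add: linear_conv_bounded_linear)

lemma continuous_on_xc [continuous_intros]:
  "continuous_on S f \<Longrightarrow> continuous_on S (\<lambda>x. xc j (f x))"
  by (rule bounded_linear.continuous_on[OF bounded_linear_xc])

lemma xc_measurable [measurable]: "xc j \<in> borel_measurable borel"
  by (intro borel_measurable_continuous_onI continuous_intros)

lemma sum_xc_frame: "(\<Sum>j = 1..DIM('a). xc j v *\<^sub>R frame G j) = v"
proof -
  have "(\<Sum>b\<in>frame G ` {1..DIM('a)}. representation (frame G ` {1..DIM('a)}) v b *\<^sub>R b) = v"
    using real_vector.sum_representation_eq[OF frame_independent in_span_frame, of "frame G ` {1..DIM('a)}"]
    by simp
  then show ?thesis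
    by (simp add: sum.reindex[OF frame_inj] xc_representation)
qed

lemma xc_frame:
  assumes "i \<in> {1..DIM('a)}" "j \<in> {1..DIM('a)}"
  shows "xc i (frame G j) = (if i = j then 1 else 0)"
  unfolding xc_representation
  using assms inj_onD[OF frame_inj, of i j]
  by (subst real_vector.representation_basis[OF frame_independent]) auto

lemma xc_sum_frame:
  assumes "i \<in> {1..DIM('a)}"
  shows "xc i (\<Sum>j = 1..DIM('a). c j *\<^sub>R frame G j) = c i"
proof -
  have "xc i (\<Sum>j = 1..DIM('a). c j *\<^sub>R frame G j) = (\<Sum>j = 1..DIM('a). if i = j then c j else 0)"
    unfolding linear_sum[OF linear_xc] linear_cmul[OF linear_xc]
    using assms by (intro sum.cong) (auto simp: xc_frame)
  then show ?thesis using assms by simp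
qed

lemma xc_eqI: "(\<And>i. i \<in> {1..DIM('a)} \<Longrightarrow> xc i v = xc i w) \<Longrightarrow> v = w"
  using sum_xc_frame[of v] sum_xc_frame[of w] by (metis (no_types, lifting) sum.cong)

text \<open>\<open>dil G r\<close> is unspecified for \<open>r \<le> 0\<close>; this version is jointly measurable in \<open>r\<close> and \<open>v\<close>.\<close>

definition dl :: "real \<Rightarrow> 'a \<Rightarrow> 'a" where
  "dl r v = (\<Sum>j = 1..DIM('a). (r powr weight G j * xc j v) *\<^sub>R frame G j)"

lemma dil_eq_dl: "r > 0 \<Longrightarrow> dil G r v = dl r v"
proof -
  assume "r > 0"
  have "dil G r v = dil G r (\<Sum>j = 1..DIM('a). xc j v *\<^sub>R frame G j)"
    by (simp add: sum_xc_frame)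
  also have "\<dots> = (\<Sum>j = 1..DIM('a). xc j v *\<^sub>R dil G r (frame G j))"
    by (simp add: linear_sum[OF dil_linear[OF \<open>r > 0\<close>]] linear_cmul[OF dil_linear[OF \<open>r > 0\<close>]])
  also have "\<dots> = dl r v"
    unfolding dl_def using \<open>r > 0\<close> by (intro sum.cong) (auto simp: dil_frame)
  finally show ?thesis .
qed

lemma xc_dl: "i \<in> {1..DIM('a)} \<Longrightarrow> xc i (dl r v) = r powr weight G i * xc i v"
  unfolding dl_def by (rule xc_sum_frame)

lemma dl_dl: "r > 0 \<Longrightarrow> s > 0 \<Longrightarrow> dl r (dl s v) = dl (r * s) v"
  by (rule xc_eqI) (simp add: xc_dl powr_mult)

lemma dl_one [simp]: "dl 1 v = v"
  by (simp add: dl_def sum_xc_frame)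

lemma weight_ge_one: "j \<in> {1..DIM('a)} \<Longrightarrow> weight G j \<ge> 1"
  using mono_onD[OF weight_mono, of 1 j] weight_one by simp

text \<open>The weights are at least \<open>1\<close> and nondecreasing, so those equal to
  \<open>1\<close> form an initial segment; this turns the cardinality \<open>num_first G\<close>
  into a range of indices.\<close>

lemma weight_first: "{j \<in> {1..DIM('a)}. weight G j = 1} = {1..num_first G}"
proof -
  let ?A = "{j \<in> {1..DIM('a)}. weight G j = 1}"
  have down: "i \<in> ?A" if "j \<in> ?A" "1 \<le> i" "i \<le> j" for i j
    using that mono_onD[OF weight_mono, of i j] weight_ge_one[of i] by auto
  have ne: "1 \<in> ?A" using weight_one one_le_DIM by simp
  define k where "k = Max ?A"
  have "k \<in> ?A" unfolding k_def using ne by (intro Max_in) auto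
  have "?A = {1..k}"
  proof (intro equalityI subsetI)
    fix i assume i: "i \<in> ?A"
    then have "i \<le> k" unfolding k_def by (intro Max_ge) auto
    then show "i \<in> {1..k}" using i by simp
  next
    fix i assume "i \<in> {1..k}"
    then show "i \<in> ?A" using down[OF \<open>k \<in> ?A\<close>, of i] by simp
  qed
  moreover from this have "num_first G = k" by (simp add: num_first_def)
  ultimately show ?thesis by simp
qed

lemma weight_eq_one: "j \<in> {1..num_first G} \<Longrightarrow> weight G j = 1"
  and num_first_le: "num_first G \<le> DIM('a)"
  and num_first_pos: "1 \<le> num_first G"
proof -
  show "j \<in> {1..num_first G} \<Longrightarrow> weight G j = 1" using weight_first by blast
  have "1 \<in> {j \<in> {1..DIM('a)}. weight G j = 1}" using weight_one one_le_DIM by simp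
  then show "1 \<le> num_first G" unfolding weight_first by simp
  then have "num_first G \<in> {j \<in> {1..DIM('a)}. weight G j = 1}" unfolding weight_first by simp
  then show "num_first G \<le> DIM('a)" by simp
qed

lemma weight_gt_one: "j \<in> {1..DIM('a)} \<Longrightarrow> j \<notin> {1..num_first G} \<Longrightarrow> weight G j > 1"
proof -
  assume j: "j \<in> {1..DIM('a)}" "j \<notin> {1..num_first G}"
  then have "weight G j \<noteq> 1" unfolding weight_first[symmetric] by simp
  with weight_ge_one[OF j(1)] show ?thesis by simp
qed

lemma hom_dim_ge_one: "hom_dim G \<ge> 1"
proof -
  have "weight G 1 \<le> (\<Sum>j = 1..DIM('a). weight G j)"
    using weight_ge_one one_le_DIM
    by (intro member_le_sum) (auto intro: order_trans[of 0 1])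
  then show ?thesis by (simp add: hom_dim_def weight_one)
qed

lemma dl_measurable [measurable]:
  assumes [measurable]: "f \<in> borel_measurable M" "g \<in> borel_measurable M"
  shows "(\<lambda>x. dl (f x) (g x)) \<in> borel_measurable M"
  unfolding dl_def by measurable

text \<open>Positivity of all weights gives continuity up to \<open>r = 0\<close>, where
  \<open>dl 0 v = 0\<close>; dilations therefore contract a vector continuously to the
  origin.\<close>

lemma continuous_on_dl [continuous_intros]:
  assumes "continuous_on S f" "continuous_on S g" "\<And>x. x \<in> S \<Longrightarrow> f x \<ge> 0"
  shows "continuous_on S (\<lambda>x. dl (f x) (g x))"
proof -
  have "weight G j > 0" if "j \<in> {1..DIM('a)}" for j using weight_ge_one[OF that] by simp
  then show ?thesis
    unfolding dl_def using assms
    by (intro continuous_intros continuous_on_powr') auto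
qed

lemma xc_bound: "\<exists>C\<ge>0. \<forall>j\<in>{1..DIM('a)}. \<forall>v. \<bar>xc j v\<bar> \<le> C * norm v"
proof -
  have "\<exists>K\<ge>0. \<forall>v. \<bar>xc j v\<bar> \<le> K * norm v" for j
    using bounded_linear.nonneg_bounded[OF bounded_linear_xc[of j]] by (auto simp: mult.commute)
  then obtain K where K: "\<And>j. K j \<ge> 0" "\<And>j v. \<bar>xc j v\<bar> \<le> K j * norm v" by metis
  have "\<bar>xc j v\<bar> \<le> (\<Sum>j = 1..DIM('a). K j) * norm v" if "j \<in> {1..DIM('a)}" for j v
    using K that by (intro order_trans[OF K(2) mult_right_mono] member_le_sum) auto
  then show ?thesis using K by (intro exI[of _ "\<Sum>j = 1..DIM('a). K j"]) (auto intro: sum_nonneg)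
qed

text \<open>For \<open>r \<le> 1\<close> weights at least \<open>1\<close> give
  \<open>r powr weight G j \<le> r\<close>. This linear rate becomes the quadratic bound on
  \<open>Psi\<close>.\<close>

lemma norm_dl_le:
  "\<exists>C\<ge>0. \<forall>r v. 0 \<le> r \<longrightarrow> r \<le> 1 \<longrightarrow> norm (dl r v) \<le> C * r * norm v"
proof -
  obtain C where C: "C \<ge> 0" "\<And>j v. j \<in> {1..DIM('a)} \<Longrightarrow> \<bar>xc j v\<bar> \<le> C * norm v"
    using xc_bound by blast
  define D where "D = (\<Sum>j = 1..DIM('a). C * norm (frame G j))"
  have "norm (dl r v) \<le> D * r * norm v" if r: "0 \<le> r" "r \<le> 1" for r v
  proof -
    have "norm (dl r v) \<le> (\<Sum>j = 1..DIM('a). norm ((r powr weight G j * xc j v) *\<^sub>R frame G j))"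
      unfolding dl_def by (rule norm_sum)
    also have "\<dots> \<le> (\<Sum>j = 1..DIM('a). r * (C * norm v) * norm (frame G j))"
    proof (rule sum_mono)
      fix j assume j: "j \<in> {1..DIM('a)}"
      have "r powr weight G j \<le> r powr 1"
        using r weight_ge_one[OF j] by (intro powr_mono') auto
      then have "r powr weight G j * \<bar>xc j v\<bar> \<le> r * (C * norm v)"
        using r C(2)[OF j, of v] by (intro mult_mono) auto
      then show "norm ((r powr weight G j * xc j v) *\<^sub>R frame G j) \<le> r * (C * norm v) * norm (frame G j)"
        by (simp add: abs_mult mult_right_mono)
    qed
    also have "\<dots> = D * r * norm v" by (simp add: D_def sum_distrib_left sum_distrib_right mult_ac)
    finally show ?thesis .
  qed
  moreover have "D \<ge> 0" unfolding D_def using C by (intro sum_nonneg) auto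
  ultimately show ?thesis by blast
qed

lemma norm_dl_le_of_le:
  assumes "R \<ge> 1"
  shows "\<exists>C. \<forall>r v. 0 \<le> r \<longrightarrow> r \<le> R \<longrightarrow> norm v \<le> 1 \<longrightarrow> norm (dl r v) \<le> C"
proof -
  have "compact ((\<lambda>p. dl (fst p) (snd p)) ` ({0..R} \<times> cball 0 1))"
    by (intro compact_continuous_image continuous_intros compact_Times) auto
  then have "bounded ((\<lambda>p. dl (fst p) (snd p)) ` ({0..R} \<times> cball 0 1))"
    by (rule compact_imp_bounded)
  then obtain C where "\<forall>x\<in>(\<lambda>p. dl (fst p) (snd p)) ` ({0..R} \<times> cball 0 1). norm x \<le> C"
    unfolding bounded_iff by blast
  then show ?thesis by (intro exI[of _ C]) (force simp: dist_norm)
qed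

definition horizontal :: "'a \<Rightarrow> 'a" where
  "horizontal v = (\<Sum>j = 1..num_first G. xc j v *\<^sub>R frame G j)"

text \<open>After division by \<open>r\<close> the \<open>j\<close>-th coordinate carries the factor
  \<open>r powr (weight G j - 1)\<close>, which is \<open>1\<close> for weight one and tends to
  \<open>0\<close> otherwise.\<close>

lemma dl_over_tendsto:
  "((\<lambda>r. dl r v /\<^sub>R r) \<longlongrightarrow> horizontal v) (at_right 0)"
proof -
  have "((\<lambda>r. r powr (weight G j - 1) * xc j v) \<longlongrightarrow>
      (if j \<in> {1..num_first G} then xc j v else 0)) (at_right 0)" if "j \<in> {1..DIM('a)}" for j
  proof (cases "j \<in> {1..num_first G}")
    case True
    have "\<forall>\<^sub>F r in at_right 0. r powr (weight G j - 1) * xc j v = xc j v"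
      using eventually_at_right_less[of "0::real"]
      by eventually_elim (simp add: weight_eq_one[OF True])
    then have "((\<lambda>r. r powr (weight G j - 1) * xc j v) \<longlongrightarrow> xc j v) (at_right 0)"
      by (rule tendsto_eventually)
    then show ?thesis using True by simp
  next
    case False
    then have pos: "weight G j - 1 > 0" using weight_gt_one that by simp
    have nonneg: "\<forall>\<^sub>F r in at_right (0::real). 0 \<le> r"
      using eventually_at_right_less[of "0::real"] by eventually_elim simp
    have "((\<lambda>r. r powr (weight G j - 1)) \<longlongrightarrow> 0) (at_right 0)"
      by (rule tendsto_zero_powrI[OF tendsto_ident_at tendsto_const nonneg pos])
    then have "((\<lambda>r. r powr (weight G j - 1) * xc j v) \<longlongrightarrow> 0) (at_right 0)"
      by (rule tendsto_mult_left_zero)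
    then show ?thesis by (simp only: False if_False)
  qed
  then have lim: "((\<lambda>r. \<Sum>j = 1..DIM('a). (r powr (weight G j - 1) * xc j v) *\<^sub>R frame G j) \<longlongrightarrow>
      (\<Sum>j = 1..DIM('a). (if j \<in> {1..num_first G} then xc j v else 0) *\<^sub>R frame G j)) (at_right 0)"
    by (rule tendsto_sum[OF tendsto_scaleR[OF _ tendsto_const]])
  have hor: "(\<Sum>j = 1..DIM('a). (if j \<in> {1..num_first G} then xc j v else 0) *\<^sub>R frame G j) = horizontal v"
    unfolding horizontal_def using num_first_le
    by (intro sum.mono_neutral_cong_right) auto
  have ev: "\<forall>\<^sub>F r in at_right 0. (\<Sum>j = 1..DIM('a). (r powr (weight G j - 1) * xc j v) *\<^sub>R frame G j) = dl r v /\<^sub>R r"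
    using eventually_at_right_less[of "0::real"]
    by eventually_elim (simp add: dl_def scaleR_sum_right powr_diff divide_inverse mult_ac)
  show ?thesis
    using Lim_transform_eventually[OF lim ev] unfolding hor .
qed

end

section \<open>Homogeneous norms\<close>

locale normed_homogeneous_group = homogeneous_group G
  for G :: "('g, 'a::euclidean_space) homogeneous_group_data" +
  fixes N :: "'g \<Rightarrow> real"
  assumes hom_norm: "homogeneous_norm G N"
begin

definition nn :: "'a \<Rightarrow> real" where
  "nn x = N (exp_map G x)"

lemma continuous_nn: "continuous_on UNIV nn"
  using hom_norm by (simp add: homogeneous_norm_def nn_def[abs_def] o_def)

lemma continuous_on_nn [continuous_intros]:
  "continuous_on S f \<Longrightarrow> continuous_on S (\<lambda>x. nn (f x))"
  using continuous_on_compose2[OF continuous_nn] by blast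

lemma nn_measurable [measurable]: "nn \<in> borel_measurable borel"
  by (rule borel_measurable_continuous_onI[OF continuous_nn])

lemma nn_nonneg [simp]: "nn x \<ge> 0"
  using hom_norm by (simp add: homogeneous_norm_def nn_def)

lemma nn_eq_0 [simp]: "nn x = 0 \<longleftrightarrow> x = 0"
  using hom_norm inj_exp by (simp add: homogeneous_norm_def nn_def exp_zero[symmetric] inj_eq)

lemma nn_minus [simp]: "nn (- x) = nn x"
  using hom_norm by (simp add: homogeneous_norm_def nn_def exp_minus)

lemma nn_dl: "r > 0 \<Longrightarrow> nn (dl r x) = r * nn x"
proof -
  assume r: "r > 0"
  then have "N (group_dil G r (exp_map G x)) = r * N (exp_map G x)"
    using hom_norm by (simp add: homogeneous_norm_def)
  then show ?thesis using r by (simp add: nn_def group_dil_def dil_eq_dl)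
qed

lemma nn_cmul: "nn (cmul x y) \<le> nn x + nn y"
  using hom_norm by (simp add: homogeneous_norm_def nn_def exp_cmul)

text \<open>Let \<open>c > 0\<close> be the minimum of the norm on the Euclidean unit sphere. A
  vector outside the Euclidean unit ball is contracted onto that sphere by some \<open>dl r\<close>
  with \<open>0 < r \<le> 1\<close>, whence \<open>c \<le> r * R\<close>. It is thus the dilation of
  a unit vector by \<open>1 / r \<le> R / c\<close>, and such dilations form a bounded set.\<close>

lemma bounded_nn_le: "bounded {x. nn x \<le> R}"
proof -
  obtain b :: 'a where b: "b \<in> Basis" using nonempty_Basis by blast
  have "compact (sphere (0::'a) 1)" "sphere (0::'a) 1 \<noteq> {}"
    using b by (auto intro!: exI[of _ b])
  then obtain y0 where y0: "y0 \<in> sphere 0 1" "\<And>y. y \<in> sphere 0 1 \<Longrightarrow> nn y0 \<le> nn y"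
    using continuous_attains_inf[of "sphere 0 1" nn] continuous_on_subset[OF continuous_nn] by blast
  define c where "c = nn y0"
  have "y0 \<noteq> 0" using y0 by auto
  then have c: "c > 0" unfolding c_def using nn_nonneg[of y0] nn_eq_0[of y0] by linarith
  define T where "T = max 1 (R / c)"
  obtain C where C: "\<And>r v. 0 \<le> r \<Longrightarrow> r \<le> T \<Longrightarrow> norm v \<le> 1 \<Longrightarrow> norm (dl r v) \<le> C"
    using norm_dl_le_of_le[of T] by (auto simp: T_def)
  have "norm x \<le> max 1 C" if x: "nn x \<le> R" for x
  proof (cases "norm x \<le> 1")
    case False
    have "continuous_on {0..1} (\<lambda>r. norm (dl r x))" by (intro continuous_intros) auto
    moreover have "norm (dl 0 x) \<le> 1" by (simp add: dl_def)
    ultimately obtain r where r: "0 \<le> r" "r \<le> 1" "norm (dl r x) = 1"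
      using IVT'[of "\<lambda>r. norm (dl r x)" 0 1 1] False by auto
    then have "r \<noteq> 0" by (auto simp: dl_def)
    with r have r0: "r > 0" by simp
    have "c \<le> r * nn x" using y0(2)[of "dl r x"] r r0 by (simp add: c_def nn_dl)
    also have "\<dots> \<le> r * R" using x r0 by simp
    finally have "1 / r \<le> T" using c r0 by (simp add: T_def field_simps le_max_iff_disj)
    then have "norm (dl (1 / r) (dl r x)) \<le> C" using r r0 by (intro C) auto
    then show ?thesis using r0 by (simp add: dl_dl)
  qed simp
  then show ?thesis unfolding bounded_iff by blast
qed

lemma emeasure_nn_le: "emeasure lborel {x. nn x \<le> R} < \<infinity>"
  by (intro emeasure_bounded_finite bounded_nn_le)

end

section \<open>Polar coordinates\<close>

locale polar_homogeneous_group = normed_homogeneous_group G N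
  for G :: "('g, 'a::euclidean_space) homogeneous_group_data" and N :: "'g \<Rightarrow> real" +
  fixes \<sigma> :: "'g measure"
  assumes surface: "surface_measure G N \<sigma>"
begin

lemma embed_haar: "haar G = distr lborel (haar G) (exp_map G)"
  unfolding haar_def by (rule embed_measure_eq_distr[OF inj_exp])

lemma exp_measurable_haar: "exp_map G \<in> lborel \<rightarrow>\<^sub>M haar G"
  unfolding haar_def by (rule measurable_embed_measure2[OF inj_exp])

lemma log_measurable_haar: "log_map G \<in> haar G \<rightarrow>\<^sub>M borel"
  unfolding haar_def by (rule measurable_embed_measure1) simp

lemma finite_\<sigma>: "finite_measure \<sigma>"
  using surface by (simp add: surface_measure_def)

lemma space_\<sigma>: "space \<sigma> = unit_sphere G N"
  using surface by (simp add: surface_measure_def)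

lemma log_measurable_\<sigma> [measurable]: "log_map G \<in> \<sigma> \<rightarrow>\<^sub>M borel"
proof -
  have "sets \<sigma> = sets (restrict_space (haar G) (unit_sphere G N))"
    using surface by (simp add: surface_measure_def)
  then show ?thesis
    using measurable_restrict_space1[OF log_measurable_haar] by (simp cong: measurable_cong_sets)
qed

text \<open>The surface measure carried to the Lie algebra and extended by zero off the unit sphere,
  so that Borel functions on the whole space can be integrated without restricting them.\<close>

definition \<sigma>c :: "'a measure" where
  "\<sigma>c = distr \<sigma> borel (log_map G)"

lemma sets_\<sigma>c [measurable_cong, simp]: "sets \<sigma>c = sets borel"
  by (simp add: \<sigma>c_def)

lemma space_\<sigma>c [simp]: "space \<sigma>c = UNIV"
  by (simp add: \<sigma>c_def)

lemma AE_\<sigma>c: "AE x in \<sigma>c. nn x = 1"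
proof -
  have "AE h in \<sigma>. nn (log_map G h) = 1"
    by (rule AE_I2) (simp add: space_\<sigma> unit_sphere_def nn_def exp_log)
  then show ?thesis
    unfolding \<sigma>c_def by (subst AE_distr_iff) auto
qed

lemma sphere_mass_eq: "sphere_mass \<sigma> = (LINT x|\<sigma>c. 1)"
  unfolding sphere_mass_def \<sigma>c_def by (subst integral_distr) simp_all

lemma first_moment_eq: "first_moment G \<sigma> = (LINT x|\<sigma>c. (\<Sum>i = 1..num_first G. (xc i x)\<^sup>2))"
  unfolding first_moment_def \<sigma>c_def
  by (subst integral_distr)
    (auto simp: space_\<sigma> unit_sphere_def coord_eq_xc intro!: Bochner_Integration.integral_cong)

end

sublocale polar_homogeneous_group \<subseteq> \<sigma>c: finite_measure \<sigma>c
  unfolding \<sigma>c_def by (rule finite_measure.finite_measure_distr[OF finite_\<sigma> log_measurable_\<sigma>])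

context polar_homogeneous_group
begin

lemma polar_integral:
  fixes f :: "'a \<Rightarrow> real"
  assumes "integrable lborel f"
  shows "(LBINT x. f x) = (LINT r:{0<..}|lborel. (LINT x|\<sigma>c. f (dl r x) * r powr (hom_dim G - 1)))"
proof -
  have [measurable]: "f \<in> borel_measurable borel" using assms by auto
  have "integrable (haar G) (\<lambda>h. f (log_map G h))"
    using assms by (subst embed_haar, subst integrable_distr_eq)
      (use log_measurable_haar exp_measurable_haar in \<open>auto intro: measurable_compose\<close>)
  then have "(LINT h|haar G. f (log_map G h)) = (LINT r:{0<..}|lborel.
      (LINT h|\<sigma>. f (log_map G (group_dil G r h)) * r powr (hom_dim G - 1)))"
    using surface by (simp add: surface_measure_def)
  moreover have "(LINT h|haar G. f (log_map G h)) = (LBINT x. f x)"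
    by (subst embed_haar, subst integral_distr)
      (use log_measurable_haar exp_measurable_haar in \<open>auto intro: measurable_compose\<close>)
  moreover have "(LINT h|\<sigma>. f (log_map G (group_dil G r h)) * r powr (hom_dim G - 1)) =
      (LINT x|\<sigma>c. f (dl r x) * r powr (hom_dim G - 1))" if "r > 0" for r
    unfolding \<sigma>c_def using that
    by (subst integral_distr)
      (auto simp: space_\<sigma> unit_sphere_def group_dil_def dil_eq_dl intro!: Bochner_Integration.integral_cong)
  then have "(LINT r:{0<..}|lborel. (LINT h|\<sigma>. f (log_map G (group_dil G r h)) * r powr (hom_dim G - 1))) =
      (LINT r:{0<..}|lborel. (LINT x|\<sigma>c. f (dl r x) * r powr (hom_dim G - 1)))"
    by (intro set_lebesgue_integral_cong) auto
  ultimately show ?thesis by simp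
qed

definition polar_push :: "'a measure" where
  "polar_push = distr (density (lborel \<Otimes>\<^sub>M \<sigma>c)
     (\<lambda>p. ennreal (indicator {0<..} (fst p) * fst p powr (hom_dim G - 1)))) borel (\<lambda>p. dl (fst p) (snd p))"

lemma nn_integral_polar_push:
  assumes [measurable]: "f \<in> borel_measurable borel"
  shows "(\<integral>\<^sup>+x. f x \<partial>polar_push) =
    (\<integral>\<^sup>+r. ennreal (indicator {0<..} r * r powr (hom_dim G - 1)) * (\<integral>\<^sup>+x. f (dl r x) \<partial>\<sigma>c) \<partial>lborel)"
proof -
  have "(\<integral>\<^sup>+x. f x \<partial>polar_push) = (\<integral>\<^sup>+p. ennreal (indicator {0<..} (fst p) * fst p powr (hom_dim G - 1)) *
      f (dl (fst p) (snd p)) \<partial>(lborel \<Otimes>\<^sub>M \<sigma>c))"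
    unfolding polar_push_def
    by (subst nn_integral_distr, simp, simp, subst nn_integral_density) auto
  also have "\<dots> = (\<integral>\<^sup>+r. \<integral>\<^sup>+x. ennreal (indicator {0<..} r * r powr (hom_dim G - 1)) * f (dl r x) \<partial>\<sigma>c \<partial>lborel)"
    by (subst \<sigma>c.nn_integral_fst[symmetric]) auto
  also have "\<dots> = (\<integral>\<^sup>+r. ennreal (indicator {0<..} r * r powr (hom_dim G - 1)) * (\<integral>\<^sup>+x. f (dl r x) \<partial>\<sigma>c) \<partial>lborel)"
    by (intro nn_integral_cong nn_integral_cmult) auto
  finally show ?thesis .
qed

text \<open>The polar formula for the indicator of a box says that both measures agree on it;
  equality of the measures then extends the formula to every nonnegative Borel function, integrable
  or not.\<close>

lemma polar_measure: "lborel = polar_push"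
proof (rule lborel_eqI)
  fix l u :: 'a
  assume le: "\<And>b. b \<in> Basis \<Longrightarrow> l \<bullet> b \<le> u \<bullet> b"
  define f :: "'a \<Rightarrow> real" where "f = indicator (box l u)"
  have [measurable]: "f \<in> borel_measurable borel" by (simp add: f_def)
  define h where "h r = indicator {0<..} r * r powr (hom_dim G - 1)" for r :: real
  have [measurable]: "h \<in> borel_measurable borel" unfolding h_def by measurable
  have h0: "h r \<ge> 0" for r by (simp add: h_def)
  have f0: "0 \<le> f x" "f x \<le> 1" for x by (auto simp: f_def indicator_def)
  define F where "F r = (LINT x|\<sigma>c. f (dl r x))" for r
  have F: "(\<integral>\<^sup>+x. ennreal (f (dl r x)) \<partial>\<sigma>c) = ennreal (F r)" for r
    unfolding F_def using f0
    by (intro nn_integral_eq_integral \<sigma>c.integrable_const_bound[where B=1]) auto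
  have Fm [measurable]: "F \<in> borel_measurable borel"
    unfolding F_def by measurable
  have F_bound: "0 \<le> F r" "F r \<le> measure \<sigma>c UNIV" for r
  proof -
    show "0 \<le> F r" unfolding F_def using f0 by (intro Bochner_Integration.integral_nonneg) auto
    have "F r \<le> (LINT x|\<sigma>c. 1)"
      unfolding F_def using f0 by (intro integral_mono \<sigma>c.integrable_const_bound[where B=1]) auto
    then show "F r \<le> measure \<sigma>c UNIV" by simp
  qed
  have "bounded (nn ` cbox l u)"
    by (intro compact_imp_bounded compact_continuous_image continuous_intros compact_cbox)
  then obtain R0 where "\<And>x. x \<in> cbox l u \<Longrightarrow> nn x \<le> R0" unfolding bounded_iff by force
  then have R0: "\<And>x. x \<in> box l u \<Longrightarrow> nn x \<le> R0" using box_subset_cbox by blast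
  define R where "R = max 1 R0"
  have F_zero: "F r = 0" if "r > R" for r
  proof -
    have "AE x in \<sigma>c. f (dl r x) = 0"
      using AE_\<sigma>c
    proof eventually_elim
      case (elim x)
      then have "nn (dl r x) = r" using that by (simp add: R_def nn_dl)
      then show ?case using R0[of "dl r x"] that by (auto simp: f_def R_def indicator_def)
    qed
    then show ?thesis unfolding F_def by (simp add: integral_eq_zero_AE)
  qed
  \<comment> \<open>The radial integrand is bounded and vanishes beyond \<open>R\<close>.
    Integrability is what identifies its real integral with the nonnegative one; otherwise the
    former would be \<open>0\<close> by convention.\<close>
  have int: "integrable lborel (\<lambda>r. h r * F r)"
  proof (rule Bochner_Integration.integrable_bound)
    show "integrable lborel (\<lambda>r. R powr (hom_dim G - 1) * measure \<sigma>c UNIV * indicator {0..R} r)"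
      using emeasure_lborel_Icc[of 0 R]
      by (intro integrable_mult_right integrable_real_indicator) (auto simp: R_def)
    show "AE r in lborel. norm (h r * F r) \<le> norm (R powr (hom_dim G - 1) * measure \<sigma>c UNIV * indicator {0..R} r)"
    proof (rule AE_I2)
      fix r :: real
      show "norm (h r * F r) \<le> norm (R powr (hom_dim G - 1) * measure \<sigma>c UNIV * indicator {0..R} r)"
      proof (cases "0 < r \<and> r \<le> R")
        case True
        then have "r powr (hom_dim G - 1) \<le> R powr (hom_dim G - 1)"
          using hom_dim_ge_one by (intro powr_mono2) auto
        then have "r powr (hom_dim G - 1) * F r \<le> R powr (hom_dim G - 1) * measure \<sigma>c UNIV"
          using F_bound by (intro mult_mono) auto
        then show ?thesis using True F_bound[of r] by (simp add: h_def)
      next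
        case False
        then have *: "h r * F r = 0" using F_zero[of r] by (auto simp: h_def)
        show ?thesis unfolding * norm_zero by (rule norm_ge_zero)
      qed
    qed
  qed simp
  have "emeasure polar_push (box l u) = (\<integral>\<^sup>+x. ennreal (f x) \<partial>polar_push)"
    by (simp add: f_def polar_push_def ennreal_indicator)
  also have "\<dots> = (\<integral>\<^sup>+r. ennreal (h r) * ennreal (F r) \<partial>lborel)"
    by (subst nn_integral_polar_push) (simp_all add: F h_def)
  also have "\<dots> = (\<integral>\<^sup>+r. ennreal (h r * F r) \<partial>lborel)"
    by (simp add: ennreal_mult h0 F_bound)
  also have "\<dots> = ennreal (LBINT r. h r * F r)"
    using h0 F_bound by (intro nn_integral_eq_integral int) auto
  also have "(LBINT r. h r * F r) = (LINT r:{0<..}|lborel. (LINT x|\<sigma>c. f (dl r x) * r powr (hom_dim G - 1)))"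
    unfolding set_lebesgue_integral_def by (intro Bochner_Integration.integral_cong) (auto simp: h_def F_def)
  also have "\<dots> = (LBINT x. f x)"
    unfolding f_def
    by (intro polar_integral[symmetric] integrable_real_indicator) (simp_all add: emeasure_lborel_box_finite[unfolded infinity_ennreal_def])
  also have "\<dots> = (\<Prod>b\<in>Basis. (u - l) \<bullet> b)"
    using le by (simp add: f_def measure_lborel_box_eq)
  finally show "emeasure polar_push (box l u) = ennreal (\<Prod>b\<in>Basis. (u - l) \<bullet> b)" .
qed (simp add: polar_push_def)

lemma polar_nn_integral:
  assumes [measurable]: "f \<in> borel_measurable borel"
  shows "(\<integral>\<^sup>+x. f x \<partial>lborel) =
    (\<integral>\<^sup>+r. ennreal (indicator {0<..} r * r powr (hom_dim G - 1)) * (\<integral>\<^sup>+x. f (dl r x) \<partial>\<sigma>c) \<partial>lborel)"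
  using nn_integral_polar_push[OF assms] by (simp add: polar_measure[symmetric])

end

section \<open>Translates of a test function\<close>

locale polar_test_fun = polar_homogeneous_group G N \<sigma>
  for G :: "('g, 'a::euclidean_space) homogeneous_group_data" and N :: "'g \<Rightarrow> real" and \<sigma> :: "'g measure" +
  fixes u :: "'g \<Rightarrow> real"
  assumes test: "test_fun G u"
begin

definition w :: "'a \<Rightarrow> real" where
  "w x = u (exp_map G x)"

definition K :: "'a set" where
  "K = closure {x. w x \<noteq> 0}"

lemma w_smooth: "smooth_on UNIV w"
  using test by (simp add: test_fun_def smooth_fun_def w_def[abs_def] o_def)

lemma w_comp: "u \<circ> exp_map G = w"
  by (simp add: w_def[abs_def] o_def)

lemma compact_K: "compact K"
  using test by (simp add: test_fun_def K_def w_def)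

lemma w_zero: "x \<notin> K \<Longrightarrow> w x = 0"
  using closure_subset[of "{x. w x \<noteq> 0}"] by (auto simp: K_def)

lemma continuous_on_w [continuous_intros]:
  "continuous_on S f \<Longrightarrow> continuous_on S (\<lambda>x. w (f x))"
  using continuous_on_compose2[OF smooth_on_continuous[OF w_smooth]] by blast

lemma w_measurable [measurable]: "w \<in> borel_measurable borel"
  by (intro borel_measurable_continuous_onI continuous_intros)

lemma cmul_measurable [measurable]:
  assumes [measurable]: "f \<in> borel_measurable M" "g \<in> borel_measurable M"
  shows "(\<lambda>x. cmul (f x) (g x)) \<in> borel_measurable M"
proof -
  have "continuous_on UNIV (\<lambda>p :: 'a \<times> 'a. cmul (fst p) (snd p))"
    by (intro continuous_intros)
  then show ?thesis
    using borel_measurable_continuous_Pair[of f M g cmul] assms by simp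
qed

lemma w_differentiable: "w differentiable at x"
  by (rule smooth_on_UNIV_differentiable[OF w_smooth])

section \<open>Derivatives along left-invariant fields\<close>

definition DX :: "'a \<Rightarrow> 'a \<Rightarrow> real" where
  "DX v x = frechet_derivative w (at x) (lfield x v)"

lemma left_field_eq_DX: "left_field G v u (exp_map G x) = DX v x"
  using left_field_exp[of u x v] by (simp add: w_comp w_differentiable DX_def)

lemma linear_DX: "linear (\<lambda>v. DX v x)"
  unfolding DX_def
  using linear_compose[OF linear_D_right linear_frechet_derivative[OF w_differentiable]] by (simp add: o_def)

lemma DX_sum: "DX (\<Sum>i\<in>A. c i *\<^sub>R f i) x = (\<Sum>i\<in>A. c i * DX (f i) x)"
proof -
  interpret linear "\<lambda>v. DX v x" by (rule linear_DX)
  show ?thesis by (simp only: sum scale real_scaleR_def)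
qed

lemma frechet_w_expand: "frechet_derivative w (at x) v = (\<Sum>b\<in>Basis. (v \<bullet> b) * frechet_derivative w (at x) b)"
proof -
  interpret linear "frechet_derivative w (at x)" by (rule linear_frechet_derivative[OF w_differentiable])
  have "frechet_derivative w (at x) v = frechet_derivative w (at x) (\<Sum>b\<in>Basis. (v \<bullet> b) *\<^sub>R b)"
    by (simp only: euclidean_representation)
  then show ?thesis by (simp only: sum scale real_scaleR_def)
qed

lemma continuous_DX: "continuous_on UNIV (DX v)"
proof -
  have "continuous_on UNIV (\<lambda>x. lfield x v)"
  proof -
    have "continuous_on UNIV (\<lambda>x :: 'a. (x, 0 :: 'a))" by (intro continuous_intros)
    from continuous_on_compose2[OF smooth_on_continuous[OF D_right_smooth[of v]] this] show ?thesis by simp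
  qed
  moreover have "continuous_on UNIV (\<lambda>x. frechet_derivative w (at x) b)" for b
    by (rule smooth_on_continuous[OF smooth_on_UNIV_derivative[OF w_smooth]])
  ultimately show ?thesis
    unfolding DX_def frechet_w_expand[of _ "lfield _ v"] by (intro continuous_intros)
qed

lemma DX_measurable [measurable]: "DX v \<in> borel_measurable borel"
  by (rule borel_measurable_continuous_onI[OF continuous_DX])

lemma DX_zero: "x \<notin> K \<Longrightarrow> DX v x = 0"
proof -
  assume x: "x \<notin> K"
  have "(w has_derivative (\<lambda>_. 0)) (at x)"
    by (rule has_derivative_transform_within_open[of "\<lambda>_. 0" _ _ _ "- K"])
      (use x w_zero compact_imp_closed[OF compact_K] in \<open>auto simp: open_Compl\<close>)
  then have "frechet_derivative w (at x) = (\<lambda>_. 0)"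
    by (rule frechet_derivative_at[symmetric])
  then show ?thesis by (simp add: DX_def)
qed

lemma DX_bound: "\<exists>C\<ge>0. \<forall>v x. \<bar>DX v x\<bar> \<le> C * norm v"
proof -
  have "\<exists>c. \<forall>x. \<bar>DX b x\<bar> \<le> c" for b
  proof -
    have "bounded (DX b ` K)"
      by (intro compact_imp_bounded compact_continuous_image compact_K continuous_on_subset[OF continuous_DX]) auto
    then obtain c where "\<And>x. x \<in> K \<Longrightarrow> \<bar>DX b x\<bar> \<le> c" unfolding bounded_iff by auto
    then have "\<bar>DX b x\<bar> \<le> max c 0" for x
      using DX_zero[of x b] by (cases "x \<in> K") (auto simp: le_max_iff_disj)
    then show ?thesis by blast
  qed
  then obtain c where c: "\<And>b x. \<bar>DX b x\<bar> \<le> c b" by metis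
  have c0: "c b \<ge> 0" for b using c[of b 0] by (rule order_trans[OF abs_ge_zero])
  have "\<bar>DX v x\<bar> \<le> (\<Sum>b\<in>Basis. c b) * norm v" for v x
  proof -
    have "DX v x = DX (\<Sum>b\<in>Basis. (v \<bullet> b) *\<^sub>R b) x" by (simp only: euclidean_representation)
    also have "\<dots> = (\<Sum>b\<in>Basis. (v \<bullet> b) * DX b x)"
      by (rule DX_sum)
    also have "\<bar>\<dots>\<bar> \<le> (\<Sum>b\<in>Basis. \<bar>(v \<bullet> b) * DX b x\<bar>)" by (rule sum_abs)
    also have "\<dots> \<le> (\<Sum>b\<in>Basis. norm v * c b)"
      using c by (intro sum_mono) (auto simp: abs_mult intro!: mult_mono Basis_le_norm)
    also have "\<dots> = (\<Sum>b\<in>Basis. c b) * norm v" by (simp add: sum_distrib_left sum_distrib_right mult.commute)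
    finally show ?thesis .
  qed
  then show ?thesis using c0 by (intro exI[of _ "\<Sum>b\<in>Basis. c b"]) (auto intro: sum_nonneg)
qed

lemma w_cmul_line_DERIV:
  "((\<lambda>t. w (cmul h (t *\<^sub>R v))) has_real_derivative DX v (cmul h (t *\<^sub>R v))) (at t)"
proof -
  define x where "x = cmul h (t *\<^sub>R v)"
  have "(w has_derivative frechet_derivative w (at x)) (at (cmul x (0 *\<^sub>R v)))"
    using w_differentiable by (simp add: frechet_derivative_works)
  from has_derivative_compose[OF cmul_line_has_derivative this]
  have "((\<lambda>s. w (cmul x (s *\<^sub>R v))) has_derivative (\<lambda>s. frechet_derivative w (at x) (lfield x (s *\<^sub>R v)))) (at 0)" .
  moreover have "(\<lambda>s. frechet_derivative w (at x) (lfield x (s *\<^sub>R v))) = (*) (DX v x)"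
    using linear_cmul[OF linear_DX, of _ v x] by (simp add: fun_eq_iff DX_def mult.commute)
  ultimately have "((\<lambda>s. w (cmul x (s *\<^sub>R v))) has_real_derivative DX v x) (at 0)"
    by (simp add: has_field_derivative_def)
  moreover have "cmul x (s *\<^sub>R v) = cmul h ((s + t) *\<^sub>R v)" for s
    by (simp add: x_def cmul_assoc cmul_scaleR add.commute)
  ultimately show ?thesis
    using DERIV_shift[of "\<lambda>t. w (cmul h (t *\<^sub>R v))" "DX v x" 0 t] by (simp add: x_def)
qed

text \<open>The mean value theorem along the curve
  \<open>t \<mapsto> cmul h (t *\<^sub>R v)\<close>, whose velocity is the left-invariant field of
  \<open>v\<close>; since \<open>DX\<close> is bounded on the whole group, the constant does not
  depend on \<open>h\<close>.\<close>

lemma w_cmul_diff_bound: "\<exists>C\<ge>0. \<forall>h v. \<bar>w (cmul h v) - w h\<bar> \<le> C * norm v"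
proof -
  obtain C where C: "C \<ge> 0" "\<And>v x. \<bar>DX v x\<bar> \<le> C * norm v" using DX_bound by blast
  have "\<bar>w (cmul h v) - w h\<bar> \<le> C * norm v" for h v
  proof -
    obtain z where "w (cmul h (1 *\<^sub>R v)) - w (cmul h (0 *\<^sub>R v)) = (1 - 0) * DX v (cmul h (z *\<^sub>R v))"
      using MVT2[of 0 1 "\<lambda>t. w (cmul h (t *\<^sub>R v))" "\<lambda>t. DX v (cmul h (t *\<^sub>R v))"] w_cmul_line_DERIV by auto
    then show ?thesis using C(2) by simp
  qed
  then show ?thesis using C(1) by blast
qed

lemma w_cmul_has_derivative: "((\<lambda>v. w (cmul h v)) has_derivative (\<lambda>v. DX v h)) (at 0)"
proof -
  have "(w has_derivative frechet_derivative w (at h)) (at (cmul h 0))"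
    using w_differentiable by (simp add: frechet_derivative_works)
  from has_derivative_compose[OF cmul_has_derivative this] show ?thesis by (simp add: DX_def)
qed

lemma w_dl_quotient_tendsto:
  "((\<lambda>r. (w (cmul h (dl r x)) - w h) / r) \<longlongrightarrow> DX (horizontal x) h) (at_right 0)"
proof -
  define e where "e v = (w (cmul h v) - w h - DX v h) / norm v" for v
  have bl: "bounded_linear (\<lambda>v. DX v h)" using linear_DX by (simp add: linear_conv_bounded_linear)
  have "(e \<longlongrightarrow> 0) (at 0)"
    using w_cmul_has_derivative[of h] unfolding has_derivative_at_within
    by (simp add: e_def[abs_def] divide_inverse_commute)
  then have e: "(e \<longlongrightarrow> e 0) (at 0)" by (simp add: e_def)
  have "((\<lambda>r. r *\<^sub>R (dl r x /\<^sub>R r)) \<longlongrightarrow> 0 *\<^sub>R horizontal x) (at_right 0)"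
    by (intro tendsto_scaleR tendsto_ident_at dl_over_tendsto)
  moreover have "\<forall>\<^sub>F r in at_right (0::real). r *\<^sub>R (dl r x /\<^sub>R r) = dl r x"
    using eventually_at_right_less[of "0::real"] by eventually_elim simp
  ultimately have "((\<lambda>r. dl r x) \<longlongrightarrow> 0) (at_right 0)"
    using Lim_transform_eventually by fastforce
  then have "((\<lambda>r. e (dl r x)) \<longlongrightarrow> e 0) (at_right 0)"
    by (rule continuous_at_compose[unfolded o_def] tendsto_compose[OF e])
  then have "((\<lambda>r. e (dl r x) * norm (dl r x /\<^sub>R r) + DX (dl r x /\<^sub>R r) h) \<longlongrightarrow>
      0 * norm (horizontal x) + DX (horizontal x) h) (at_right 0)"
    by (intro tendsto_add tendsto_mult tendsto_norm dl_over_tendsto bounded_linear.tendsto[OF bl])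
      (simp add: e_def)
  moreover have "\<forall>\<^sub>F r in at_right 0. e (dl r x) * norm (dl r x /\<^sub>R r) + DX (dl r x /\<^sub>R r) h =
      (w (cmul h (dl r x)) - w h) / r"
    using eventually_at_right_less[of "0::real"]
  proof eventually_elim
    case (elim r)
    have "DX (dl r x /\<^sub>R r) h = DX (dl r x) h / r"
      using linear_cmul[OF linear_DX] by (simp add: divide_inverse_commute)
    moreover have "e (dl r x) * norm (dl r x) = w (cmul h (dl r x)) - w h - DX (dl r x) h"
      using linear_0[OF linear_DX] by (cases "dl r x = 0") (simp_all add: e_def)
    then have "e (dl r x) * norm (dl r x /\<^sub>R r) = (w (cmul h (dl r x)) - w h - DX (dl r x) h) / r"
      using elim by (simp add: divide_inverse_commute mult.left_commute)
    ultimately show ?case using elim by (simp add: diff_divide_distrib)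
  qed
  ultimately show ?thesis using Lim_transform_eventually by fastforce
qed

definition R0 :: real where
  "R0 = (SOME R. R > 0 \<and> (\<forall>x\<in>K. nn x \<le> R))"

lemma R0: "R0 > 0" "x \<in> K \<Longrightarrow> nn x \<le> R0"
proof -
  have "bounded (nn ` K)"
    by (intro compact_imp_bounded compact_continuous_image compact_K continuous_intros)
  then obtain R where "\<And>x. x \<in> K \<Longrightarrow> nn x \<le> R" unfolding bounded_iff by force
  then have "max R 1 > 0 \<and> (\<forall>x\<in>K. nn x \<le> max R 1)" by (simp add: le_max_iff_disj)
  then have "R0 > 0 \<and> (\<forall>x\<in>K. nn x \<le> R0)" unfolding R0_def by (rule someI)
  then show "R0 > 0" "x \<in> K \<Longrightarrow> nn x \<le> R0" by auto
qed

lemma w_nonzero_nn: "w x \<noteq> 0 \<Longrightarrow> nn x \<le> R0"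
  using w_zero R0 by blast

lemma w_cmul_zero: "nn h > R0 + nn k \<Longrightarrow> w (cmul h k) = 0 \<and> w h = 0"
proof -
  assume *: "nn h > R0 + nn k"
  have "nn h \<le> nn (cmul h k) + nn k"
    using nn_cmul[of "cmul h k" "- k"] by (simp add: cmul_assoc)
  then have "nn (cmul h k) > R0" "nn h > R0" using * nn_nonneg[of k] by linarith+
  then show ?thesis using w_nonzero_nn by force
qed

section \<open>The integrated square difference\<close>

definition phi :: "'a \<Rightarrow> ennreal" where
  "phi k = (\<integral>\<^sup>+h. ennreal ((w (cmul h k) - w h)\<^sup>2) \<partial>lborel)"

lemma phi_measurable [measurable]: "phi \<in> borel_measurable borel"
  unfolding phi_def by measurable

definition U :: ennreal where
  "U = (\<integral>\<^sup>+h. ennreal ((w h)\<^sup>2) \<partial>lborel)"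

lemma nn_integral_cmul_right:
  "f \<in> borel_measurable borel \<Longrightarrow> (\<integral>\<^sup>+h. f (cmul h k) \<partial>lborel) = (\<integral>\<^sup>+h. f h \<partial>lborel)"
  for f :: "'a \<Rightarrow> ennreal"
proof -
  assume [measurable]: "f \<in> borel_measurable borel"
  have "(\<integral>\<^sup>+h. f h \<partial>distr lborel borel (\<lambda>h. cmul h k)) = (\<integral>\<^sup>+h. f (cmul h k) \<partial>lborel)"
    by (rule nn_integral_distr) measurable
  then show ?thesis by (simp add: lborel_distr_cmul_right)
qed

lemma nn_integral_cmul_left:
  "f \<in> borel_measurable borel \<Longrightarrow> (\<integral>\<^sup>+h. f (cmul k h) \<partial>lborel) = (\<integral>\<^sup>+h. f h \<partial>lborel)"
  for f :: "'a \<Rightarrow> ennreal"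
proof -
  assume [measurable]: "f \<in> borel_measurable borel"
  have "(\<integral>\<^sup>+h. f h \<partial>distr lborel borel (cmul k)) = (\<integral>\<^sup>+h. f (cmul k h) \<partial>lborel)"
    by (rule nn_integral_distr) measurable
  then show ?thesis by (simp add: lborel_distr_cmul_left)
qed

lemma nn_integral_compact_finite:
  assumes "continuous_on UNIV f" "\<And>x. x \<notin> K \<Longrightarrow> f x = 0"
  shows "(\<integral>\<^sup>+x. ennreal (f x) \<partial>lborel) < \<infinity>"
proof -
  have "bounded (f ` K)"
    by (intro compact_imp_bounded compact_continuous_image compact_K continuous_on_subset[OF assms(1)]) auto
  then obtain c where c: "\<And>x. x \<in> K \<Longrightarrow> \<bar>f x\<bar> \<le> c" unfolding bounded_iff by auto
  have "(\<integral>\<^sup>+x. ennreal (f x) \<partial>lborel) \<le> (\<integral>\<^sup>+x. ennreal c * indicator K x \<partial>lborel)"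
    using c assms(2) by (intro nn_integral_mono) (auto simp: indicator_def intro!: ennreal_leI dest: abs_le_D1)
  also have "\<dots> = ennreal c * emeasure lborel K"
    using compact_K by (subst nn_integral_cmult_indicator) (auto simp: borel_compact)
  also have "\<dots> < \<infinity>"
    using emeasure_compact_finite[OF compact_K] by (simp add: ennreal_mult_less_top)
  finally show ?thesis .
qed

lemma U_finite: "U < \<infinity>"
  unfolding U_def by (rule nn_integral_compact_finite) (auto intro!: continuous_intros simp: w_zero)

text \<open>\<open>(a - b)^2 \<le> 2 a^2 + 2 b^2\<close>, and right invariance turns the translated
  term into \<open>U\<close>.\<close>

lemma phi_le: "phi k \<le> 4 * U"
proof -
  have "phi k \<le> (\<integral>\<^sup>+h. 2 * ennreal ((w (cmul h k))\<^sup>2) + 2 * ennreal ((w h)\<^sup>2) \<partial>lborel)"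
    unfolding phi_def
  proof (rule nn_integral_mono)
    fix h
    have "(w (cmul h k) - w h)\<^sup>2 \<le> 2 * (w (cmul h k))\<^sup>2 + 2 * (w h)\<^sup>2"
      using zero_le_power2[of "w (cmul h k) + w h"] by (simp add: power2_eq_square algebra_simps)
    then have "ennreal ((w (cmul h k) - w h)\<^sup>2) \<le> ennreal (2 * (w (cmul h k))\<^sup>2 + 2 * (w h)\<^sup>2)"
      by (rule ennreal_leI)
    then show "ennreal ((w (cmul h k) - w h)\<^sup>2) \<le> 2 * ennreal ((w (cmul h k))\<^sup>2) + 2 * ennreal ((w h)\<^sup>2)"
      by (simp add: ennreal_mult)
  qed
  also have "\<dots> = 2 * (\<integral>\<^sup>+h. ennreal ((w (cmul h k))\<^sup>2) \<partial>lborel) + 2 * U"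
    by (simp add: nn_integral_add nn_integral_cmult U_def)
  also have "\<dots> = 2 * U + 2 * U"
    using nn_integral_cmul_right[of "\<lambda>h. ennreal ((w h)\<^sup>2)" k] by (simp add: U_def)
  also have "\<dots> = 4 * U" by (simp flip: distrib_right)
  finally show ?thesis .
qed

text \<open>If \<open>h\<close> and \<open>h k\<close> both met the support, the triangle inequality
  for \<open>k\<close>, written as the inverse of \<open>h\<close> times \<open>h k\<close>, would
  give \<open>nn k \<le> 2 * R0\<close>. Hence the mixed term of the square vanishes.\<close>

lemma phi_far: "nn k > 2 * R0 \<Longrightarrow> phi k = 2 * U"
proof -
  assume k: "nn k > 2 * R0"
  have "phi k = (\<integral>\<^sup>+h. ennreal ((w (cmul h k))\<^sup>2) + ennreal ((w h)\<^sup>2) \<partial>lborel)"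
    unfolding phi_def
  proof (rule nn_integral_cong)
    fix h
    have "w (cmul h k) = 0 \<or> w h = 0"
    proof (rule ccontr)
      assume "\<not> ?thesis"
      then have "nn (cmul h k) \<le> R0" "nn h \<le> R0" using w_nonzero_nn by auto
      then show False using nn_cmul[of "- h" "cmul h k"] k by simp
    qed
    then show "ennreal ((w (cmul h k) - w h)\<^sup>2) = ennreal ((w (cmul h k))\<^sup>2) + ennreal ((w h)\<^sup>2)"
      by auto
  qed
  also have "\<dots> = (\<integral>\<^sup>+h. ennreal ((w (cmul h k))\<^sup>2) \<partial>lborel) + U"
    by (simp add: nn_integral_add U_def)
  also have "\<dots> = U + U"
    using nn_integral_cmul_right[of "\<lambda>h. ennreal ((w h)\<^sup>2)" k] by (simp add: U_def)
  finally show ?thesis by (simp add: mult_2)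
qed

lemma nn_integral_haar_chart:
  assumes "(\<lambda>x. f (exp_map G x)) \<in> borel_measurable lborel"
  shows "(\<integral>\<^sup>+g. f g \<partial>haar G) = (\<integral>\<^sup>+x. f (exp_map G x) \<partial>lborel)"
  unfolding haar_def using assms by (intro nn_integral_embed_measure inj_exp measurable_embed_measure1)

text \<open>Substitute \<open>g = h k\<close> in the inner integral.\<close>

lemma D_norm_sq_eq_phi:
  "D_norm_sq G N s u = (\<integral>\<^sup>+k. phi k * ennreal (1 / nn k powr (hom_dim G + 2 * s)) \<partial>lborel)"
proof -
  define p where "p = hom_dim G + 2 * s"
  define F where "F x y = ennreal ((w y - w x)\<^sup>2 / nn (cmul (- x) y) powr p)" for x y
  have F_meas [measurable]: "(\<lambda>q. F (fst q) (snd q)) \<in> borel_measurable (borel \<Otimes>\<^sub>M borel)"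
    unfolding F_def by measurable
  have F_meas1 [measurable]: "F x \<in> borel_measurable borel" for x
    unfolding F_def by measurable
  have I_meas [measurable]: "(\<lambda>x. \<integral>\<^sup>+y. F x y \<partial>lborel) \<in> borel_measurable borel"
    unfolding F_def by measurable
  have inner: "(\<integral>\<^sup>+g. ennreal (\<bar>u g - u (exp_map G x)\<bar>\<^sup>2 / N (inv\<^bsub>G\<^esub> exp_map G x \<otimes>\<^bsub>G\<^esub> g) powr p) \<partial>haar G)
      = (\<integral>\<^sup>+y. F x y \<partial>lborel)" for x
  proof -
    define f where "f g = ennreal (\<bar>u g - u (exp_map G x)\<bar>\<^sup>2 / N (inv\<^bsub>G\<^esub> exp_map G x \<otimes>\<^bsub>G\<^esub> g) powr p)" for g
    have *: "f (exp_map G y) = F x y" for y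
      by (simp add: f_def F_def w_def nn_def exp_cmul exp_minus)
    have "(\<integral>\<^sup>+g. f g \<partial>haar G) = (\<integral>\<^sup>+y. f (exp_map G y) \<partial>lborel)"
      by (rule nn_integral_haar_chart) (simp add: *)
    then show ?thesis unfolding * by (simp only: f_def)
  qed
  have "D_norm_sq G N s u = (\<integral>\<^sup>+x. \<integral>\<^sup>+y. F x y \<partial>lborel \<partial>lborel)"
  proof -
    define J where "J h = (\<integral>\<^sup>+g. ennreal (\<bar>u g - u h\<bar>\<^sup>2 / N (inv\<^bsub>G\<^esub> h \<otimes>\<^bsub>G\<^esub> g) powr p) \<partial>haar G)" for h
    have *: "J (exp_map G x) = (\<integral>\<^sup>+y. F x y \<partial>lborel)" for x
      by (simp only: J_def inner)
    have "(\<integral>\<^sup>+h. J h \<partial>haar G) = (\<integral>\<^sup>+x. J (exp_map G x) \<partial>lborel)"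
      by (rule nn_integral_haar_chart) (simp add: *)
    then show ?thesis unfolding * by (simp only: J_def D_norm_sq_def p_def)
  qed
  also have "\<dots> = (\<integral>\<^sup>+x. \<integral>\<^sup>+k. F x (cmul x k) \<partial>lborel \<partial>lborel)"
    by (intro nn_integral_cong nn_integral_cmul_left[symmetric]) measurable
  also have "\<dots> = (\<integral>\<^sup>+k. \<integral>\<^sup>+x. F x (cmul x k) \<partial>lborel \<partial>lborel)"
    by (intro lborel_pair.Fubini') (unfold F_def, measurable)
  also have "\<dots> = (\<integral>\<^sup>+k. phi k * ennreal (1 / nn k powr p) \<partial>lborel)"
  proof (rule nn_integral_cong)
    fix k
    have "(\<integral>\<^sup>+x. F x (cmul x k) \<partial>lborel) =
        (\<integral>\<^sup>+x. ennreal ((w (cmul x k) - w x)\<^sup>2) * ennreal (1 / nn k powr p) \<partial>lborel)"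
      by (simp add: F_def ennreal_mult[symmetric])
    then show "(\<integral>\<^sup>+x. F x (cmul x k) \<partial>lborel) = phi k * ennreal (1 / nn k powr p)"
      by (simp add: phi_def nn_integral_multc)
  qed
  finally show ?thesis by (simp add: p_def)
qed

section \<open>Polar form of the squared norm\<close>

definition Psi :: "real \<Rightarrow> ennreal" where
  "Psi r = (\<integral>\<^sup>+x. phi (dl r x) \<partial>\<sigma>c)"

lemma Psi_measurable [measurable]: "Psi \<in> borel_measurable borel"
  unfolding Psi_def by measurable

text \<open>On the unit sphere \<open>nn (dl r x) = r\<close>, so the kernel leaves the inner
  integral and the homogeneous dimension cancels:
  \<open>(Q - 1) - (Q + 2 * s) = - 1 - 2 * s\<close>.\<close>

lemma D_norm_sq_eq_Psi:
  "D_norm_sq G N s u = (\<integral>\<^sup>+r. ennreal (r powr (- 1 - 2 * s)) * Psi r * indicator {0<..} r \<partial>lborel)"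
proof -
  have "D_norm_sq G N s u = (\<integral>\<^sup>+r. ennreal (indicator {0<..} r * r powr (hom_dim G - 1)) *
      (\<integral>\<^sup>+x. phi (dl r x) * ennreal (1 / nn (dl r x) powr (hom_dim G + 2 * s)) \<partial>\<sigma>c) \<partial>lborel)"
    unfolding D_norm_sq_eq_phi by (rule polar_nn_integral) measurable
  also have "\<dots> = (\<integral>\<^sup>+r. ennreal (r powr (- 1 - 2 * s)) * Psi r * indicator {0<..} r \<partial>lborel)"
  proof (rule nn_integral_cong)
    fix r :: real
    show "ennreal (indicator {0<..} r * r powr (hom_dim G - 1)) *
        (\<integral>\<^sup>+x. phi (dl r x) * ennreal (1 / nn (dl r x) powr (hom_dim G + 2 * s)) \<partial>\<sigma>c) =
        ennreal (r powr (- 1 - 2 * s)) * Psi r * indicator {0<..} r"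
    proof (cases "r > 0")
      case True
      have "(\<integral>\<^sup>+x. phi (dl r x) * ennreal (1 / nn (dl r x) powr (hom_dim G + 2 * s)) \<partial>\<sigma>c) =
          (\<integral>\<^sup>+x. phi (dl r x) * ennreal (1 / r powr (hom_dim G + 2 * s)) \<partial>\<sigma>c)"
        by (rule nn_integral_cong_AE) (use AE_\<sigma>c in eventually_elim, simp add: nn_dl True)
      also have "\<dots> = Psi r * ennreal (1 / r powr (hom_dim G + 2 * s))"
        unfolding Psi_def by (rule nn_integral_multc) measurable
      finally have *: "(\<integral>\<^sup>+x. phi (dl r x) * ennreal (1 / nn (dl r x) powr (hom_dim G + 2 * s)) \<partial>\<sigma>c) = \<dots>" .
      have "r powr (hom_dim G - 1) * (1 / r powr (hom_dim G + 2 * s)) = r powr (- 1 - 2 * s)"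
        using True by (simp add: powr_diff[symmetric] divide_inverse powr_minus[symmetric] powr_add[symmetric])
      then have "ennreal (r powr (hom_dim G - 1)) * ennreal (1 / r powr (hom_dim G + 2 * s)) =
          ennreal (r powr (- 1 - 2 * s))"
        by (simp add: ennreal_mult[symmetric])
      then show ?thesis unfolding * using True by (simp add: mult_ac flip: mult.assoc)
    qed simp
  qed
  finally show ?thesis .
qed

abbreviation mass :: real where "mass \<equiv> measure \<sigma>c UNIV"

lemma Psi_le: "Psi r \<le> 4 * U * ennreal mass"
proof -
  have "Psi r \<le> (\<integral>\<^sup>+x. 4 * U \<partial>\<sigma>c)" unfolding Psi_def by (intro nn_integral_mono phi_le)
  then show ?thesis by (simp add: \<sigma>c.emeasure_eq_measure)
qed

lemma Psi_far: "r > 2 * R0 \<Longrightarrow> Psi r = 2 * U * ennreal mass"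
proof -
  assume r: "r > 2 * R0"
  then have "r > 0" using R0 by simp
  have "Psi r = (\<integral>\<^sup>+x. 2 * U \<partial>\<sigma>c)"
    unfolding Psi_def
    by (rule nn_integral_cong_AE) (use AE_\<sigma>c in eventually_elim, simp add: nn_dl \<open>r > 0\<close> phi_far r)
  then show ?thesis by (simp add: \<sigma>c.emeasure_eq_measure)
qed

text \<open>The dominating function for the limit \<open>r \<rightarrow> 0\<close>. If
  \<open>nn h > R0 + 1\<close>, neither \<open>h\<close> nor its translate meets the support;
  otherwise the constant is the Lipschitz constant of \<open>w\<close>, times that of the dilations,
  times the Euclidean radius of the unit ball.\<close>

lemma quotient_bound:
  "\<exists>C\<ge>0. \<forall>r x h. 0 < r \<longrightarrow> r \<le> 1 \<longrightarrow> nn x = 1 \<longrightarrow>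
    ((w (cmul h (dl r x)) - w h) / r)\<^sup>2 \<le> C * indicator {h. nn h \<le> R0 + 1} h"
proof -
  obtain C where C: "C \<ge> 0" "\<And>h v. \<bar>w (cmul h v) - w h\<bar> \<le> C * norm v"
    using w_cmul_diff_bound by blast
  obtain D where D: "D \<ge> 0" "\<And>r v. 0 \<le> r \<Longrightarrow> r \<le> 1 \<Longrightarrow> norm (dl r v) \<le> D * r * norm v"
    using norm_dl_le by blast
  obtain E where E: "\<And>x. nn x \<le> 1 \<Longrightarrow> norm x \<le> E"
    using bounded_nn_le[of 1] unfolding bounded_iff by blast
  have "nn 0 \<le> 1" by (metis nn_eq_0 zero_le_one)
  from E[OF this] have E0: "E \<ge> 0" by simp
  define c where "c = C * (D * E)"
  have "((w (cmul h (dl r x)) - w h) / r)\<^sup>2 \<le> c\<^sup>2 * indicator {h. nn h \<le> R0 + 1} h"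
    if r: "0 < r" "r \<le> 1" and x: "nn x = 1" for r x h
  proof (cases "nn h \<le> R0 + 1")
    case True
    have "norm (dl r x) \<le> D * r * norm x" using D(2) r by simp
    also have "\<dots> \<le> D * r * E" using D(1) r E[of x] x by (intro mult_left_mono) auto
    finally have "\<bar>w (cmul h (dl r x)) - w h\<bar> \<le> C * (D * r * E)"
      using C by (meson mult_left_mono order_trans)
    then have "\<bar>w (cmul h (dl r x)) - w h\<bar> / r \<le> c"
      using r by (simp add: c_def pos_divide_le_eq mult_ac)
    then have "\<bar>(w (cmul h (dl r x)) - w h) / r\<bar> \<le> c" using r by (simp add: abs_divide)
    then have "\<bar>(w (cmul h (dl r x)) - w h) / r\<bar>\<^sup>2 \<le> c\<^sup>2" by (intro power_mono) auto
    then have "((w (cmul h (dl r x)) - w h) / r)\<^sup>2 \<le> c\<^sup>2" by (simp only: power2_abs)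
    then show ?thesis using True by simp
  next
    case False
    then have "nn h > R0 + nn (dl r x)" using r x by (simp add: nn_dl)
    then show ?thesis using w_cmul_zero by (simp add: False)
  qed
  then show ?thesis by (intro exI[of _ "c\<^sup>2"]) auto
qed

lemma phi_quotient:
  assumes "r > 0"
  shows "ennreal (1 / r\<^sup>2) * phi k = (\<integral>\<^sup>+h. ennreal (((w (cmul h k) - w h) / r)\<^sup>2) \<partial>lborel)"
proof -
  have "ennreal (1 / r\<^sup>2) * phi k = (\<integral>\<^sup>+h. ennreal (1 / r\<^sup>2) * ennreal ((w (cmul h k) - w h)\<^sup>2) \<partial>lborel)"
    unfolding phi_def by (rule nn_integral_cmult[symmetric]) measurable
  then show ?thesis using assms by (simp add: ennreal_mult[symmetric] power_divide)
qed

section \<open>Behaviour of \<open>Psi\<close> at small radii\<close>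

definition vol :: real where
  "vol = measure lborel {h. nn h \<le> R0 + 1}"

lemma emeasure_vol: "emeasure lborel {h. nn h \<le> R0 + 1} = ennreal vol"
  unfolding vol_def using emeasure_nn_le[of "R0 + 1"] by (intro emeasure_eq_ennreal_measure) auto

text \<open>Controls the singular weight at \<open>0\<close>: \<open>r powr (- 1 - 2 * s)\<close>
  times \<open>r\<^sup>2\<close> is integrable near \<open>0\<close> for \<open>s < 1\<close>, with
  a bound that survives \<open>s \<rightarrow> 0\<close>.\<close>

lemma Psi_le_square: "\<exists>C\<ge>0. \<forall>r. 0 < r \<longrightarrow> r \<le> 1 \<longrightarrow> Psi r \<le> ennreal (C * r\<^sup>2)"
proof -
  obtain C where C: "C \<ge> 0" "\<And>r x h. 0 < r \<Longrightarrow> r \<le> 1 \<Longrightarrow> nn x = 1 \<Longrightarrow>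
      ((w (cmul h (dl r x)) - w h) / r)\<^sup>2 \<le> C * indicator {h. nn h \<le> R0 + 1} h"
    using quotient_bound by blast
  have "Psi r \<le> ennreal (C * vol * mass * r\<^sup>2)" if r: "0 < r" "r \<le> 1" for r
  proof -
    have phi: "phi (dl r x) \<le> ennreal (C * vol * r\<^sup>2)" if x: "nn x = 1" for x
    proof -
      have "phi (dl r x) \<le> (\<integral>\<^sup>+h. ennreal (C * r\<^sup>2) * indicator {h. nn h \<le> R0 + 1} h \<partial>lborel)"
        unfolding phi_def
      proof (rule nn_integral_mono)
        fix h
        have "(w (cmul h (dl r x)) - w h)\<^sup>2 \<le> C * r\<^sup>2 * indicator {h. nn h \<le> R0 + 1} h"
          using C(2)[OF r x, of h] r by (simp add: power_divide pos_divide_le_eq mult_ac)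
        then show "ennreal ((w (cmul h (dl r x)) - w h)\<^sup>2) \<le> ennreal (C * r\<^sup>2) * indicator {h. nn h \<le> R0 + 1} h"
          by (auto simp: indicator_def intro: ennreal_leI split: if_splits)
      qed
      also have "\<dots> = ennreal (C * r\<^sup>2) * ennreal vol"
        by (subst nn_integral_cmult_indicator) (simp_all add: emeasure_vol)
      also have "\<dots> = ennreal (C * vol * r\<^sup>2)"
        using C(1) by (simp add: ennreal_mult[symmetric] vol_def mult_ac)
      finally show ?thesis .
    qed
    have "Psi r \<le> (\<integral>\<^sup>+x. ennreal (C * vol * r\<^sup>2) \<partial>\<sigma>c)"
      unfolding Psi_def by (rule nn_integral_mono_AE) (use AE_\<sigma>c in eventually_elim, rule phi)
    also have "\<dots> = ennreal (C * vol * mass * r\<^sup>2)"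
      using C(1) by (simp add: \<sigma>c.emeasure_eq_measure ennreal_mult[symmetric] vol_def mult_ac)
    finally show ?thesis .
  qed
  then show ?thesis using C(1) by (intro exI[of _ "C * vol * mass"]) (auto simp: vol_def)
qed

definition L_inf :: ennreal where
  "L_inf = (\<integral>\<^sup>+x. (\<integral>\<^sup>+h. ennreal ((DX (horizontal x) h)\<^sup>2) \<partial>lborel) \<partial>\<sigma>c)"

lemma DX_horizontal: "DX (horizontal x) h = (\<Sum>i = 1..num_first G. xc i x * DX (frame G i) h)"
  unfolding horizontal_def by (rule DX_sum)

lemma DX_horizontal_measurable [measurable]:
  "(\<lambda>p. DX (horizontal (fst p)) (snd p)) \<in> borel_measurable (borel \<Otimes>\<^sub>M borel)"
  unfolding DX_horizontal by measurable

text \<open>Dominated convergence twice, along sequences tending to \<open>0\<close>: in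
  \<open>h\<close> for a fixed point of the unit sphere, with a multiple of the indicator of a ball
  as majorant, then over the sphere, whose measure is finite, with a constant majorant.\<close>

lemma Psi_over_square_tendsto: "((\<lambda>r. ennreal (1 / r\<^sup>2) * Psi r) \<longlongrightarrow> L_inf) (at_right 0)"
proof (rule tendsto_at_right_sequentially[of 0 1])
  fix S :: "nat \<Rightarrow> real"
  assume S: "\<And>n. 0 < S n" "\<And>n. S n < 1" "S \<longlonglongrightarrow> 0"
  obtain C where C: "C \<ge> 0" "\<And>r x h. 0 < r \<Longrightarrow> r \<le> 1 \<Longrightarrow> nn x = 1 \<Longrightarrow>
      ((w (cmul h (dl r x)) - w h) / r)\<^sup>2 \<le> C * indicator {h. nn h \<le> R0 + 1} h"
    using quotient_bound by blast
  have Sr: "filterlim S (at_right 0) sequentially"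
    using S less_imp_neq[OF S(1)] by (auto simp: filterlim_at intro!: always_eventually)
  define f where "f n x = ennreal (1 / (S n)\<^sup>2) * phi (dl (S n) x)" for n x
  define g where "g x = (\<integral>\<^sup>+h. ennreal ((DX (horizontal x) h)\<^sup>2) \<partial>lborel)" for x
  have f_eq: "f n x = (\<integral>\<^sup>+h. ennreal (((w (cmul h (dl (S n) x)) - w h) / S n)\<^sup>2) \<partial>lborel)" for n x
    unfolding f_def by (rule phi_quotient) (rule S)
  have ind: "(\<integral>\<^sup>+h. ennreal (C * indicator {h. nn h \<le> R0 + 1} h) \<partial>lborel) = ennreal (C * vol)"
    using C(1) by (simp add: ennreal_mult ennreal_indicator nn_integral_cmult emeasure_vol vol_def)
  have f_le: "f n x \<le> ennreal (C * vol)" if "nn x = 1" for n x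
    unfolding f_eq ind[symmetric] using C(2)[OF S(1) less_imp_le[OF S(2)] that]
    by (intro nn_integral_mono ennreal_leI)
  have f_lim: "(\<lambda>n. f n x) \<longlonglongrightarrow> g x" if x: "nn x = 1" for x
    unfolding f_eq g_def
  proof (rule nn_integral_dominated_convergence)
    show "(\<integral>\<^sup>+h. ennreal (C * indicator {h. nn h \<le> R0 + 1} h) \<partial>lborel) < \<infinity>"
      unfolding ind by simp
    show "AE h in lborel. ennreal (((w (cmul h (dl (S n) x)) - w h) / S n)\<^sup>2)
        \<le> ennreal (C * indicator {h. nn h \<le> R0 + 1} h)" for n
      using C(2)[OF S(1) less_imp_le[OF S(2)] x] by (intro AE_I2 ennreal_leI)
    show "AE h in lborel. (\<lambda>n. ennreal (((w (cmul h (dl (S n) x)) - w h) / S n)\<^sup>2))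
        \<longlonglongrightarrow> ennreal ((DX (horizontal x) h)\<^sup>2)"
      by (intro AE_I2 tendsto_ennrealI tendsto_power filterlim_compose[OF w_dl_quotient_tendsto Sr])
  qed (measurable)
  have "(\<lambda>n. \<integral>\<^sup>+x. f n x \<partial>\<sigma>c) \<longlonglongrightarrow> (\<integral>\<^sup>+x. g x \<partial>\<sigma>c)"
  proof (rule nn_integral_dominated_convergence)
    show "AE x in \<sigma>c. f n x \<le> ennreal (C * vol)" for n
      using AE_\<sigma>c by eventually_elim (rule f_le)
    show "AE x in \<sigma>c. (\<lambda>n. f n x) \<longlonglongrightarrow> g x"
      using AE_\<sigma>c by eventually_elim (rule f_lim)
    show "(\<integral>\<^sup>+x. ennreal (C * vol) \<partial>\<sigma>c) < \<infinity>"
      by (simp add: \<sigma>c.emeasure_eq_measure ennreal_mult_less_top)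
    show "f n \<in> borel_measurable \<sigma>c" for n unfolding f_def by measurable
    show "g \<in> borel_measurable \<sigma>c" unfolding g_def by measurable
  qed simp
  moreover have "(\<integral>\<^sup>+x. f n x \<partial>\<sigma>c) = ennreal (1 / (S n)\<^sup>2) * Psi (S n)" for n
    unfolding f_def Psi_def by (rule nn_integral_cmult) measurable
  ultimately show "(\<lambda>n. ennreal (1 / (S n)\<^sup>2) * Psi (S n)) \<longlonglongrightarrow> L_inf"
    by (simp add: L_inf_def g_def)
qed simp

section \<open>The two limits of the squared norm\<close>

lemma D_norm_limit_1:
  assumes L: "L_inf = ennreal L" "L \<ge> 0"
  shows "((\<lambda>s. ennreal (1 - s) * D_norm_sq G N s u) \<longlongrightarrow> ennreal (L / 2)) (at_left 1)"
proof -
  obtain Ur where Ur: "U = ennreal Ur" "Ur \<ge> 0"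
    using U_finite by (cases U) auto
  show ?thesis
    unfolding D_norm_sq_eq_Psi
  proof (rule mellin_limit_1)
    show "Psi r \<le> ennreal (4 * Ur * mass)" for r
      using Psi_le[of r] Ur by (simp add: ennreal_mult)
    show "0 \<le> 4 * Ur * mass" using Ur by simp
    fix e :: real assume e: "e > 0"
    have "\<forall>\<^sub>F r in at_right 0. ennreal (1 / r\<^sup>2) * Psi r < ennreal (L + e)"
      using Psi_over_square_tendsto L e by (intro order_tendstoD(2)[of _ L_inf]) (auto simp: ennreal_less_iff simp del: ennreal_plus)
    moreover have "\<forall>\<^sub>F r in at_right 0. ennreal (L - e) \<le> ennreal (1 / r\<^sup>2) * Psi r"
    proof (cases "L - e \<ge> 0")
      case True
      then have "ennreal (L - e) < L_inf" using e by (simp add: L ennreal_less_iff)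
      then have "\<forall>\<^sub>F r in at_right 0. ennreal (L - e) < ennreal (1 / r\<^sup>2) * Psi r"
        by (rule order_tendstoD(1)[OF Psi_over_square_tendsto])
      then show ?thesis by eventually_elim simp
    qed (simp add: ennreal_neg)
    ultimately have "\<forall>\<^sub>F r in at_right 0. ennreal (L - e) \<le> ennreal (1 / r\<^sup>2) * Psi r \<and>
        ennreal (1 / r\<^sup>2) * Psi r \<le> ennreal (L + e)"
      by eventually_elim simp
    then obtain b where b: "b > 0" "\<And>r. 0 < r \<Longrightarrow> r < b \<Longrightarrow> ennreal (L - e) \<le> ennreal (1 / r\<^sup>2) * Psi r \<and>
        ennreal (1 / r\<^sup>2) * Psi r \<le> ennreal (L + e)"
      unfolding eventually_at_right_field by auto
    \<comment> \<open>The bounds hold for \<open>r < b\<close>, whereas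
      \<open>mellin_limit_1\<close> wants a closed condition \<open>r \<le> d\<close>; hence
      \<open>d = b / 2\<close>.\<close>
    have "ennreal ((L - e) * r\<^sup>2) \<le> Psi r \<and> Psi r \<le> ennreal ((L + e) * r\<^sup>2)" if r: "0 < r" "r \<le> b / 2" for r
    proof -
      have cancel: "ennreal (r\<^sup>2) * (ennreal (1 / r\<^sup>2) * Psi r) = Psi r"
        using r by (simp add: mult.assoc[symmetric] ennreal_mult[symmetric])
      have q: "ennreal (L - e) \<le> ennreal (1 / r\<^sup>2) * Psi r" "ennreal (1 / r\<^sup>2) * Psi r \<le> ennreal (L + e)"
        using b r by auto
      have "ennreal (r\<^sup>2) * ennreal (L - e) \<le> Psi r"
        using mult_left_mono[OF q(1), of "ennreal (r\<^sup>2)"] unfolding cancel by simp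
      moreover have "Psi r \<le> ennreal (r\<^sup>2) * ennreal (L + e)"
        using mult_left_mono[OF q(2), of "ennreal (r\<^sup>2)"] unfolding cancel by simp
      ultimately show ?thesis by (simp only: ennreal_mult''[OF zero_le_power2] mult.commute)
    qed
    then show "\<exists>d>0. \<forall>r. 0 < r \<longrightarrow> r \<le> d \<longrightarrow>
        ennreal ((L - e) * r\<^sup>2) \<le> Psi r \<and> Psi r \<le> ennreal ((L + e) * r\<^sup>2)"
      using b(1) by (intro exI[of _ "b / 2"]) auto
  qed (use L in simp_all)
qed

lemma D_norm_limit_0:
  assumes Ur: "U = ennreal Ur" "Ur \<ge> 0"
  shows "((\<lambda>s. ennreal s * D_norm_sq G N s u) \<longlongrightarrow> ennreal (Ur * mass)) (at_right 0)"
proof -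
  obtain C where C: "C \<ge> 0" "\<And>r. 0 < r \<Longrightarrow> r \<le> 1 \<Longrightarrow> Psi r \<le> ennreal (C * r\<^sup>2)"
    using Psi_le_square by blast
  have "((\<lambda>s. ennreal s * (\<integral>\<^sup>+r. ennreal (r powr (- 1 - 2 * s)) * Psi r * indicator {0<..} r \<partial>lborel)) \<longlongrightarrow>
      ennreal (2 * Ur * mass / 2)) (at_right 0)"
  proof (rule mellin_limit_0)
    \<comment> \<open>\<open>Psi\<close> is known to be constant only for \<open>r > 2 * R0\<close>;
      the added \<open>1\<close> makes this hold from the splitting radius on.\<close>
    show "0 < 2 * R0 + 1" using R0(1) by simp
    \<comment> \<open>\<open>C\<close> serves for \<open>r \<le> 1\<close>; for \<open>r > 1\<close>
      the uniform bound \<open>4 * Ur * mass\<close> on \<open>Psi\<close> is at most itself times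
      \<open>r\<^sup>2\<close>.\<close>
    show "0 \<le> max C (4 * Ur * mass)" using C by simp
    show "Psi r = ennreal (2 * Ur * mass)" if "2 * R0 + 1 \<le> r" for r
      using Psi_far[of r] that Ur by (simp add: ennreal_mult)
    show "Psi r \<le> ennreal (max C (4 * Ur * mass) * r\<^sup>2)" if r: "0 < r" "r \<le> 2 * R0 + 1" for r
    proof (cases "r \<le> 1")
      case True
      have "Psi r \<le> ennreal (C * r\<^sup>2)" by (rule C(2)[OF r(1) True])
      also have "\<dots> \<le> ennreal (max C (4 * Ur * mass) * r\<^sup>2)"
        by (intro ennreal_leI mult_right_mono) auto
      finally show ?thesis .
    next
      case False
      have "Psi r \<le> ennreal (4 * Ur * mass)" using Psi_le[of r] Ur by (simp add: ennreal_mult)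
      also have "\<dots> \<le> ennreal (max C (4 * Ur * mass) * r\<^sup>2)"
      proof (rule ennreal_leI)
        have "1 \<le> r\<^sup>2" using False by (simp add: one_le_power)
        then have "max C (4 * Ur * mass) * 1 \<le> max C (4 * Ur * mass) * r\<^sup>2"
          using C(1) by (intro mult_left_mono) auto
        then show "4 * Ur * mass \<le> max C (4 * Ur * mass) * r\<^sup>2" by linarith
      qed
      finally show ?thesis .
    qed
  qed (use Ur in simp_all)
  then show ?thesis unfolding D_norm_sq_eq_Psi by simp
qed

end

section \<open>Second moments of the surface measure\<close>

text \<open>\<open>T\<close> composed with itself is the identity, so its determinant squares to
  \<open>1\<close>; no determinant of a reflection or a transposition has to be evaluated.\<close>

lemma integral_lborel_involution:
  fixes T :: "'a::euclidean_space \<Rightarrow> 'a" and f :: "'a \<Rightarrow> real"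
  assumes T: "linear T" "\<And>x. T (T x) = x" and [measurable]: "f \<in> borel_measurable borel"
  shows "(LBINT x. f (T x)) = (LBINT x. f x)"
proof -
  have "linear_det T * linear_det T = 1"
    using linear_det_compose[OF T(1) T(1)] by (simp add: T(2) linear_det_id)
  then have det: "\<bar>linear_det T\<bar> = 1"
    by (metis abs_mult abs_mult_self_eq abs_one mult.right_neutral power2_eq_1_iff power2_eq_square abs_minus_cancel)
  have bl: "bounded_linear T" using T(1) by (simp add: linear_conv_bounded_linear)
  then have [measurable]: "T \<in> borel_measurable borel"
    by (intro borel_measurable_continuous_onI linear_continuous_on)
  have "distr lborel borel T = lborel"
  proof (rule lborel_distr_bij)
    show "(T has_derivative T) (at x)" for x using bl by (rule bounded_linear_imp_has_derivative)
    show "bij T" by (rule o_bij[of T]) (simp_all add: o_def fun_eq_iff T(2))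
  qed (rule det)
  then have "(LBINT x. f x) = (LINT x|distr lborel borel T. f x)" by simp
  also have "\<dots> = (LBINT x. f (T x))" by (rule integral_distr) measurable
  finally show ?thesis by simp
qed

locale radial_homogeneous_group = polar_homogeneous_group G N \<sigma>
  for G :: "('g, 'a::euclidean_space) homogeneous_group_data" and N :: "'g \<Rightarrow> real" and \<sigma> :: "'g measure" +
  assumes radial: "radial_first_coords G N"
begin

text \<open>Where the sum of squares vanishes the radial formula says nothing, but there both points
  have zero first coordinates and coincide. Elsewhere \<open>F\<close> depends only on data that
  agree.\<close>

lemma nn_cong_radial:
  assumes tail: "\<And>k. k \<in> {num_first G<..DIM('a)} \<Longrightarrow> xc k y = xc k x"
    and sum: "(\<Sum>i = 1..num_first G. (xc i y)\<^sup>2) = (\<Sum>i = 1..num_first G. (xc i x)\<^sup>2)"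
  shows "nn y = nn x"
proof (cases "(\<Sum>i = 1..num_first G. (xc i x)\<^sup>2) = 0")
  case True
  then have *: "xc i x = 0 \<and> xc i y = 0" if "i \<in> {1..num_first G}" for i
    using that sum by (simp add: sum_nonneg_eq_0_iff)
  have "y = x"
  proof (rule xc_eqI)
    fix i assume "i \<in> {1..DIM('a)}"
    then show "xc i y = xc i x"
      using *[of i] tail[of i] by (cases "i \<le> num_first G") auto
  qed
  then show ?thesis by simp
next
  case False
  obtain F :: "'a \<Rightarrow> real \<Rightarrow> real" where F: "\<And>g. g \<in> carrier G \<Longrightarrow> (\<Sum>i = 1..num_first G. (coord G i g)\<^sup>2) \<noteq> 0 \<Longrightarrow>
      N g = F (\<Sum>j\<in>{num_first G<..DIM('a)}. coord G j g *\<^sub>R frame G j) (\<Sum>i = 1..num_first G. (coord G i g)\<^sup>2)"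
    using radial unfolding radial_first_coords_def by blast
  have "nn z = F (\<Sum>j\<in>{num_first G<..DIM('a)}. xc j z *\<^sub>R frame G j) (\<Sum>i = 1..num_first G. (xc i z)\<^sup>2)"
    if "(\<Sum>i = 1..num_first G. (xc i z)\<^sup>2) \<noteq> 0" for z
    using F[of "exp_map G z"] that by (simp add: nn_def xc_def)
  moreover have "(\<Sum>j\<in>{num_first G<..DIM('a)}. xc j y *\<^sub>R frame G j) = (\<Sum>j\<in>{num_first G<..DIM('a)}. xc j x *\<^sub>R frame G j)"
    by (intro sum.cong) (auto simp: tail)
  ultimately show ?thesis using False sum by simp
qed

lemma first_index: "i \<in> {1..num_first G} \<Longrightarrow> i \<in> {1..DIM('a)}"
  using num_first_le by auto

section \<open>Symmetries of the homogeneous norm\<close>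

definition reflection :: "nat \<Rightarrow> 'a \<Rightarrow> 'a" where
  "reflection i v = v - (2 * xc i v) *\<^sub>R frame G i"

text \<open>For \<open>i \<noteq> j\<close> this is the transposition of two coordinates, written as
  a rank-one change of the identity so that it makes sense without a choice of coordinates on the
  domain.\<close>

definition swap :: "nat \<Rightarrow> nat \<Rightarrow> 'a \<Rightarrow> 'a" where
  "swap i j v = v + (xc j v - xc i v) *\<^sub>R (frame G i - frame G j)"

lemma xc_reflection:
  "i \<in> {1..DIM('a)} \<Longrightarrow> k \<in> {1..DIM('a)} \<Longrightarrow> xc k (reflection i v) = (if k = i then - xc k v else xc k v)"
  by (simp add: reflection_def linear_diff[OF linear_xc] linear_cmul[OF linear_xc] xc_frame)

lemma xc_swap:
  assumes "i \<in> {1..DIM('a)}" "j \<in> {1..DIM('a)}" "i \<noteq> j" "k \<in> {1..DIM('a)}"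
  shows "xc k (swap i j v) = (if k = i then xc j v else if k = j then xc i v else xc k v)"
  using assms
  by (simp add: swap_def linear_add[OF linear_xc] linear_diff[OF linear_xc] linear_cmul[OF linear_xc] xc_frame)

lemma linear_reflection: "linear (reflection i)"
  unfolding reflection_def
  by (intro linearI)
    (simp_all add: linear_add[OF linear_xc] linear_cmul[OF linear_xc] algebra_simps scaleR_add_left)

lemma linear_swap: "linear (swap i j)"
  unfolding swap_def
  by (intro linearI)
    (simp_all add: linear_add[OF linear_xc] linear_cmul[OF linear_xc] algebra_simps)

lemma reflection_reflection: "i \<in> {1..DIM('a)} \<Longrightarrow> reflection i (reflection i v) = v"
  by (rule xc_eqI) (simp add: xc_reflection)

lemma swap_swap: "i \<in> {1..DIM('a)} \<Longrightarrow> j \<in> {1..DIM('a)} \<Longrightarrow> i \<noteq> j \<Longrightarrow> swap i j (swap i j v) = v"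
  by (rule xc_eqI) (simp add: xc_swap)

lemma nn_reflection:
  assumes i: "i \<in> {1..num_first G}"
  shows "nn (reflection i v) = nn v"
proof (rule nn_cong_radial)
  show "xc k (reflection i v) = xc k v" if "k \<in> {num_first G<..DIM('a)}" for k
    using that i first_index[OF i] by (subst xc_reflection) auto
  show "(\<Sum>k = 1..num_first G. (xc k (reflection i v))\<^sup>2) = (\<Sum>k = 1..num_first G. (xc k v)\<^sup>2)"
    using first_index[OF i] first_index by (intro sum.cong) (auto simp: xc_reflection)
qed

lemma nn_swap:
  assumes i: "i \<in> {1..num_first G}" and j: "j \<in> {1..num_first G}" and ij: "i \<noteq> j"
  shows "nn (swap i j v) = nn v"
proof (rule nn_cong_radial)
  note ij' = first_index[OF i] first_index[OF j] ij
  show "xc k (swap i j v) = xc k v" if "k \<in> {num_first G<..DIM('a)}" for k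
    using that i j by (subst xc_swap[OF ij']) auto
  let ?A = "{1..num_first G}"
  have split: "(\<Sum>k\<in>?A. f k) = f i + (f j + (\<Sum>k\<in>?A - {i} - {j}. f k))" for f :: "nat \<Rightarrow> real"
    using i j ij sum.remove[of ?A i f] sum.remove[of "?A - {i}" j f] by simp
  have "(\<Sum>k\<in>?A - {i} - {j}. (xc k (swap i j v))\<^sup>2) = (\<Sum>k\<in>?A - {i} - {j}. (xc k v)\<^sup>2)"
    using first_index by (intro sum.cong) (auto simp: xc_swap[OF ij'])
  then show "(\<Sum>k\<in>?A. (xc k (swap i j v))\<^sup>2) = (\<Sum>k\<in>?A. (xc k v)\<^sup>2)"
    unfolding split using ij' by (simp add: xc_swap[OF ij'])
qed

section \<open>Second moments over the sphere and over the ball\<close>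

definition moment :: "nat \<Rightarrow> nat \<Rightarrow> real" where
  "moment i j = (LINT x|\<sigma>c. xc i x * xc j x)"

text \<open>A substitute for \<open>moment\<close> on which the symmetries act directly: they
  preserve Lebesgue measure and the ball, while the surface measure is accessible only through polar
  coordinates.\<close>

definition ball_moment :: "nat \<Rightarrow> nat \<Rightarrow> real" where
  "ball_moment i j = (LBINT x. indicator {x. nn x \<le> 1} x * (xc i x * xc j x))"

lemma xc_bounded_ball: "\<exists>C\<ge>0. \<forall>x i j. i \<in> {1..DIM('a)} \<longrightarrow> j \<in> {1..DIM('a)} \<longrightarrow> nn x \<le> 1 \<longrightarrow> \<bar>xc i x * xc j x\<bar> \<le> C"
proof -
  obtain C where C: "C \<ge> 0" "\<And>j v. j \<in> {1..DIM('a)} \<Longrightarrow> \<bar>xc j v\<bar> \<le> C * norm v"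
    using xc_bound by blast
  obtain E where E: "\<And>x. nn x \<le> 1 \<Longrightarrow> norm x \<le> E"
    using bounded_nn_le[of 1] unfolding bounded_iff by blast
  have "\<bar>xc j v\<bar> \<le> C * E" if "j \<in> {1..DIM('a)}" "nn v \<le> 1" for j v
    using C(2)[OF that(1), of v] mult_left_mono[OF E[OF that(2)] C(1)] by linarith
  then have "\<bar>xc i x * xc j x\<bar> \<le> \<bar>C * E\<bar> * \<bar>C * E\<bar>"
    if "i \<in> {1..DIM('a)}" "j \<in> {1..DIM('a)}" "nn x \<le> 1" for i j x
    using that unfolding abs_mult by (intro mult_mono) (auto intro: order_trans[OF _ abs_ge_self] simp: abs_mult[symmetric])
  then show ?thesis by (intro exI[of _ "\<bar>C * E\<bar> * \<bar>C * E\<bar>"]) auto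
qed

lemma integrable_moment:
  assumes "i \<in> {1..DIM('a)}" "j \<in> {1..DIM('a)}"
  shows "integrable \<sigma>c (\<lambda>x. xc i x * xc j x)"
proof -
  obtain C where C: "\<And>x. nn x \<le> 1 \<Longrightarrow> \<bar>xc i x * xc j x\<bar> \<le> C"
    using xc_bounded_ball assms by blast
  have "AE x in \<sigma>c. norm (xc i x * xc j x) \<le> C"
    using AE_\<sigma>c by eventually_elim (use C in simp)
  then show ?thesis by (rule \<sigma>c.integrable_const_bound) measurable
qed

lemma integrable_ball_moment:
  assumes "i \<in> {1..DIM('a)}" "j \<in> {1..DIM('a)}"
  shows "integrable lborel (\<lambda>x. indicator {x. nn x \<le> 1} x * (xc i x * xc j x))"
proof -
  obtain C where C: "C \<ge> 0" "\<And>x. nn x \<le> 1 \<Longrightarrow> \<bar>xc i x * xc j x\<bar> \<le> C"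
    using xc_bounded_ball assms by blast
  have "integrable lborel (\<lambda>x. C * indicator {x. nn x \<le> 1} x)"
    using emeasure_nn_le[of 1] by (intro integrable_mult_right integrable_real_indicator) auto
  then show ?thesis
    by (rule Bochner_Integration.integrable_bound) (use C in \<open>auto simp: indicator_def\<close>)
qed

text \<open>The constant is \<open>1 / (Q + 2)\<close>.\<close>

lemma ball_moment_eq:
  "\<exists>c. \<forall>i\<in>{1..num_first G}. \<forall>j\<in>{1..num_first G}. ball_moment i j = c * moment i j"
proof -
  \<comment> \<open>The factor \<open>r * r\<close> comes from dilating two coordinates of weight
    one, the indicator from cutting off at the unit ball.\<close>
  define k where "k r = indicator {0<..} r * (indicator {..1} r * (r * r * r powr (hom_dim G - 1)))" for r :: real
  have "ball_moment i j = (LBINT r. k r) * moment i j"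
    if i: "i \<in> {1..num_first G}" and j: "j \<in> {1..num_first G}" for i j
  proof -
    note ij = first_index[OF i] first_index[OF j]
    have "ball_moment i j = (LINT r:{0<..}|lborel. (LINT x|\<sigma>c.
        (indicator {x. nn x \<le> 1} (dl r x) * (xc i (dl r x) * xc j (dl r x))) * r powr (hom_dim G - 1)))"
      unfolding ball_moment_def by (rule polar_integral[OF integrable_ball_moment[OF ij]])
    also have "\<dots> = (LBINT r. k r * moment i j)"
      unfolding set_lebesgue_integral_def
    proof (rule Bochner_Integration.integral_cong)
      fix r :: real
      have "(LINT x|\<sigma>c. (indicator {x. nn x \<le> 1} (dl r x) * (xc i (dl r x) * xc j (dl r x))) * r powr (hom_dim G - 1)) =
          (LINT x|\<sigma>c. (indicator {..1} r * (r * r * r powr (hom_dim G - 1))) * (xc i x * xc j x))" if r: "r > 0"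
      proof (rule integral_cong_AE)
        show "AE x in \<sigma>c. (indicator {x. nn x \<le> 1} (dl r x) * (xc i (dl r x) * xc j (dl r x))) * r powr (hom_dim G - 1) =
            (indicator {..1} r * (r * r * r powr (hom_dim G - 1))) * (xc i x * xc j x)"
          using AE_\<sigma>c
          by eventually_elim
            (use r in \<open>simp add: indicator_def nn_dl xc_dl[OF ij(1)] xc_dl[OF ij(2)] weight_eq_one[OF i] weight_eq_one[OF j]\<close>)
      qed (measurable)
      also have "\<dots> = (indicator {..1} r * (r * r * r powr (hom_dim G - 1))) * moment i j"
        unfolding moment_def by (rule integral_mult_right_zero)
      finally show "indicator {0<..} r *\<^sub>R (LINT x|\<sigma>c. (indicator {x. nn x \<le> 1} (dl r x) *
          (xc i (dl r x) * xc j (dl r x))) * r powr (hom_dim G - 1)) = k r * moment i j"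
        by (cases "r > 0") (simp_all add: k_def)
    qed simp
    also have "\<dots> = (LBINT r. k r) * moment i j" by (rule integral_mult_left_zero)
    finally show ?thesis .
  qed
  then show ?thesis by blast
qed

lemma ball_moment_off_diagonal:
  assumes i: "i \<in> {1..num_first G}" and j: "j \<in> {1..num_first G}" and ij: "i \<noteq> j"
  shows "ball_moment i j = 0"
proof -
  note ij' = first_index[OF i] first_index[OF j]
  have "ball_moment i j = (LBINT x. indicator {x. nn x \<le> 1} (reflection i x) * (xc i (reflection i x) * xc j (reflection i x)))"
    unfolding ball_moment_def
    by (rule integral_lborel_involution[symmetric]) (simp_all add: linear_reflection reflection_reflection[OF ij'(1)])
  also have "\<dots> = (LBINT x. - (indicator {x. nn x \<le> 1} x * (xc i x * xc j x)))"
    using ij by (intro Bochner_Integration.integral_cong)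
      (simp_all add: indicator_def nn_reflection[OF i] xc_reflection[OF ij'(1) ij'(1)] xc_reflection[OF ij'(1) ij'(2)])
  also have "\<dots> = - ball_moment i j" by (simp add: ball_moment_def)
  finally show ?thesis by simp
qed

lemma ball_moment_diagonal:
  assumes i: "i \<in> {1..num_first G}" and j: "j \<in> {1..num_first G}"
  shows "ball_moment i i = ball_moment j j"
proof (cases "i = j")
  case ij: False
  note ij' = first_index[OF i] first_index[OF j]
  have "ball_moment i i = (LBINT x. indicator {x. nn x \<le> 1} (swap i j x) * (xc i (swap i j x) * xc i (swap i j x)))"
    unfolding ball_moment_def
    by (rule integral_lborel_involution[symmetric]) (simp_all add: linear_swap swap_swap[OF ij' ij])
  also have "\<dots> = ball_moment j j"
    unfolding ball_moment_def
    by (intro Bochner_Integration.integral_cong)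
      (simp_all add: indicator_def nn_swap[OF i j ij] xc_swap[OF ij' ij ij'(1)])
  finally show ?thesis .
qed simp

text \<open>The integrand is nonnegative, and it is positive on a nonempty open set, which cannot be
  a null set.\<close>

lemma ball_moment_pos: "ball_moment 1 1 > 0"
proof -
  have one: "1 \<in> {1..DIM('a)}" using one_le_DIM by simp
  let ?f = "\<lambda>x. indicator {x. nn x \<le> 1} x * (xc 1 x * xc 1 x)"
  have nonneg: "ball_moment 1 1 \<ge> 0"
    unfolding ball_moment_def by (intro Bochner_Integration.integral_nonneg) auto
  have "ball_moment 1 1 \<noteq> 0"
  proof
    assume "ball_moment 1 1 = 0"
    then have "AE x in lborel. ?f x = 0"
      unfolding ball_moment_def
      by (subst (asm) integral_nonneg_eq_0_iff_AE[OF integrable_ball_moment[OF one one]]) auto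
    then have ae: "AE x in lborel. x \<notin> {x. nn x < 1 \<and> xc 1 x \<noteq> 0}"
      by eventually_elim (auto simp: indicator_def)
    define S where "S = {x. nn x < 1 \<and> xc 1 x \<noteq> 0}"
    have "open S"
      unfolding S_def
      by (intro open_Collect_conj open_Collect_less open_Collect_neq continuous_intros)
    then have "S \<in> null_sets lborel"
      using ae by (subst AE_iff_null_sets) (auto simp: S_def)
    then have "negligible S"
      by (simp add: negligible_iff_null_sets null_sets_completionI)
    moreover have "S \<noteq> {}"
    proof -
      define v where "v = frame G 1"
      have v: "xc 1 v = 1" using one by (simp add: v_def xc_frame)
      then have "v \<noteq> 0" using linear_0[OF linear_xc] by auto
      then have pos: "nn v > 0" using nn_nonneg[of v] nn_eq_0[of v] by linarith
      \<comment> \<open>Dilating \<open>X_1\<close> to norm \<open>1 / 2\<close> puts it inside the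
        open unit ball and keeps its first coordinate nonzero.\<close>
      then have "nn (dl (1 / (2 * nn v)) v) = 1 / 2" using \<open>v \<noteq> 0\<close> by (simp add: nn_dl)
      moreover have "xc 1 (dl (1 / (2 * nn v)) v) \<noteq> 0"
        using pos v \<open>v \<noteq> 0\<close> by (simp add: xc_dl[OF one])
      ultimately have "dl (1 / (2 * nn v)) v \<in> S" by (simp add: S_def)
      then show ?thesis by blast
    qed
    ultimately show False using open_not_negligible \<open>open S\<close> by blast
  qed
  with nonneg show ?thesis by simp
qed

lemma one_first: "1 \<in> {1..num_first G}"
  using num_first_pos by simp

text \<open>The symmetries of the ball moments pass to the sphere because the proportionality
  constant \<open>c\<close> is nonzero, and that follows from
  \<open>c * moment 1 1 = ball_moment 1 1 > 0\<close> without evaluating \<open>c\<close>.\<close>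

lemma first_moment_sum: "first_moment G \<sigma> = real (num_first G) * moment 1 1"
  and moment_eq: "i \<in> {1..num_first G} \<Longrightarrow> j \<in> {1..num_first G} \<Longrightarrow>
    moment i j = (if i = j then moment 1 1 else 0)"
  and moment_nonzero: "moment 1 1 \<noteq> 0"
proof -
  obtain c where c: "\<And>i j. i \<in> {1..num_first G} \<Longrightarrow> j \<in> {1..num_first G} \<Longrightarrow> ball_moment i j = c * moment i j"
    using ball_moment_eq by blast
  have "c * moment 1 1 \<noteq> 0" using c[OF one_first one_first] ball_moment_pos by (metis order_less_irrefl)
  then have ne: "moment 1 1 \<noteq> 0" and "c \<noteq> 0" by auto
  show "moment 1 1 \<noteq> 0" by (rule ne)
  show eq: "moment i j = (if i = j then moment 1 1 else 0)"
    if "i \<in> {1..num_first G}" "j \<in> {1..num_first G}" for i j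
    using c[OF that] c[OF one_first one_first] \<open>c \<noteq> 0\<close>
      ball_moment_off_diagonal[OF that] ball_moment_diagonal[OF that(1) one_first] by auto
  have "first_moment G \<sigma> = (LINT x|\<sigma>c. (\<Sum>i = 1..num_first G. xc i x * xc i x))"
    by (simp add: first_moment_eq power2_eq_square)
  also have "\<dots> = (\<Sum>i = 1..num_first G. moment i i)"
    unfolding moment_def by (rule Bochner_Integration.integral_sum) (intro integrable_moment first_index)
  also have "\<dots> = (\<Sum>i = 1..num_first G. moment 1 1)" by (intro sum.cong refl) (subst eq, auto)
  finally show "first_moment G \<sigma> = real (num_first G) * moment 1 1" by simp
qed

lemma moment_pos: "moment 1 1 > 0"
proof -
  have "moment 1 1 \<ge> 0" unfolding moment_def by (intro Bochner_Integration.integral_nonneg) auto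
  then show ?thesis using moment_nonzero by simp
qed

text \<open>A null surface measure would annihilate \<open>moment 1 1\<close>. Positivity is what
  makes the division by \<open>sphere_mass\<close> legitimate.\<close>

lemma sphere_mass_pos: "measure \<sigma>c UNIV > 0"
proof (rule ccontr)
  assume "\<not> measure \<sigma>c UNIV > 0"
  then have "emeasure \<sigma>c UNIV = 0" by (simp add: \<sigma>c.emeasure_eq_measure measure_nonneg order_antisym)
  then have "AE x in \<sigma>c. xc 1 x * xc 1 x = 0"
    by (intro AE_I[of _ _ UNIV]) auto
  then have "moment 1 1 = 0" unfolding moment_def by (rule integral_eq_zero_AE)
  then show False using moment_nonzero by simp
qed

end

section \<open>The limits with their normalising constants\<close>

locale radial_test_fun = radial_homogeneous_group G N \<sigma> + polar_test_fun G N \<sigma> u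
  for G :: "('g, 'a::euclidean_space) homogeneous_group_data" and N :: "'g \<Rightarrow> real" and \<sigma> :: "'g measure"
    and u :: "'g \<Rightarrow> real"
begin

text \<open>A quadratic form in the first coordinates is averaged over the sphere; as the moment
  matrix is a multiple of the identity, only the squares of the individual derivatives
  remain.\<close>

lemma sphere_average_DX:
  "(\<integral>\<^sup>+x. ennreal ((DX (horizontal x) h)\<^sup>2) \<partial>\<sigma>c) =
    ennreal (moment 1 1 * (\<Sum>i = 1..num_first G. (DX (frame G i) h)\<^sup>2))"
proof -
  define a where "a i = DX (frame G i) h" for i
  let ?A = "{1..num_first G}"
  have sq: "(DX (horizontal x) h)\<^sup>2 = (\<Sum>i\<in>?A. \<Sum>j\<in>?A. a i * a j * (xc i x * xc j x))" for x
    unfolding DX_horizontal power2_eq_square sum_product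
    by (intro sum.cong refl) (simp add: a_def mult_ac)
  have int: "integrable \<sigma>c (\<lambda>x. a i * a j * (xc i x * xc j x))" if "i \<in> ?A" "j \<in> ?A" for i j
    using that by (intro integrable_mult_right integrable_moment first_index)
  have int_sq: "integrable \<sigma>c (\<lambda>x. (DX (horizontal x) h)\<^sup>2)"
    unfolding sq by (intro Bochner_Integration.integrable_sum int)
  have "(\<integral>\<^sup>+x. ennreal ((DX (horizontal x) h)\<^sup>2) \<partial>\<sigma>c) = ennreal (LINT x|\<sigma>c. (DX (horizontal x) h)\<^sup>2)"
    by (rule nn_integral_eq_integral[OF int_sq]) simp
  also have "(LINT x|\<sigma>c. (DX (horizontal x) h)\<^sup>2) = (\<Sum>i\<in>?A. \<Sum>j\<in>?A. a i * a j * moment i j)"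
  proof -
    have "(LINT x|\<sigma>c. (DX (horizontal x) h)\<^sup>2) =
        (\<Sum>i\<in>?A. LINT x|\<sigma>c. (\<Sum>j\<in>?A. a i * a j * (xc i x * xc j x)))"
      unfolding sq
      by (rule Bochner_Integration.integral_sum) (intro Bochner_Integration.integrable_sum int)
    also have "\<dots> = (\<Sum>i\<in>?A. \<Sum>j\<in>?A. LINT x|\<sigma>c. a i * a j * (xc i x * xc j x))"
      by (intro sum.cong refl Bochner_Integration.integral_sum int)
    finally show ?thesis by (simp add: moment_def)
  qed
  also have "\<dots> = (\<Sum>i\<in>?A. \<Sum>j\<in>?A. if i = j then a i * a i * moment 1 1 else 0)"
    by (intro sum.cong refl) (subst moment_eq, auto)
  also have "\<dots> = moment 1 1 * (\<Sum>i\<in>?A. (a i)\<^sup>2)"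
    by (simp add: sum_distrib_left power2_eq_square mult_ac)
  finally show ?thesis by (simp add: a_def)
qed

lemma L_inf_eq: "L_inf = ennreal (moment 1 1) * (\<integral>\<^sup>+h. ennreal (\<Sum>i = 1..num_first G. (DX (frame G i) h)\<^sup>2) \<partial>lborel)"
proof -
  interpret pair_sigma_finite \<sigma>c lborel
    by (rule pair_sigma_finite.intro) (simp_all add: \<sigma>c.sigma_finite_measure_axioms sigma_finite_lborel)
  have "L_inf = (\<integral>\<^sup>+h. (\<integral>\<^sup>+x. ennreal ((DX (horizontal x) h)\<^sup>2) \<partial>\<sigma>c) \<partial>lborel)"
    unfolding L_inf_def by (rule Fubini'[symmetric]) measurable
  also have "\<dots> = (\<integral>\<^sup>+h. ennreal (moment 1 1) * ennreal (\<Sum>i = 1..num_first G. (DX (frame G i) h)\<^sup>2) \<partial>lborel)"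
    unfolding sphere_average_DX using moment_pos by (simp add: ennreal_mult sum_nonneg)
  also have "\<dots> = ennreal (moment 1 1) * (\<integral>\<^sup>+h. ennreal (\<Sum>i = 1..num_first G. (DX (frame G i) h)\<^sup>2) \<partial>lborel)"
    by (rule nn_integral_cmult) measurable
  finally show ?thesis .
qed

text \<open>Here \<open>L_inf\<close> is \<open>moment 1 1\<close> times the energy
  \<open>T\<close>, of which the Mellin limit retains half. Since \<open>first_moment\<close> is
  \<open>m\<close> times \<open>moment 1 1\<close>, the prefactor is \<open>2 / moment 1 1\<close>
  times \<open>1 - s\<close> and cancels both constants. Compact support makes \<open>T\<close>
  finite, as the real limit lemma requires.\<close>

lemma limit_one:
  "((\<lambda>s. ennreal (2 * real (num_first G) * (1 - s) / first_moment G \<sigma>) * D_norm_sq G N s u) \<longlongrightarrow>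
    (\<integral>\<^sup>+g. ennreal (\<Sum>i = 1..num_first G. \<bar>left_field G (frame G i) u g\<bar>\<^sup>2) \<partial>haar G)) (at_left 1)"
proof -
  define T where "T = (\<integral>\<^sup>+h. ennreal (\<Sum>i = 1..num_first G. (DX (frame G i) h)\<^sup>2) \<partial>lborel)"
  have "T < \<infinity>"
    unfolding T_def by (rule nn_integral_compact_finite)
      (auto intro!: continuous_intros continuous_DX simp: DX_zero)
  then obtain t where t: "T = ennreal t" "t \<ge> 0" by (cases T) auto
  have rhs: "(\<integral>\<^sup>+g. ennreal (\<Sum>i = 1..num_first G. \<bar>left_field G (frame G i) u g\<bar>\<^sup>2) \<partial>haar G) = T"
    unfolding T_def by (subst nn_integral_haar_chart) (simp_all add: left_field_eq_DX)
  have pos: "moment 1 1 > 0" "num_first G > 0" using moment_pos num_first_pos by simp_all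
  have lim: "((\<lambda>s. ennreal (2 / moment 1 1) * (ennreal (1 - s) * D_norm_sq G N s u)) \<longlongrightarrow>
      ennreal (2 / moment 1 1) * ennreal (moment 1 1 * t / 2)) (at_left 1)"
    by (intro ennreal_tendsto_cmult D_norm_limit_1)
      (use pos t in \<open>simp_all add: L_inf_eq T_def[symmetric] ennreal_mult\<close>)
  have eq: "ennreal (2 / moment 1 1) * ennreal (moment 1 1 * t / 2) = T"
    using pos t by (simp add: ennreal_mult[symmetric])
  have ev: "\<forall>\<^sub>F s in at_left 1. ennreal (2 / moment 1 1) * (ennreal (1 - s) * D_norm_sq G N s u) =
      ennreal (2 * real (num_first G) * (1 - s) / first_moment G \<sigma>) * D_norm_sq G N s u"
    using eventually_at_left_real[of 0 1, OF zero_less_one]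
  proof eventually_elim
    case (elim s)
    have "2 / moment 1 1 * (1 - s) = 2 * real (num_first G) * (1 - s) / first_moment G \<sigma>"
      using pos by (simp add: first_moment_sum)
    moreover have "ennreal (2 / moment 1 1) * ennreal (1 - s) = ennreal (2 / moment 1 1 * (1 - s))"
      using elim pos by (intro ennreal_mult[symmetric]) auto
    ultimately show ?case by (simp add: mult.assoc[symmetric])
  qed
  show ?thesis
    using Lim_transform_eventually[OF lim ev] unfolding eq rhs .
qed

lemma limit_zero:
  "((\<lambda>s. ennreal (s / sphere_mass \<sigma>) * D_norm_sq G N s u) \<longlongrightarrow> (\<integral>\<^sup>+g. ennreal (\<bar>u g\<bar>\<^sup>2) \<partial>haar G)) (at_right 0)"
proof -
  obtain t where t: "U = ennreal t" "t \<ge> 0" using U_finite by (cases U) auto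
  have rhs: "(\<integral>\<^sup>+g. ennreal (\<bar>u g\<bar>\<^sup>2) \<partial>haar G) = U"
    unfolding U_def by (subst nn_integral_haar_chart) (simp_all add: w_def[symmetric])
  have mass: "sphere_mass \<sigma> = mass" by (simp add: sphere_mass_eq)
  have lim: "((\<lambda>s. ennreal (1 / mass) * (ennreal s * D_norm_sq G N s u)) \<longlongrightarrow>
      ennreal (1 / mass) * ennreal (t * mass)) (at_right 0)"
    by (intro ennreal_tendsto_cmult D_norm_limit_0 t) simp
  have eq: "ennreal (1 / mass) * ennreal (t * mass) = U"
    using sphere_mass_pos t by (simp add: ennreal_mult[symmetric])
  have ev: "\<forall>\<^sub>F s in at_right 0. ennreal (1 / mass) * (ennreal s * D_norm_sq G N s u) =
      ennreal (s / sphere_mass \<sigma>) * D_norm_sq G N s u"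
    using eventually_at_right_less[of "0::real"]
  proof eventually_elim
    case (elim s)
    have "ennreal (1 / mass) * ennreal s = ennreal (s / sphere_mass \<sigma>)"
      using elim by (simp add: ennreal_mult[symmetric] mass)
    then show ?case by (simp add: mult.assoc[symmetric])
  qed
  show ?thesis
    using Lim_transform_eventually[OF lim ev] unfolding eq rhs .
qed

end

theorem proposition3p7:
  fixes G :: "('g, 'a::euclidean_space) homogeneous_group_data"
    and N :: "'g \<Rightarrow> real"
    and \<sigma> :: "'g measure"
    and u :: "'g \<Rightarrow> real"
    and m :: nat
  assumes "homogeneous_group G"
    and "homogeneous_norm G N"
    and "surface_measure G N \<sigma>"
    and "m = num_first G"
    and "radial_first_coords G N"
    and "test_fun G u"
  shows "((\<lambda>s. ennreal (2 * real m * (1 - s) / first_moment G \<sigma>) * D_norm_sq G N s u) \<longlongrightarrow>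
            (\<integral>\<^sup>+g. ennreal (\<Sum>i = 1..m. \<bar>left_field G (frame G i) u g\<bar>\<^sup>2) \<partial>haar G)) (at_left 1) \<and>
         ((\<lambda>s. ennreal (s / sphere_mass \<sigma>) * D_norm_sq G N s u) \<longlongrightarrow>
            (\<integral>\<^sup>+g. ennreal (\<bar>u g\<bar>\<^sup>2) \<partial>haar G)) (at_right 0)"
proof -
  interpret homogeneous_group G by fact
  interpret radial_test_fun G N \<sigma> u
    by unfold_locales fact+
  show ?thesis using limit_one limit_zero assms(4) by simp
qed

end
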